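(* Let $d\ge1$ and $L\ge2$ be integers. (i) For any fixed value of the parameter $s\in\mathbb C$, the commutation relations $$[t_{ij}(w;s),t_{kl}(\widetilde w;s)]=c_1\tau_1(s)+\dots+c_m\tau_m(s),\qquad 1\le i,j,k,l\le d,\quad w,\widetilde w\in W_L,$$ described in the context, are defining relations of the algebra $Y_{d,L}$ with generators $t_{ij}(w;s)$, $1\le i,j\le d$, $w\in W_L$. (ii) The additive group $\mathbb C$ acts on the algebra $Y_{d,L}$ by automorphisms $\operatorname{Shift}_c$, $c\in\mathbb C$, such that, for all $1\le i,j\le d$, $w\in W_L$ and $s\in\mathbb C$, $$\operatorname{Shift}_c(t_{ij}(w;s))=t_{ij}(w;s+c),\qquad c\in\mathbb C.$$ (iii) The automorphisms $\operatorname{Shift}_c$ preserve the filtration $Y_{d,L}=\bigcup_n Y_{d,L}^{(n)}$ induced by the filtration $A_{d,L}=\bigcup_n A^{(n)}_{d,L}$ of the ambient algebra $A_{d,L}$.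
   Context: The ground field is $\mathbb C$; algebras are associative and unital. $\mathfrak{gl}(N,\mathbb C)$ has the basis of matrix units $E_{ij}$; $E_{ij\mid\alpha}$ is $E_{ij}$ in the $\alpha$-th copy in $\mathfrak{gl}(N,\mathbb C)^{\oplus L}$, $\alpha\in[L]=\{1,\dots,L\}$. $U(\cdot)$ is the universal enveloping algebra with its standard filtration. For $0\le d\le N$, $\mathfrak{gl}_d(N,\mathbb C)$ is the span of $E_{ij}$ with $d<i,j\le N$; $\operatorname{diag}$ is the diagonal embedding into $\mathfrak{gl}(N,\mathbb C)^{\oplus L}$. $A_{d,L}(N):=U(\mathfrak{gl}(N,\mathbb C)^{\oplus L})^{\operatorname{diag}\mathfrak{gl}_d(N,\mathbb C)}$ (centralizer). Let $I^+(N)$ be the left ideal of $U(\mathfrak{gl}(N,\mathbb C)^{\oplus L})$ generated by all $E_{iN\mid\alpha}$, $1\le i\le N$, $\alpha\in[L]$. Then $J(N):=A_{N-1,L}(N)\cap I^+(N)$ is a two-sided ideal of $A_{N-1,L}(N)$ and $A_{N-1,L}(N)=U(\mathfrak{gl}(N-1,\mathbb C)^{\oplus L})\oplus J(N)$. The projection $\pi_{N,N-1}$ onto the first summand is a filtration-preserving algebra morphism and maps $A_{d,L}(N)$ into $A_{d,L}(N-1)$ for $d\le N-1$. $A_{d,L}:=\varprojlim(A_{d,L}(N),\pi_{N,N-1})$ in the category of filtered algebras: elements are sequences $(x_N)_{N\ge\max(d,1)}$, $x_N\in A_{d,L}(N)$, with $\pi_{N,N-1}(x_N)=x_{N-1}$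 and uniformly bounded degrees; $A_{d,L}^{(n)}$ consists of those with all $\deg x_N\le n$. $W_L$ is the set of nonempty words in the alphabet $[L]$; $\ell(w)$ is the length of $w$. Let $u_1,\dots,u_L$ be free noncommuting variables, commuting with coefficients, $\bar u(w)=u_{w_1}^{-1}\cdots u_{w_n}^{-1}$ for $w=w_1\dots w_n$, and $E(N)_\alpha=[E_{ij\mid\alpha}]_{i,j=1}^N$. For $s\in\mathbb C$ define $t_{ij}(w;N;s)\in U(\mathfrak{gl}(N,\mathbb C)^{\oplus L})$ by (with $(u_\alpha+c)^{-1}=\sum_{k\ge0}(-c)^ku_\alpha^{-k-1}$) $$\Bigl(\bigl(1-\sum_{\alpha=1}^L\tfrac{E(N)_\alpha}{u_\alpha+N+s}\bigr)^{-1}\Bigr)_{ij}=\delta_{ij}+\sum_{w\in W_L}t_{ij}(w;N;s)\,\bar u(w).$$ For $1\le i,j\le d\le N$ these lie in $A_{d,L}(N)$ and are consistent with the projections $\pi_{N,N-1}$, so they define $t_{ij}(w;s)\in A_{d,L}$. $Y_{d,L}$ is the subalgebra of $A_{d,L}$ generated by all $t_{ij}(w;s)$, $1\le i,j\le d$, $w\in W_L$, for a fixed $s$; it does not depend on $s$. $Y_{d,L}^{(n)}=Y_{d,L}\cap A_{d,L}^{(n)}$. The commutation relations. Fix an arbitrary total order on the set of triples $(i,j;w)\in\mathbb Z_{\ge1}\times\mathbb Z_{\ge1}\times W_L$. A product of elements $t_{ab}(z;s)$ (with the same $s$) is a normal monomial if its factors are written in weakly increasing order of their triples $(a,b;z)$;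 $:\!xy\!:$ denotes the normal monomial obtained by reordering the two factors $x,y$. The degree of a monomial is the sum of the lengths of the words involved. For any $i,j,k,l$ and any $w,\widetilde w\in W_L$ there are finitely many pairwise distinct normal monomials $\tau_1(s),\dots,\tau_m(s)$ (the index triples of their factors not depending on $s$), of degree at most $\ell(w)+\ell(\widetilde w)-1$ and of the form $$t_{ij}(\cdot;s),\ t_{kl}(\cdot;s),\ t_{il}(\cdot;s),\ t_{kj}(\cdot;s),\ :\!t_{ij}(\cdot;s)t_{kl}(\cdot;s)\!:,\ :\!t_{il}(\cdot;s)t_{kj}(\cdot;s)\!:$$ (dots standing for nonempty words), and integers $c_1,\dots,c_m$ not depending on $s$, such that $[t_{ij}(w;s),t_{kl}(\widetilde w;s)]=c_1\tau_1(s)+\dots+c_m\tau_m(s)$ for all $s\in\mathbb C$. Distinct normal monomials are linearly independent, so this expression (with nonzero coefficients) is unique. These are the relations referred to in (i). *)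

theory Defs
  imports Complex_Main "HOL-Library.Poly_Mapping" "HOL-Algebra.Algebra"
begin

section \<open>Free associative algebras, quotients, presentations\<close>

datatype 'g fmon = Mon (letters: "'g list")

instantiation fmon :: (type) monoid_add
begin
definition zero_fmon :: "'a fmon" where "0 = Mon []"
definition plus_fmon :: "'a fmon \<Rightarrow> 'a fmon \<Rightarrow> 'a fmon"
  where "x + y = Mon (letters x @ letters y)"
instance by standard (simp_all add: zero_fmon_def plus_fmon_def)
end

text \<open>The free monoid on \<^typ>\<open>'g\<close>, written additively so that \<^typ>\<open>'g fmon \<Rightarrow>\<^sub>0 complex\<close>
  with the convolution product of \<^theory>\<open>HOL-Library.Poly_Mapping\<close> is the free associative
  unital complex algebra on \<^typ>\<open>'g\<close>.\<close>

type_synonym 'g falg = "'g fmon \<Rightarrow>\<^sub>0 complex"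

definition fmono :: "'g list \<Rightarrow> 'g falg"
  where "fmono xs = Poly_Mapping.single (Mon xs) 1"

abbreviation gen :: "'g \<Rightarrow> 'g falg"
  where "gen x \<equiv> fmono [x]"

definition fscale :: "complex \<Rightarrow> 'g falg \<Rightarrow> 'g falg"
  where "fscale c p = Poly_Mapping.single 0 c * p"

text \<open>Algebras are records of type \<^typ>\<open>(complex, 'a) module\<close>: the ring record of HOL-Algebra extended by
  a scalar multiplication (multiplication need not be commutative).\<close>

definition free_alg :: "'g set \<Rightarrow> (complex, 'g falg) module"
  where "free_alg V =
    \<lparr>carrier = {p. \<forall>m\<in>Poly_Mapping.keys p. set (letters m) \<subseteq> V},
     monoid.mult = (*), one = 1, ring.zero = 0, ring.add = (+), smult = fscale\<rparr>"

definition quot_alg :: "(complex, 'a) module \<Rightarrow> 'a set \<Rightarrow> (complex, 'a set) module"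
  where "quot_alg A I = ring.extend (A Quot I)
    (module.fields (\<lambda>c Z. \<Union>x\<in>Z. I +>\<^bsub>A\<^esub> (c \<odot>\<^bsub>A\<^esub> x)))"

definition alg_hom :: "(complex, 'a) module \<Rightarrow> (complex, 'b) module \<Rightarrow> ('a \<Rightarrow> 'b) set"
  where "alg_hom A B = {h \<in> ring_hom A B. \<forall>c. \<forall>x\<in>carrier A. h (c \<odot>\<^bsub>A\<^esub> x) = c \<odot>\<^bsub>B\<^esub> h x}"

definition alg_aut :: "(complex, 'a) module \<Rightarrow> ('a \<Rightarrow> 'a) set"
  where "alg_aut A = {h \<in> alg_hom A A. bij_betw h (carrier A) (carrier A)}"

definition subalg_gen :: "(complex, 'a) module \<Rightarrow> 'a set \<Rightarrow> 'a set"
  where "subalg_gen A S = \<Inter>{B. subring B A \<and> (\<forall>c. \<forall>x\<in>B. c \<odot>\<^bsub>A\<^esub> x \<in> B) \<and> S \<subseteq> B}"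

definition left_idl :: "('a, 'm) ring_scheme \<Rightarrow> 'a set \<Rightarrow> 'a set"
  where "left_idl R S = \<Inter>{I. additive_subgroup I R \<and>
    (\<forall>a\<in>carrier R. \<forall>x\<in>I. a \<otimes>\<^bsub>R\<^esub> x \<in> I) \<and> S \<subseteq> I}"

text \<open>\<open>rels\<close> are defining relations of \<open>A\<close> with generators \<open>g x\<close>, \<open>x \<in> G\<close>: the canonical
  homomorphism from the free algebra on \<open>G\<close> is onto, and its kernel is the two-sided ideal
  generated by \<open>rels\<close>.\<close>

definition defining_relations ::
    "(complex, 'a) module \<Rightarrow> 'g set \<Rightarrow> ('g \<Rightarrow> 'a) \<Rightarrow> 'g falg set \<Rightarrow> bool"
  where "defining_relations A G g rels \<longleftrightarrow>
    rels \<subseteq> carrier (free_alg G) \<and>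
    (\<exists>\<phi>\<in>alg_hom (free_alg G) A.
       (\<forall>x\<in>G. \<phi> (gen x) = g x) \<and>
       \<phi> ` carrier (free_alg G) = carrier A \<and>
       a_kernel (free_alg G) A \<phi> = Idl\<^bsub>free_alg G\<^esub> rels)"

section \<open>Universal enveloping algebras\<close>

record 'a lie_algebra = "'a partial_object" +
  lie_add :: "'a \<Rightarrow> 'a \<Rightarrow> 'a"
  lie_scale :: "complex \<Rightarrow> 'a \<Rightarrow> 'a"
  lie_bracket :: "'a \<Rightarrow> 'a \<Rightarrow> 'a"

text \<open>The first two families of relations cut the free algebra on the set \<open>carrier g\<close> down to
  the tensor algebra of the vector space \<open>g\<close>.\<close>

definition env_ideal :: "'a lie_algebra \<Rightarrow> 'a falg set"
  where "env_ideal g = Idl\<^bsub>free_alg (carrier g)\<^esub>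
    ({gen (lie_add g x y) - gen x - gen y | x y. x \<in> carrier g \<and> y \<in> carrier g} \<union>
     {gen (lie_scale g c x) - fscale c (gen x) | c x. x \<in> carrier g} \<union>
     {gen x * gen y - gen y * gen x - gen (lie_bracket g x y) | x y.
        x \<in> carrier g \<and> y \<in> carrier g})"

definition env :: "'a lie_algebra \<Rightarrow> (complex, 'a falg set) module"
  where "env g = quot_alg (free_alg (carrier g)) (env_ideal g)"

definition env_proj :: "'a lie_algebra \<Rightarrow> 'a falg \<Rightarrow> 'a falg set"
  where "env_proj g p = env_ideal g +>\<^bsub>free_alg (carrier g)\<^esub> p"

definition env_in :: "'a lie_algebra \<Rightarrow> 'a \<Rightarrow> 'a falg set"
  where "env_in g x = env_proj g (gen x)"

definition env_filt :: "'a lie_algebra \<Rightarrow> nat \<Rightarrow> 'a falg set set"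
  where "env_filt g n = env_proj g `
    {p \<in> carrier (free_alg (carrier g)). \<forall>m\<in>Poly_Mapping.keys p. length (letters m) \<le> n}"

text \<open>For a Lie subalgebra \<open>h\<close> of \<open>g\<close> the canonical map from \<open>U(h)\<close> to \<open>U(g)\<close> (which does not
  depend on \<open>h\<close> when written on cosets) sends the coset \<open>Z\<close> to the coset of \<open>env_ideal g\<close>
  containing it.\<close>

definition env_incl :: "'a lie_algebra \<Rightarrow> 'a falg set \<Rightarrow> 'a falg set"
  where "env_incl g Z = env_ideal g <+>\<^bsub>free_alg (carrier g)\<^esub> Z"

section \<open>Centralizers in the enveloping algebra of a sum of copies of gl(N)\<close>

text \<open>An element of the sum of \<open>L\<close> copies of \<open>gl(N)\<close> is a function \<open>x\<close>, where \<open>x \<alpha> i j\<close> is the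
  \<open>(i, j)\<close> entry of its \<open>\<alpha>\<close>-th component, all indices starting from 1 and all other values
  being 0. So the algebras for smaller \<open>N\<close> are literally subsets of those for larger \<open>N\<close>.\<close>

type_synonym gl_elem = "nat \<Rightarrow> nat \<Rightarrow> nat \<Rightarrow> complex"

definition gl :: "nat \<Rightarrow> nat \<Rightarrow> gl_elem lie_algebra"
  where "gl L N =
    \<lparr>carrier = {x. \<forall>\<alpha> i j. x \<alpha> i j \<noteq> 0 \<longrightarrow> \<alpha> \<in> {1..L} \<and> i \<in> {1..N} \<and> j \<in> {1..N}},
     lie_add = (\<lambda>x y \<alpha> i j. x \<alpha> i j + y \<alpha> i j),
     lie_scale = (\<lambda>c x \<alpha> i j. c * x \<alpha> i j),
     lie_bracket = (\<lambda>x y \<alpha> i j.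
       (\<Sum>k=1..N. x \<alpha> i k * y \<alpha> k j) - (\<Sum>k=1..N. y \<alpha> i k * x \<alpha> k j))\<rparr>"

abbreviation UgL :: "nat \<Rightarrow> nat \<Rightarrow> (complex, gl_elem falg set) module"
  where "UgL L N \<equiv> env (gl L N)"

definition munit :: "nat \<Rightarrow> nat \<Rightarrow> nat \<Rightarrow> gl_elem"
  where "munit i j \<alpha> = (\<lambda>\<beta> k l. if \<beta> = \<alpha> \<and> k = i \<and> l = j then 1 else 0)"

definition UE :: "nat \<Rightarrow> nat \<Rightarrow> nat \<Rightarrow> nat \<Rightarrow> nat \<Rightarrow> gl_elem falg set"
  where "UE L N i j \<alpha> = env_in (gl L N) (munit i j \<alpha>)"

text \<open>\<open>gl\<^sub>d(N)\<close>, as complex matrices.\<close>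

definition gl_sub :: "nat \<Rightarrow> nat \<Rightarrow> (nat \<Rightarrow> nat \<Rightarrow> complex) set"
  where "gl_sub d N = {a. \<forall>i j. a i j \<noteq> 0 \<longrightarrow> d < i \<and> i \<le> N \<and> d < j \<and> j \<le> N}"

definition diag_emb :: "nat \<Rightarrow> (nat \<Rightarrow> nat \<Rightarrow> complex) \<Rightarrow> gl_elem"
  where "diag_emb L a = (\<lambda>\<alpha> i j. if \<alpha> \<in> {1..L} then a i j else 0)"

definition centr :: "nat \<Rightarrow> nat \<Rightarrow> nat \<Rightarrow> gl_elem falg set set"
  where "centr d L N = {x \<in> carrier (UgL L N). \<forall>a\<in>gl_sub d N.
    env_in (gl L N) (diag_emb L a) \<otimes>\<^bsub>UgL L N\<^esub> x = x \<otimes>\<^bsub>UgL L N\<^esub> env_in (gl L N) (diag_emb L a)}"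

definition Iplus :: "nat \<Rightarrow> nat \<Rightarrow> gl_elem falg set set"
  where "Iplus L N = left_idl (UgL L N) {UE L N i N \<alpha> | i \<alpha>. i \<in> {1..N} \<and> \<alpha> \<in> {1..L}}"

definition Jideal :: "nat \<Rightarrow> nat \<Rightarrow> gl_elem falg set set"
  where "Jideal L N = centr (N - 1) L N \<inter> Iplus L N"

text \<open>The projection of \<open>A\<^sub>N\<^sub>-\<^sub>1\<^sub>,\<^sub>L(N)\<close> onto \<open>U(gl(N-1)\<^sup>L)\<close> along \<^term>\<open>Jideal L N\<close>, for \<open>N \<ge> 1\<close>.\<close>

definition centr_proj :: "nat \<Rightarrow> nat \<Rightarrow> gl_elem falg set \<Rightarrow> gl_elem falg set"
  where "centr_proj L N x = (THE y. y \<in> carrier (UgL L (N - 1)) \<and>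
    x \<ominus>\<^bsub>UgL L N\<^esub> env_incl (gl L N) y \<in> Jideal L N)"

section \<open>The projective limit\<close>

type_synonym lim_elem = "nat \<Rightarrow> gl_elem falg set"

definition lim_index :: "nat \<Rightarrow> nat set"
  where "lim_index d = {max d 1..}"

definition Alim_filt :: "nat \<Rightarrow> nat \<Rightarrow> nat \<Rightarrow> lim_elem set"
  where "Alim_filt d L n = {x \<in> (\<Pi>\<^sub>E N\<in>lim_index d. centr d L N).
    (\<forall>N. N \<in> lim_index d \<and> N - 1 \<in> lim_index d \<longrightarrow> centr_proj L N (x N) = x (N - 1)) \<and>
    (\<forall>N\<in>lim_index d. x N \<in> env_filt (gl L N) n)}"

definition Alim :: "nat \<Rightarrow> nat \<Rightarrow> (complex, lim_elem) module"
  where "Alim d L =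
    \<lparr>carrier = (\<Union>n. Alim_filt d L n),
     monoid.mult = (\<lambda>x y. \<lambda>N\<in>lim_index d. x N \<otimes>\<^bsub>UgL L N\<^esub> y N),
     one = (\<lambda>N\<in>lim_index d. \<one>\<^bsub>UgL L N\<^esub>),
     ring.zero = (\<lambda>N\<in>lim_index d. \<zero>\<^bsub>UgL L N\<^esub>),
     ring.add = (\<lambda>x y. \<lambda>N\<in>lim_index d. x N \<oplus>\<^bsub>UgL L N\<^esub> y N),
     smult = (\<lambda>c x. \<lambda>N\<in>lim_index d. c \<odot>\<^bsub>UgL L N\<^esub> x N)\<rparr>"

section \<open>The generators\<close>

definition words0 :: "nat \<Rightarrow> nat list set"
  where "words0 L = lists {1..L}"

definition words :: "nat \<Rightarrow> nat list set"
  where "words L = {w \<in> words0 L. w \<noteq> []}"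

text \<open>Formal power series in the noncommuting variables \<open>u\<^sub>1\<^sup>-\<^sup>1, \<dots>, u\<^sub>L\<^sup>-\<^sup>1\<close>, which commute with the
  coefficients; a series is the family of its coefficients, indexed by (possibly empty) words.\<close>

definition ncseries :: "nat \<Rightarrow> ('a, 'm) ring_scheme \<Rightarrow> (nat list \<Rightarrow> 'a) ring"
  where "ncseries L R =
    \<lparr>carrier = (\<Pi>\<^sub>E w\<in>words0 L. carrier R),
     monoid.mult = (\<lambda>F G. \<lambda>w\<in>words0 L. \<Oplus>\<^bsub>R\<^esub>k\<in>{0..length w}. F (take k w) \<otimes>\<^bsub>R\<^esub> G (drop k w)),
     one = (\<lambda>w\<in>words0 L. if w = [] then \<one>\<^bsub>R\<^esub> else \<zero>\<^bsub>R\<^esub>),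
     ring.zero = (\<lambda>w\<in>words0 L. \<zero>\<^bsub>R\<^esub>),
     ring.add = (\<lambda>F G. \<lambda>w\<in>words0 L. F w \<oplus>\<^bsub>R\<^esub> G w)\<rparr>"

definition matrix_ring :: "nat \<Rightarrow> ('a, 'm) ring_scheme \<Rightarrow> (nat \<times> nat \<Rightarrow> 'a) ring"
  where "matrix_ring n R =
    \<lparr>carrier = (\<Pi>\<^sub>E ij\<in>{1..n} \<times> {1..n}. carrier R),
     monoid.mult = (\<lambda>A B. \<lambda>(i, j)\<in>{1..n} \<times> {1..n}. \<Oplus>\<^bsub>R\<^esub>k\<in>{1..n}. A (i, k) \<otimes>\<^bsub>R\<^esub> B (k, j)),
     one = (\<lambda>(i, j)\<in>{1..n} \<times> {1..n}. if i = j then \<one>\<^bsub>R\<^esub> else \<zero>\<^bsub>R\<^esub>),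
     ring.zero = (\<lambda>(i, j)\<in>{1..n} \<times> {1..n}. \<zero>\<^bsub>R\<^esub>),
     ring.add = (\<lambda>A B. \<lambda>(i, j)\<in>{1..n} \<times> {1..n}. A (i, j) \<oplus>\<^bsub>R\<^esub> B (i, j))\<rparr>"

abbreviation series_matrices ::
    "nat \<Rightarrow> nat \<Rightarrow> (nat \<times> nat \<Rightarrow> nat list \<Rightarrow> gl_elem falg set) ring"
  where "series_matrices L N \<equiv> matrix_ring N (ncseries L (UgL L N))"

text \<open>The matrix \<open>E(N)\<^sub>\<alpha> (u\<^sub>\<alpha> + c)\<^sup>-\<^sup>1\<close>: the coefficient of \<open>u\<^sub>\<alpha>\<^sup>-\<^sup>k\<^sup>-\<^sup>1\<close> in its \<open>(i, j)\<close> entry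
  is \<open>(-c)\<^sup>k E\<^sub>i\<^sub>j\<^sub>|\<^sub>\<alpha>\<close>.\<close>

definition Eseries ::
    "nat \<Rightarrow> nat \<Rightarrow> complex \<Rightarrow> nat \<Rightarrow> nat \<times> nat \<Rightarrow> nat list \<Rightarrow> gl_elem falg set"
  where "Eseries L N c \<alpha> = (\<lambda>(i, j)\<in>{1..N} \<times> {1..N}. \<lambda>w\<in>words0 L.
    if w \<noteq> [] \<and> set w \<subseteq> {\<alpha>} then (- c) ^ (length w - 1) \<odot>\<^bsub>UgL L N\<^esub> UE L N i j \<alpha>
    else \<zero>\<^bsub>UgL L N\<^esub>)"

type_synonym triple = "nat \<times> nat \<times> nat list"

definition tN :: "nat \<Rightarrow> nat \<Rightarrow> complex \<Rightarrow> triple \<Rightarrow> gl_elem falg set"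
  where "tN L N s = (\<lambda>(i, j, w).
    (inv\<^bsub>series_matrices L N\<^esub> (\<one>\<^bsub>series_matrices L N\<^esub> \<ominus>\<^bsub>series_matrices L N\<^esub>
       (\<Oplus>\<^bsub>series_matrices L N\<^esub>\<alpha>\<in>{1..L}. Eseries L N (of_nat N + s) \<alpha>))) (i, j) w)"

definition tlim :: "nat \<Rightarrow> nat \<Rightarrow> complex \<Rightarrow> triple \<Rightarrow> lim_elem"
  where "tlim d L s x = (\<lambda>N\<in>lim_index d. tN L N s x)"

definition gens :: "nat \<Rightarrow> nat \<Rightarrow> triple set"
  where "gens d L = {1..d} \<times> {1..d} \<times> words L"

definition Yalg :: "nat \<Rightarrow> nat \<Rightarrow> complex \<Rightarrow> (complex, lim_elem) module"
  where "Yalg d L s = (Alim d L)\<lparr>carrier := subalg_gen (Alim d L) (tlim d L s ` gens d L)\<rparr>"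

definition Yfilt :: "nat \<Rightarrow> nat \<Rightarrow> complex \<Rightarrow> nat \<Rightarrow> lim_elem set"
  where "Yfilt d L s n = carrier (Yalg d L s) \<inter> Alim_filt d L n"

section \<open>The commutation relations\<close>

definition all_triples :: "nat \<Rightarrow> triple set"
  where "all_triples L = {1..} \<times> {1..} \<times> words L"

definition normal_pair :: "triple rel \<Rightarrow> triple \<Rightarrow> triple \<Rightarrow> triple list"
  where "normal_pair ord x y = (if (x, y) \<in> ord then [x, y] else [y, x])"

definition mon_degree :: "triple list \<Rightarrow> nat"
  where "mon_degree m = (\<Sum>(a, b, z)\<leftarrow>m. length z)"

text \<open>A normal monomial is represented by the list of the triples of its factors. These are the
  ones which may occur in the commutator of \<open>t\<^sub>i\<^sub>j(w; s)\<close> and \<open>t\<^sub>k\<^sub>l(w'; s)\<close>.\<close>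

definition allowed_monomials :: "nat \<Rightarrow> triple rel \<Rightarrow> triple \<Rightarrow> triple \<Rightarrow> triple list set"
  where "allowed_monomials L ord = (\<lambda>(i, j, w) (k, l, w').
    {m. mon_degree m \<le> length w + length w' - 1 \<and>
        ((\<exists>z\<in>words L. m = [(i, j, z)] \<or> m = [(k, l, z)] \<or> m = [(i, l, z)] \<or> m = [(k, j, z)]) \<or>
         (\<exists>z\<in>words L. \<exists>z'\<in>words L. m = normal_pair ord (i, j, z) (k, l, z') \<or>
                                  m = normal_pair ord (i, l, z) (k, j, z')))})"

definition mon_eval :: "(complex, 'a) module \<Rightarrow> ('g \<Rightarrow> 'a) \<Rightarrow> 'g list \<Rightarrow> 'a"
  where "mon_eval A g m = foldr (\<lambda>x y. g x \<otimes>\<^bsub>A\<^esub> y) m \<one>\<^bsub>A\<^esub>"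

text \<open>The right-hand side \<open>c\<^sub>1 \<tau>\<^sub>1(s) + \<dots> + c\<^sub>m \<tau>\<^sub>m(s)\<close>, with nonzero \<open>c\<^sub>i\<close> and pairwise distinct
  normal monomials, is encoded by a finitely supported function \<open>r\<close> from monomials to integers;
  it is the same for all \<open>s\<close>.\<close>

definition is_comm_relation ::
    "nat \<Rightarrow> nat \<Rightarrow> triple rel \<Rightarrow> triple \<Rightarrow> triple \<Rightarrow> (triple list \<Rightarrow>\<^sub>0 int) \<Rightarrow> bool"
  where "is_comm_relation d L ord x y r \<longleftrightarrow>
    Poly_Mapping.keys r \<subseteq> allowed_monomials L ord x y \<and>
    (\<forall>s. tlim d L s x \<otimes>\<^bsub>Alim d L\<^esub> tlim d L s y \<ominus>\<^bsub>Alim d L\<^esub> tlim d L s y \<otimes>\<^bsub>Alim d L\<^esub> tlim d L s x =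
      (\<Oplus>\<^bsub>Alim d L\<^esub>m\<in>Poly_Mapping.keys r.
        of_int (Poly_Mapping.lookup r m) \<odot>\<^bsub>Alim d L\<^esub> mon_eval (Alim d L) (tlim d L s) m))"

definition comm_relations :: "nat \<Rightarrow> nat \<Rightarrow> triple rel \<Rightarrow> triple falg set"
  where "comm_relations d L ord =
    {gen x * gen y - gen y * gen x
       - (\<Sum>m\<in>Poly_Mapping.keys r. fscale (of_int (Poly_Mapping.lookup r m)) (fmono m)) | x y r.
     x \<in> gens d L \<and> y \<in> gens d L \<and> is_comm_relation d L ord x y r}"

definition additive_C :: "complex monoid"
  where "additive_C = \<lparr>carrier = UNIV, monoid.mult = (+), one = 0\<rparr>"

end

theory Submission
  imports Defs
begin

text \<open>
Modulo the commutation relations every polynomial in the generators is a combination of normal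
monomials. So the relations are defining, and their right-hand sides are unique, as soon as the
relations hold and normal monomials are linearly independent in the limit.

\<^bold>\<open>The model.\<close> Let \<open>A\<close> be an associative algebra and let \<open>x \<in> A\<close> act on the symmetric algebra of \<open>A\<close>
by multiplication by \<open>x\<close> plus the derivation that extends left multiplication by \<open>x\<close>. This is an
action of the Lie algebra \<open>A\<close>. With matrix units for all sizes and all copies it provides one algebra
\<open>U\<close> of operators into which every \<open>U(gl(N)\<^sup>L)\<close> maps. An operator applied to the polynomial \<open>1\<close> has
the symbol of the operator as its leading part; this gives the Poincare-Birkhoff-Witt theorem in the
form that an element is determined by its value on \<open>1\<close> (\<open>ev_lie_app_eq_0\<close>). Left multiplication keeps
the column of a matrix unit. Hence elements of \<open>I\<^sup>+(N)\<close> map \<open>1\<close> into the ideal of the last column,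
which contains no nonzero polynomial in the other columns, and so the projection from size \<open>N\<close> to
size \<open>N - 1\<close> is well defined on the elements that matter (\<open>centr_proj_eq\<close>).

\<^bold>\<open>Relations.\<close> Put \<open>c = N + s\<close>. The coefficients of the inverse matrix obey a recursion in the first
letter of the word (\<open>tU\<close>). It yields the commutator of a matrix unit with a generator, which does not
involve \<open>c\<close> (\<open>E_tU_comm\<close>). From this follow the membership in the centralizer, the fact that removing
the last row and column lowers \<open>c\<close> by \<open>1\<close> modulo \<open>I\<^sup>+(N)\<close> (\<open>tU_project\<close>), and, for \<open>c = 0\<close> and by
induction on the length, commutation relations with coefficients independent of \<open>N\<close>
(\<open>comm_upto_Suc\<close>). A relation that holds for \<open>c = 0\<close> and all \<open>N\<close> descends along the projections to
\<open>c = -1, -2, \<dots>\<close>; being polynomial in \<open>c\<close>, it holds for all \<open>c\<close> (\<open>relation_all_parameters\<close>). This is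
why the structure constants do not depend on \<open>s\<close>.

\<^bold>\<open>Independence.\<close> The symbol of a generator \<open>t\<^sub>i\<^sub>j(w; s)\<close> is the sum over the paths from \<open>i\<close> to \<open>j\<close> that
read \<open>w\<close>, in the complete graph with labelled weighted edges. For large \<open>N\<close> the weights can be chosen
so that finitely many of these sums take prescribed values (\<open>path_sym_path_point\<close>), so normal monomials
of the same degree have linearly independent symbols (\<open>normal_independent\<close>). The same argument shows
that an element of \<open>Y\<close> has filtration degree at most \<open>n\<close> only if its normal form has
(\<open>normal_filtration\<close>).

\<^bold>\<open>Shifts.\<close> The generator \<open>t(w; s + c)\<close> is a combination of generators \<open>t(v; s)\<close> with coefficients
depending on \<open>c\<close> only (\<open>tU_shift\<close>), so \<open>Y\<close> does not depend on \<open>s\<close>. The relations do not depend on \<open>s\<close>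
either; therefore replacing \<open>s\<close> by \<open>s + c\<close> in polynomials in the generators is a well defined
automorphism, and it does not change the degree of a normal form.
\<close>


abbreviation lk where "lk \<equiv> Poly_Mapping.lookup"
abbreviation ks where "ks \<equiv> Poly_Mapping.keys"
abbreviation sng where "sng \<equiv> Poly_Mapping.single"

section \<open>Free algebras and evaluation of noncommutative polynomials\<close>

lemma fmono_mult: "fmono xs * fmono ys = fmono (xs @ ys)"
  by (simp add: fmono_def mult_single plus_fmon_def)

lemma fmono_Nil: "fmono [] = 1"
  by (simp add: fmono_def flip: zero_fmon_def)

lemma fscale_fmono: "fscale c (fmono xs) = sng (Mon xs) c"
  by (simp add: fscale_def fmono_def mult_single)

lemma lookup_single_mult: "lk (sng 0 c * p) m = c * lk (p :: 'a::monoid_add \<Rightarrow>\<^sub>0 'b::semiring_1) m"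
proof -
  have "lk (Poly_Mapping.map ((*) c) p) m = c * lk p m"
    by (simp add: map.rep_eq when_def)
  then show ?thesis by (simp add: mult_map_scale_conv_mult)
qed

lemma lookup_fscale: "lk (fscale c p) m = c * lk p m"
  by (simp add: fscale_def lookup_single_mult)

lemma keys_fscale: "ks (fscale c p) \<subseteq> ks p"
  by (auto simp: in_keys_iff lookup_fscale)

lemma falg_expand: "p = (\<Sum>m\<in>ks p. fscale (lk p m) (fmono (letters m)))"
  by (rule poly_mapping_eqI)
    (auto simp: fscale_fmono lookup_sum lookup_single when_def in_keys_iff)

lemma single0_comm: "sng 0 c * (x :: 'g falg) = x * sng 0 c"
proof -
  have "sng 0 c * (\<Sum>m\<in>ks x. sng (Mon (letters m)) (lk x m)) = (\<Sum>m\<in>ks x. sng (Mon (letters m)) (lk x m)) * sng 0 c"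
    unfolding sum_distrib_left sum_distrib_right by (intro sum.cong refl) (simp add: mult_single mult.commute)
  then show ?thesis using falg_expand[of x] by (simp only: fscale_fmono)
qed

text \<open>Algebras whose scalars act through a central homomorphism from the complex numbers. Polynomials are
evaluated in the operator algebra and in other free algebras alike.\<close>

locale calg =
  fixes cst :: "complex \<Rightarrow> 'a::ring_1"
  assumes cst_add: "cst (a + b) = cst a + cst b"
    and cst_mult: "cst (a * b) = cst a * cst b"
    and cst_1: "cst 1 = 1"
    and cst_comm: "cst a * x = x * cst a"
begin

lemma cst_0: "cst 0 = 0"
  using cst_add[of 0 0] by simp

lemma cst_uminus: "cst (- a) = - cst a"
  using cst_add[of a "- a"] by (simp add: cst_0 eq_neg_iff_add_eq_0 add.commute)

lemma cst_diff: "cst (a - b) = cst a - cst b"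
  using cst_add[of a "- b"] by (simp add: cst_uminus)

lemma cst_sum: "cst (sum f A) = (\<Sum>x\<in>A. cst (f x))"
  by (induction A rule: infinite_finite_induct) (auto simp: cst_0 cst_add)

lemma cst_of_nat: "cst (of_nat n) = of_nat n"
  by (induction n) (auto simp: cst_0 cst_add cst_1)

definition ev :: "('g \<Rightarrow> 'a) \<Rightarrow> 'g falg \<Rightarrow> 'a"
  where "ev g p = (\<Sum>m\<in>ks p. cst (lk p m) * prod_list (map g (letters m)))"

lemma ev_superset:
  assumes "finite A" "ks p \<subseteq> A"
  shows "ev g p = (\<Sum>m\<in>A. cst (lk p m) * prod_list (map g (letters m)))"
  unfolding ev_def by (rule sum.mono_neutral_left) (use assms in \<open>auto simp: in_keys_iff cst_0\<close>)

lemma ev_0: "ev g 0 = 0"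
  by (simp add: ev_def)

lemma ev_add: "ev g (p + q) = ev g p + ev g q"
proof -
  have *: "finite (ks p \<union> ks q)" by simp
  show ?thesis
    by (simp add: ev_superset[OF *, of "p + q"] ev_superset[OF *, of p] ev_superset[OF *, of q]
        Poly_Mapping.keys_add lookup_add cst_add distrib_right sum.distrib)
qed

lemma ev_fscale: "ev g (fscale c p) = cst c * ev g p"
  using ev_superset[OF _ keys_fscale, of p g c]
  by (simp add: ev_def lookup_fscale cst_mult sum_distrib_left mult.assoc)

lemma ev_uminus: "ev g (- p) = - ev g p"
  using ev_add[of g p "- p"] by (simp add: ev_0 eq_neg_iff_add_eq_0 add.commute)

lemma ev_diff: "ev g (p - q) = ev g p - ev g q"
  using ev_add[of g p "- q"] by (simp add: ev_uminus)

lemma ev_sum: "ev g (sum f A) = (\<Sum>x\<in>A. ev g (f x))"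
  by (induction A rule: infinite_finite_induct) (auto simp: ev_0 ev_add)

lemma ev_fmono: "ev g (fmono xs) = prod_list (map g xs)"
  by (simp add: ev_def fmono_def cst_1)

lemma ev_gen: "ev g (gen x) = g x"
  by (simp add: ev_fmono)

lemma ev_1: "ev g 1 = 1"
  using ev_fmono[of g "[]"] by (simp add: fmono_Nil)

lemma ev_mult: "ev g (p * q) = ev g p * ev g q"
proof -
  have fs: "fscale c x * fscale d y = fscale (c * d) (x * y)" for c d and x y :: "'g falg"
  proof -
    have "sng 0 (c * d) = sng 0 c * (sng 0 d :: 'g falg)" by (simp add: mult_single)
    then show ?thesis
      unfolding fscale_def by (metis mult.assoc single0_comm)
  qed
  have "p * q = (\<Sum>m\<in>ks p. \<Sum>n\<in>ks q. fscale (lk p m * lk q n) (fmono (letters m @ letters n)))"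
    using arg_cong2[OF falg_expand[of p] falg_expand[of q], of "(*)"]
    by (simp only: sum_product fs fmono_mult)
  then have "ev g (p * q) = (\<Sum>m\<in>ks p. \<Sum>n\<in>ks q. cst (lk p m * lk q n) * prod_list (map g (letters m @ letters n)))"
    by (simp add: ev_sum ev_fscale ev_fmono)
  also have "\<dots> = ev g p * ev g q"
    unfolding ev_def sum_product
  proof (intro sum.cong refl)
    fix m n
    have c: "x * (cst b * y) = cst b * (x * y)" for b x y by (metis cst_comm mult.assoc)
    show "cst (lk p m * lk q n) * prod_list (map g (letters m @ letters n)) =
        cst (lk p m) * prod_list (map g (letters m)) * (cst (lk q n) * prod_list (map g (letters n)))"
      by (simp add: cst_mult mult.assoc c[of "prod_list (map g (letters m))"])
  qed
  finally show ?thesis .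
qed

lemma ev_cong:
  assumes "\<And>m x. m \<in> ks p \<Longrightarrow> x \<in> set (letters m) \<Longrightarrow> g x = h x"
  shows "ev g p = ev h p"
  unfolding ev_def by (intro sum.cong refl arg_cong2[where f="(*)"] arg_cong[where f=prod_list] map_cong)
    (use assms in auto)

end

interpretation fa: calg "\<lambda>c. sng 0 c :: 'g falg"
  by unfold_locales (auto simp: single_add mult_single single0_comm)

lemma fscale_mult_left: "fscale c p * q = fscale c (p * q)"
  by (simp add: fscale_def mult.assoc)
lemma fscale_0: "fscale 0 p = 0"
  by (simp add: fscale_def)
lemma fscale_diff_right: "fscale c (p - q) = fscale c p - fscale c q"
  by (simp add: fscale_def algebra_simps)
text \<open>The weights of the letters are arbitrary: they are word lengths for the generators of \<open>Y\<close> and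
constantly \<open>1\<close> for the enveloping algebra.\<close>

definition fpol :: "'g set \<Rightarrow> ('g \<Rightarrow> nat) \<Rightarrow> nat \<Rightarrow> 'g falg set"
  where "fpol V dg n = {p. \<forall>m\<in>ks p. set (letters m) \<subseteq> V \<and> sum_list (map dg (letters m)) \<le> n}"

definition fcar :: "'g set \<Rightarrow> 'g falg set"
  where "fcar V = {p. \<forall>m\<in>ks p. set (letters m) \<subseteq> V}"

lemma carrier_free_alg: "carrier (free_alg V) = fcar V"
  by (simp add: free_alg_def fcar_def)

lemma fpol_fcar: "p \<in> fpol V dg n \<Longrightarrow> p \<in> fcar V"
  by (auto simp: fpol_def fcar_def)

lemma fcar_fpol: "p \<in> fcar V \<Longrightarrow> \<exists>n. p \<in> fpol V dg n"
proof
  assume "p \<in> fcar V"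
  then show "p \<in> fpol V dg (\<Sum>m\<in>ks p. sum_list (map dg (letters m)))"
    by (auto simp: fcar_def fpol_def intro: member_le_sum)
qed

lemma fcar_0: "0 \<in> fcar V" and fcar_1: "1 \<in> fcar V"
  by (auto simp: fcar_def zero_fmon_def)

lemma fcar_add: "p \<in> fcar V \<Longrightarrow> q \<in> fcar V \<Longrightarrow> p + q \<in> fcar V"
  using Poly_Mapping.keys_add[of p q] by (auto simp: fcar_def)
lemma fcar_uminus: "p \<in> fcar V \<Longrightarrow> - p \<in> fcar V"
  by (auto simp: fcar_def in_keys_iff)
lemma fcar_diff: "p \<in> fcar V \<Longrightarrow> q \<in> fcar V \<Longrightarrow> p - q \<in> fcar V"
  using fcar_add[OF _ fcar_uminus, of p V q] by simp
lemma fcar_fscale: "p \<in> fcar V \<Longrightarrow> fscale c p \<in> fcar V"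
  using keys_fscale[of c p] by (auto simp: fcar_def)
lemma fcar_mult: "p \<in> fcar V \<Longrightarrow> q \<in> fcar V \<Longrightarrow> p * q \<in> fcar V"
  using keys_mult[of p q] by (fastforce simp: fcar_def plus_fmon_def)
lemma fcar_fmono: "fmono xs \<in> fcar V \<longleftrightarrow> set xs \<subseteq> V"
  by (auto simp: fcar_def fmono_def)
lemma fcar_sum: "(\<And>x. x \<in> A \<Longrightarrow> f x \<in> fcar V) \<Longrightarrow> sum f A \<in> fcar V"
  by (induction A rule: infinite_finite_induct) (auto simp: fcar_0 fcar_add)

lemma fpol_0: "0 \<in> fpol V dg n"
  by (auto simp: fpol_def)
lemma fpol_1: "1 \<in> fpol V dg n"
  by (auto simp: fpol_def zero_fmon_def)
lemma fpol_mono: "p \<in> fpol V dg n \<Longrightarrow> n \<le> n' \<Longrightarrow> p \<in> fpol V dg n'"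
  by (fastforce simp: fpol_def)
lemma fpol_add: "p \<in> fpol V dg n \<Longrightarrow> q \<in> fpol V dg n \<Longrightarrow> p + q \<in> fpol V dg n"
  using Poly_Mapping.keys_add[of p q] by (auto simp: fpol_def)
lemma fpol_fscale: "p \<in> fpol V dg n \<Longrightarrow> fscale c p \<in> fpol V dg n"
  using keys_fscale[of c p] by (auto simp: fpol_def)
lemma fpol_mult: "p \<in> fpol V dg n \<Longrightarrow> q \<in> fpol V dg k \<Longrightarrow> p * q \<in> fpol V dg (n + k)"
  using keys_mult[of p q] by (fastforce simp: fpol_def plus_fmon_def intro: add_mono)
lemma fpol_fmono: "fmono xs \<in> fpol V dg n \<longleftrightarrow> set xs \<subseteq> V \<and> sum_list (map dg xs) \<le> n"
  by (auto simp: fpol_def fmono_def)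
section \<open>A concrete model of the enveloping algebra\<close>

text \<open>The index \<open>(i, j, \<alpha>)\<close> stands for the matrix unit \<open>E\<^sub>i\<^sub>j\<^sub>|\<^sub>\<alpha>\<close>; no bounds are imposed on the indices,
so that \<open>S\<close> is the symmetric algebra for all sizes and all numbers of copies at once.\<close>

type_synonym idx = "nat \<times> nat \<times> nat"
type_synonym S = "idx multiset \<Rightarrow>\<^sub>0 complex"

definition smono :: "idx multiset \<Rightarrow> S" where "smono M = sng M 1"

lemma S_expand: "(s::S) = (\<Sum>M\<in>ks s. sng 0 (lk s M) * smono M)"
  by (rule poly_mapping_eqI)
    (auto simp: smono_def mult_single lookup_sum lookup_single when_def in_keys_iff)

lemma smono_add: "smono (M + N) = smono M * smono N"
  by (simp add: smono_def mult_single)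

typedef U = "{f :: S \<Rightarrow> S. (\<forall>x y. f (x + y) = f x + f y) \<and> (\<forall>c x. f (sng 0 c * x) = sng 0 c * f x)}"
  morphisms app Abs_U
  by (rule exI[of _ "\<lambda>_. 0"]) simp

setup_lifting type_definition_U

instantiation U :: ring_1
begin
lift_definition zero_U :: U is "\<lambda>_. 0" by simp
lift_definition one_U :: U is "\<lambda>x. x" by simp
lift_definition plus_U :: "U \<Rightarrow> U \<Rightarrow> U" is "\<lambda>f g x. f x + g x" by (simp add: algebra_simps)
lift_definition minus_U :: "U \<Rightarrow> U \<Rightarrow> U" is "\<lambda>f g x. f x - g x" by (simp add: algebra_simps)
lift_definition uminus_U :: "U \<Rightarrow> U" is "\<lambda>f x. - f x" by (simp add: algebra_simps)
lift_definition times_U :: "U \<Rightarrow> U \<Rightarrow> U" is "\<lambda>f g x. f (g x)" by simp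
instance
proof
  show "(0::U) \<noteq> 1"
  proof
    assume "(0::U) = 1"
    then have "app 0 1 = app 1 1" by simp
    then show False by (simp add: zero_U.rep_eq one_U.rep_eq)
  qed
qed (transfer; auto simp: algebra_simps)+
end

lift_definition cst :: "complex \<Rightarrow> U" is "\<lambda>c x. sng 0 c * x"
  by (simp add: algebra_simps)

lemma app_add: "app u (x + y) = app u x + app u y"
  by transfer simp
lemma app_scale: "app u (sng 0 c * x) = sng 0 c * app u x"
  by transfer simp
lemma app_0_right: "app u 0 = 0"
  using app_add[of u 0 0] by simp
lemma app_sum_right: "app u (sum f A) = (\<Sum>x\<in>A. app u (f x))"
  by (induction A rule: infinite_finite_induct) (auto simp: app_0_right app_add)
lemma app_sum: "app (sum f A) x = (\<Sum>a\<in>A. app (f a) x)"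
  by (induction A rule: infinite_finite_induct) (auto simp: zero_U.rep_eq plus_U.rep_eq)
lemmas app_simps = zero_U.rep_eq one_U.rep_eq plus_U.rep_eq minus_U.rep_eq uminus_U.rep_eq
  times_U.rep_eq cst.rep_eq app_sum

lemma U_eqI: "(\<And>s. app u s = app v s) \<Longrightarrow> u = v"
  by (meson app_inject ext)

interpretation ua: calg cst
proof
  fix a b x
  show "cst (a + b) = cst a + cst b"
    by (rule U_eqI) (simp add: app_simps single_add distrib_right)
  have "sng 0 (a * b) = sng 0 a * (sng 0 b :: S)" by (simp add: mult_single)
  then show "cst (a * b) = cst a * cst b"
    by (intro U_eqI) (simp add: app_simps mult.assoc)
  show "cst 1 = 1" by (rule U_eqI) (simp add: app_simps)
  show "cst a * x = x * cst a" by (rule U_eqI) (simp add: app_simps app_scale)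
qed

subsection \<open>Derivations of the polynomial algebra\<close>

definition der_mono :: "(idx \<Rightarrow> S) \<Rightarrow> idx multiset \<Rightarrow> S"
  where "der_mono \<delta> M = (\<Sum>a\<in>#M. smono (M - {#a#}) * \<delta> a)"

definition der :: "(idx \<Rightarrow> S) \<Rightarrow> S \<Rightarrow> S"
  where "der \<delta> s = (\<Sum>M\<in>ks s. sng 0 (lk s M) * der_mono \<delta> M)"

lemma der_mono_add: "der_mono \<delta> (M + N) = der_mono \<delta> M * smono N + smono M * der_mono \<delta> N"
proof -
  have "(\<Sum>a\<in>#M. smono (M + N - {#a#}) * \<delta> a) = (\<Sum>a\<in>#M. smono (M - {#a#}) * \<delta> a * smono N)"
  proof (intro arg_cong[where f=sum_mset] image_mset_cong)
    fix a assume "a \<in># M"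
    then have "M + N - {#a#} = (M - {#a#}) + N" by simp
    then show "smono (M + N - {#a#}) * \<delta> a = smono (M - {#a#}) * \<delta> a * smono N"
      by (simp only: smono_add ac_simps)
  qed
  moreover have "(\<Sum>a\<in>#N. smono (M + N - {#a#}) * \<delta> a) = (\<Sum>a\<in>#N. smono M * (smono (N - {#a#}) * \<delta> a))"
    by (rule arg_cong[where f=sum_mset], rule image_mset_cong) (simp flip: smono_add mult.assoc)
  ultimately show ?thesis
    by (simp add: der_mono_def sum_mset_distrib_left sum_mset_distrib_right)
qed

lemma der_superset: "finite A \<Longrightarrow> ks s \<subseteq> A \<Longrightarrow> der \<delta> s = (\<Sum>M\<in>A. sng 0 (lk s M) * der_mono \<delta> M)"
  unfolding der_def by (rule sum.mono_neutral_left) (auto simp: in_keys_iff)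

lemma der_add: "der \<delta> (s + t) = der \<delta> s + der \<delta> t"
proof -
  have *: "finite (ks s \<union> ks t)" by simp
  show ?thesis
    by (simp add: der_superset[OF *, of "s + t"] der_superset[OF *, of s] der_superset[OF *, of t]
        Poly_Mapping.keys_add lookup_add single_add distrib_right sum.distrib)
qed

lemma der_scale: "der \<delta> (sng 0 c * s) = sng 0 c * der \<delta> s"
proof -
  have *: "ks (sng 0 c * s) \<subseteq> ks s" by (auto simp: in_keys_iff lookup_single_mult)
  have "sng 0 (c * z) = sng 0 c * (sng 0 z :: S)" for z by (simp add: mult_single)
  with * show ?thesis
    using der_superset[of "ks s" "sng 0 c * s" \<delta>]
    by (simp add: der_def lookup_single_mult sum_distrib_left mult.assoc)
qed

lemma der_0: "der \<delta> 0 = 0" by (simp add: der_def)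
lemma der_sum: "der \<delta> (sum f A) = (\<Sum>x\<in>A. der \<delta> (f x))"
  by (induction A rule: infinite_finite_induct) (auto simp: der_0 der_add)
lemma der_const: "der \<delta> (sng {#} c) = 0"
  by (simp add: der_def der_mono_def)
lemma der_smono: "der \<delta> (smono M) = der_mono \<delta> M"
  by (simp add: der_def smono_def)

lemma der_mult: "der \<delta> (s * t) = der \<delta> s * t + s * der \<delta> t"
proof -
  have 1: "der \<delta> (s * smono N) = der \<delta> s * smono N + s * der_mono \<delta> N" for s N
  proof -
    have "der \<delta> ((\<Sum>M\<in>ks s. sng 0 (lk s M) * smono M) * smono N) =
      (\<Sum>M\<in>ks s. sng 0 (lk s M) * der_mono \<delta> M) * smono N + (\<Sum>M\<in>ks s. sng 0 (lk s M) * smono M) * der_mono \<delta> N"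
      by (simp add: sum_distrib_right der_sum mult.assoc der_scale der_smono der_mono_add distrib_left sum.distrib flip: smono_add)
    then show ?thesis using S_expand[of s] by (simp flip: der_def)
  qed
  have "der \<delta> (s * t) = (\<Sum>N\<in>ks t. sng 0 (lk t N) * der \<delta> (s * smono N))"
  proof -
    have "der \<delta> (s * (\<Sum>N\<in>ks t. sng 0 (lk t N) * smono N)) = (\<Sum>N\<in>ks t. sng 0 (lk t N) * der \<delta> (s * smono N))"
      by (simp add: sum_distrib_left der_sum mult.left_commute[of s] der_scale)
    then show ?thesis using S_expand[of t] by simp
  qed
  also have "\<dots> = der \<delta> s * (\<Sum>N\<in>ks t. sng 0 (lk t N) * smono N) + s * der \<delta> t"
    by (simp add: 1 der_def[of \<delta> t] sum_distrib_left algebra_simps sum.distrib)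
  finally show ?thesis using S_expand[of t] by simp
qed

definition svar :: "idx \<Rightarrow> S" where "svar a = smono {#a#}"

lemma der_svar: "der \<delta> (svar a) = \<delta> a"
  by (simp add: svar_def der_smono der_mono_def) (simp add: smono_def)

text \<open>Derivations are determined by their values on the variables. Identities between operators on \<open>S\<close>
thereby reduce to finite case distinctions.\<close>

lemma derivation_eq:
  assumes add: "\<And>s t. f (s + t) = f s + f t" and sc: "\<And>c s. f (sng 0 c * s) = sng 0 c * f s"
    and leib: "\<And>s t. f (s * t) = f s * t + s * f (t::S)"
    and var: "\<And>a. f (svar a) = der \<delta> (svar a)"
  shows "f s = der \<delta> s"
proof -
  have "f (1 * 1) = f 1 + f 1" by (subst leib) simp
  then have f1: "f 1 = 0" by simp
  have f0: "f 0 = 0" using add[of 0 0] by simp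
  have mono: "f (smono M) = der \<delta> (smono M)" for M
  proof (induction M)
    case empty
    then show ?case by (simp add: der_smono der_mono_def) (simp add: smono_def f1)
  next
    case (add a M)
    have "smono (add_mset a M) = svar a * smono M"
      by (simp add: svar_def flip: smono_add)
    then show ?case by (simp add: leib der_mult var add)
  qed
  have fs: "f (sum g A) = (\<Sum>x\<in>A. f (g x))" for g :: "idx multiset \<Rightarrow> S" and A
    by (induction A rule: infinite_finite_induct) (auto simp: f0 add)
  have "f (\<Sum>M\<in>ks s. sng 0 (lk s M) * smono M) = der \<delta> (\<Sum>M\<in>ks s. sng 0 (lk s M) * smono M)"
    by (simp add: fs der_sum sc der_scale mono)
  then show ?thesis using S_expand[of s] by simp
qed

text \<open>The product of two matrix units in the associative algebra, as a linear polynomial.\<close>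

definition left_mult :: "idx \<Rightarrow> idx \<Rightarrow> S"
  where "left_mult = (\<lambda>(i, j, \<alpha>) (k, l, \<beta>). if \<alpha> = \<beta> \<and> j = k then svar (i, l, \<alpha>) else 0)"

text \<open>Write \<open>m\<^sub>x\<close> for multiplication by \<open>x\<close> and \<open>D\<^sub>x\<close> for the derivation with \<open>D\<^sub>x y = xy\<close> on variables. Then
\<open>[m\<^sub>x + D\<^sub>x, m\<^sub>y + D\<^sub>y] = m\<^bsub>xy - yx\<^esub> + D\<^bsub>xy - yx\<^esub>\<close>, so these operators represent the Lie algebra. The
summand \<open>m\<^sub>x\<close> raises degrees and makes symbols visible.\<close>

lift_definition E :: "idx \<Rightarrow> U" is "\<lambda>x s. svar x * s + der (left_mult x) s"
  by (simp add: der_add der_scale distrib_left mult.left_commute)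

text \<open>Left multiplications by \<open>x\<close> and by \<open>y\<close> compose to the left multiplication by \<open>xy\<close>; both sides are
derivations, so it suffices to compare them on variables.\<close>

lemma der_comm:
  "der (left_mult (i, j, \<alpha>)) (der (left_mult (k, l, \<beta>)) s) - der (left_mult (k, l, \<beta>)) (der (left_mult (i, j, \<alpha>)) s) =
   der (\<lambda>x. (if \<alpha> = \<beta> \<and> j = k then left_mult (i, l, \<alpha>) x else 0) - (if \<alpha> = \<beta> \<and> l = i then left_mult (k, j, \<alpha>) x else 0)) s"
  by (rule derivation_eq)
    (auto simp: der_add der_scale der_mult der_svar der_0 der_const left_mult_def algebra_simps)

lemma der_if_diff:
  "der (\<lambda>x. (if P then f x else 0) - (if Q then g x else 0)) s =
   (if P then der f s else 0) - (if Q then der g s else 0)"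
  by (rule derivation_eq[symmetric])
    (auto simp: der_add der_scale der_mult der_svar der_const ring_distribs right_diff_distrib)

lemma E_comm:
  "E (i, j, \<alpha>) * E (k, l, \<beta>) - E (k, l, \<beta>) * E (i, j, \<alpha>) =
    (if \<alpha> = \<beta> \<and> j = k then E (i, l, \<alpha>) else 0) - (if \<alpha> = \<beta> \<and> l = i then E (k, j, \<alpha>) else 0)"
proof (rule U_eqI)
  fix s
  have "app (E (i, j, \<alpha>) * E (k, l, \<beta>) - E (k, l, \<beta>) * E (i, j, \<alpha>)) s =
    (der (left_mult (i, j, \<alpha>)) (svar (k, l, \<beta>)) - der (left_mult (k, l, \<beta>)) (svar (i, j, \<alpha>))) * s +
    (der (left_mult (i, j, \<alpha>)) (der (left_mult (k, l, \<beta>)) s) - der (left_mult (k, l, \<beta>)) (der (left_mult (i, j, \<alpha>)) s))"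
    by (simp add: app_simps E.rep_eq der_add der_mult algebra_simps)
  also have "\<dots> = app ((if \<alpha> = \<beta> \<and> j = k then E (i, l, \<alpha>) else 0) - (if \<alpha> = \<beta> \<and> l = i then E (k, j, \<alpha>) else 0)) s"
    unfolding der_comm der_if_diff
    by (auto simp: app_simps E.rep_eq der_svar left_mult_def algebra_simps)
  finally show "app (E (i, j, \<alpha>) * E (k, l, \<beta>) - E (k, l, \<beta>) * E (i, j, \<alpha>)) s = \<dots>" .
qed

subsection \<open>Degrees and symbols\<close>

definition deg_le :: "nat \<Rightarrow> S set"
  where "deg_le n = {s. \<forall>M\<in>ks s. size M \<le> n}"

definition top_coeff :: "nat \<Rightarrow> (idx \<Rightarrow> complex) \<Rightarrow> S \<Rightarrow> complex"
  where "top_coeff n \<xi> s = (\<Sum>M\<in>ks s. if size M = n then lk s M * prod_mset (image_mset \<xi> M) else 0)"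

lemma top_superset:
  "finite A \<Longrightarrow> ks s \<subseteq> A \<Longrightarrow> top_coeff n \<xi> s = (\<Sum>M\<in>A. if size M = n then lk s M * prod_mset (image_mset \<xi> M) else 0)"
  unfolding top_coeff_def by (rule sum.mono_neutral_left) (auto simp: in_keys_iff)

lemma top_add: "top_coeff n \<xi> (s + t) = top_coeff n \<xi> s + top_coeff n \<xi> t"
proof -
  have *: "finite (ks s \<union> ks t)" by simp
  show ?thesis
    by (auto simp: top_superset[OF *, of "s + t"] top_superset[OF *, of s] top_superset[OF *, of t]
        Poly_Mapping.keys_add lookup_add distrib_right simp flip: sum.distrib intro!: sum.cong)
qed

lemma top_scale: "top_coeff n \<xi> (sng 0 c * s) = c * top_coeff n \<xi> s"
proof -
  have "ks (sng 0 c * s) \<subseteq> ks s" by (auto simp: in_keys_iff lookup_single_mult)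
  then show ?thesis
    using top_superset[of "ks s" "sng 0 c * s" n \<xi>]
    by (auto simp: top_coeff_def lookup_single_mult sum_distrib_left intro!: sum.cong)
qed

lemma top_0: "top_coeff n \<xi> 0 = 0" by (simp add: top_coeff_def)
lemma top_sum: "top_coeff n \<xi> (sum f A) = (\<Sum>x\<in>A. top_coeff n \<xi> (f x))"
  by (induction A rule: infinite_finite_induct) (auto simp: top_0 top_add)
lemma top_smono: "top_coeff n \<xi> (smono M) = (if size M = n then prod_mset (image_mset \<xi> M) else 0)"
  by (simp add: top_coeff_def smono_def)
lemma top_deg_le: "s \<in> deg_le m \<Longrightarrow> m < n \<Longrightarrow> top_coeff n \<xi> s = 0"
  by (auto simp: top_coeff_def deg_le_def intro!: sum.neutral)

lemma deg_le_0: "0 \<in> deg_le n" by (simp add: deg_le_def)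
lemma deg_le_add: "s \<in> deg_le n \<Longrightarrow> t \<in> deg_le n \<Longrightarrow> s + t \<in> deg_le n"
  using Poly_Mapping.keys_add[of s t] by (auto simp: deg_le_def)
lemma deg_le_scale: "s \<in> deg_le n \<Longrightarrow> sng 0 c * s \<in> deg_le n"
  by (auto simp: deg_le_def in_keys_iff lookup_single_mult)
lemma deg_le_sum: "(\<And>x. x \<in> A \<Longrightarrow> f x \<in> deg_le n) \<Longrightarrow> sum f A \<in> deg_le n"
  by (induction A rule: infinite_finite_induct) (auto simp: deg_le_0 deg_le_add)
lemma deg_le_smono: "smono M \<in> deg_le n \<longleftrightarrow> size M \<le> n"
  by (simp add: deg_le_def smono_def)
lemma deg_le_mono: "s \<in> deg_le n \<Longrightarrow> n \<le> m \<Longrightarrow> s \<in> deg_le m"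
  by (fastforce simp: deg_le_def)
lemma deg_le_1: "1 \<in> deg_le n"
  using deg_le_smono[of "{#}"] by (simp add: smono_def)

text \<open>The value on all polynomials is prescribed, and not only the value on \<open>1\<close>, because then symbols are
multiplicative under composition.\<close>

definition has_symbol :: "nat \<Rightarrow> (idx \<Rightarrow> complex) \<Rightarrow> U \<Rightarrow> complex \<Rightarrow> bool"
  where "has_symbol n \<xi> u z \<longleftrightarrow>
    (\<forall>m. \<forall>s\<in>deg_le m. app u s \<in> deg_le (n + m) \<and> top_coeff (n + m) \<xi> (app u s) = z * top_coeff m \<xi> s)"

lemma has_symbolI_smono:
  assumes "\<And>M. app u (smono M) \<in> deg_le (n + size M) \<and> top_coeff (n + size M) \<xi> (app u (smono M)) = z * prod_mset (image_mset \<xi> M)"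
  shows "has_symbol n \<xi> u z"
  unfolding has_symbol_def
proof (intro allI ballI)
  fix m s assume s: "s \<in> deg_le m"
  have e: "app u s = (\<Sum>M\<in>ks s. sng 0 (lk s M) * app u (smono M))"
    using arg_cong[OF S_expand[of s], of "app u"] by (simp only: app_sum_right app_scale)
  have "app u s \<in> deg_le (n + m)"
    unfolding e
  proof (intro deg_le_sum deg_le_scale)
    fix M assume "M \<in> ks s"
    then have "size M \<le> m" using s by (auto simp: deg_le_def)
    then show "app u (smono M) \<in> deg_le (n + m)" using assms[of M] by (auto intro: deg_le_mono)
  qed
  moreover have "top_coeff (n + m) \<xi> (app u s) = z * top_coeff m \<xi> s"
    unfolding e top_sum top_scale top_coeff_def[of m] sum_distrib_left
  proof (intro sum.cong refl)
    fix M assume "M \<in> ks s"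
    then have "size M \<le> m" using s by (auto simp: deg_le_def)
    then consider "size M = m" | "size M < m" by linarith
    then show "lk s M * top_coeff (n + m) \<xi> (app u (smono M)) = z * (if size M = m then lk s M * prod_mset (image_mset \<xi> M) else 0)"
    proof cases
      case 1 then show ?thesis using assms[of M] by simp
    next
      case 2
      then have "top_coeff (n + m) \<xi> (app u (smono M)) = 0"
        using assms[of M] by (intro top_deg_le[of _ "n + size M"]) auto
      then show ?thesis using 2 by simp
    qed
  qed
  ultimately show "app u s \<in> deg_le (n + m) \<and> top_coeff (n + m) \<xi> (app u s) = z * top_coeff m \<xi> s" ..
qed

text \<open>The derivation part of \<^term>\<open>E x\<close> preserves the degree and does not contribute to the symbol.\<close>

lemma has_symbol_E: "has_symbol 1 \<xi> (E x) (\<xi> x)"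
proof (rule has_symbolI_smono)
  fix M
  obtain i j \<alpha> where x: "x = (i, j, \<alpha>)" by (cases x)
  have 1: "svar x * smono M = smono (add_mset x M)"
    by (simp add: svar_def flip: smono_add)
  have "smono (M - {#a#}) * left_mult x a \<in> deg_le (size M)" if "a \<in># M" for a
  proof (cases "left_mult x a = 0")
    case True then show ?thesis by (simp add: deg_le_0)
  next
    case False
    then obtain b where "left_mult x a = svar b"
      by (cases a) (auto simp: left_mult_def x split: if_splits)
    moreover have "size (M - {#a#} + {#b#}) = size M"
      using that by (simp add: size_Suc_Diff1)
    ultimately show ?thesis
      by (simp add: svar_def deg_le_smono flip: smono_add)
  qed
  note * = this
  have smat: "(\<forall>a. a \<in># K \<longrightarrow> f a \<in> deg_le n) \<Longrightarrow> (\<Sum>a\<in>#K. f a) \<in> deg_le n" for K :: "idx multiset" and f n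
    by (induction K) (auto simp: deg_le_0 deg_le_add)
  have 2: "der_mono (left_mult x) M \<in> deg_le (size M)"
    unfolding der_mono_def by (rule smat) (use * in simp)
  have 3: "app (E x) (smono M) = smono (add_mset x M) + der_mono (left_mult x) M"
    by (simp add: E.rep_eq 1 der_smono)
  have 4: "smono (add_mset x M) \<in> deg_le (1 + size M)" by (simp add: deg_le_smono)
  have 5: "der_mono (left_mult x) M \<in> deg_le (1 + size M)" by (rule deg_le_mono[OF 2]) simp
  have 6: "top_coeff (1 + size M) \<xi> (der_mono (left_mult x) M) = 0" by (rule top_deg_le[OF 2]) simp
  show "app (E x) (smono M) \<in> deg_le (1 + size M) \<and>
      top_coeff (1 + size M) \<xi> (app (E x) (smono M)) = \<xi> x * prod_mset (image_mset \<xi> M)"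
    unfolding 3 top_add 6 using deg_le_add[OF 4 5] by (simp add: top_smono)
qed

lemma has_symbol_0: "has_symbol n \<xi> 0 0"
  by (simp add: has_symbol_def app_simps deg_le_0 top_0)
lemma has_symbol_1: "has_symbol 0 \<xi> 1 1"
  by (simp add: has_symbol_def app_simps)
lemma has_symbol_cst: "has_symbol 0 \<xi> (cst c) c"
  by (simp add: has_symbol_def app_simps deg_le_scale top_scale)
lemma has_symbol_add: "has_symbol n \<xi> u a \<Longrightarrow> has_symbol n \<xi> v b \<Longrightarrow> has_symbol n \<xi> (u + v) (a + b)"
  by (simp add: has_symbol_def app_simps deg_le_add top_add algebra_simps)
lemma has_symbol_mult: "has_symbol n \<xi> u a \<Longrightarrow> has_symbol k \<xi> v b \<Longrightarrow> has_symbol (n + k) \<xi> (u * v) (a * b)"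
  by (simp add: has_symbol_def app_simps add.assoc)
lemma has_symbol_scale: "has_symbol n \<xi> u a \<Longrightarrow> has_symbol n \<xi> (cst c * u) (c * a)"
  using has_symbol_mult[OF has_symbol_cst] by fastforce
lemma has_symbol_uminus: "has_symbol n \<xi> u a \<Longrightarrow> has_symbol n \<xi> (- u) (- a)"
  using has_symbol_scale[of n \<xi> u a "-1"] by (simp add: ua.cst_uminus ua.cst_1)
lemma has_symbol_diff: "has_symbol n \<xi> u a \<Longrightarrow> has_symbol n \<xi> v b \<Longrightarrow> has_symbol n \<xi> (u - v) (a - b)"
  using has_symbol_add[OF _ has_symbol_uminus, of n \<xi> u a v b] by simp
lemma has_symbol_sum: "(\<And>x. x \<in> A \<Longrightarrow> has_symbol n \<xi> (f x) (g x)) \<Longrightarrow> has_symbol n \<xi> (sum f A) (sum g A)"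
  by (induction A rule: infinite_finite_induct) (auto simp: has_symbol_0 has_symbol_add)
lemma has_symbol_less: "has_symbol n \<xi> u a \<Longrightarrow> n < k \<Longrightarrow> has_symbol k \<xi> u 0"
  unfolding has_symbol_def
  by (metis add_less_mono1 less_imp_le mult_zero_left deg_le_mono top_deg_le)
lemma has_symbol_prod_list:
  "(\<And>x. x \<in> set xs \<Longrightarrow> has_symbol (d x) \<xi> (f x) (g x)) \<Longrightarrow>
   has_symbol (sum_list (map d xs)) \<xi> (prod_list (map f xs)) (prod_list (map g xs))"
  by (induction xs) (auto simp: has_symbol_1 has_symbol_mult)
lemma has_symbol_top: "has_symbol n \<xi> u a \<Longrightarrow> top_coeff n \<xi> (app u 1) = a"
proof -
  assume "has_symbol n \<xi> u a"
  then have "top_coeff (n + 0) \<xi> (app u 1) = a * top_coeff 0 \<xi> 1"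
    unfolding has_symbol_def using deg_le_1 by blast
  moreover have "top_coeff 0 \<xi> 1 = 1" using top_smono[of 0 \<xi> "{#}"] by (simp add: smono_def)
  ultimately show ?thesis by simp
qed

section \<open>Reordering and independence of ordered monomials\<close>

lemma sorted_wrt_exists:
  assumes "\<And>x y. x \<in> V \<Longrightarrow> y \<in> V \<Longrightarrow> R x y \<or> R y x"
    and "\<And>x y z. R x y \<Longrightarrow> R y z \<Longrightarrow> R x z" and "set xs \<subseteq> V"
  shows "\<exists>ys. mset ys = mset xs \<and> sorted_wrt R ys"
  using assms(3)
proof (induction xs)
  case Nil
  then show ?case by simp
next
  case (Cons x xs)
  then obtain ys where ys: "mset ys = mset xs" "sorted_wrt R ys" by auto
  then have "set ys \<subseteq> V" using Cons.prems by (metis set_mset_mset set_subset_Cons subset_trans)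
  have "x \<in> V" using Cons.prems by simp
  from ys(2) \<open>set ys \<subseteq> V\<close> have "\<exists>zs. mset zs = add_mset x (mset ys) \<and> sorted_wrt R zs"
  proof (induction ys)
    case Nil
    then show ?case by (intro exI[of _ "[x]"]) simp
  next
    case (Cons y ys)
    show ?case
    proof (cases "R x y")
      case True
      then have "sorted_wrt R (x # y # ys)" using Cons.prems assms(2) by auto
      then show ?thesis by (intro exI[of _ "x # y # ys"]) simp
    next
      case False
      then have "R y x" using assms(1) \<open>x \<in> V\<close> Cons.prems by auto
      obtain zs where zs: "mset zs = add_mset x (mset ys)" "sorted_wrt R zs"
        using Cons by auto
      then have "set zs = insert x (set ys)" by (metis set_mset_add_mset_insert set_mset_mset)
      then have "sorted_wrt R (y # zs)" using zs \<open>R y x\<close> Cons.prems by auto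
      then show ?thesis using zs by (intro exI[of _ "y # zs"]) simp
    qed
  qed
  then show ?case using ys by auto
qed

lemma sorted_wrt_unique:
  assumes "\<And>x y. x \<in> V \<Longrightarrow> y \<in> V \<Longrightarrow> R x y \<Longrightarrow> R y x \<Longrightarrow> x = y"
    and "set xs \<subseteq> V" "sorted_wrt R xs" "sorted_wrt R ys" "mset xs = mset ys"
  shows "xs = ys"
  using assms(2-)
proof (induction xs arbitrary: ys)
  case Nil
  then show ?case by simp
next
  case (Cons x xs)
  then obtain y zs where ys: "ys = y # zs" by (metis mset_zero_iff neq_Nil_conv list.distinct(1))
  have "set (x # xs) = set ys" using Cons.prems(4) by (metis set_mset_mset)
  then have "x = y \<or> (R x y \<and> R y x)"
    using Cons.prems ys by (auto simp: set_eq_iff)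
  moreover have "y \<in> V" using \<open>set (x # xs) = set ys\<close> Cons.prems(1) ys by auto
  ultimately have "x = y" using assms(1) Cons.prems(1) by auto
  then show ?case using Cons ys by auto
qed

text \<open>A two-sided ideal modulo which any two letters commute up to terms of smaller weight. The defining
ideals of the enveloping algebra and of \<open>Y\<close> are both of this kind.\<close>

locale reorder =
  fixes V :: "'g set" and dg :: "'g \<Rightarrow> nat" and ord :: "'g rel" and I :: "'g falg set"
  assumes tot: "x \<in> V \<Longrightarrow> y \<in> V \<Longrightarrow> (x, y) \<in> ord \<or> (y, x) \<in> ord"
    and trns: "(x, y) \<in> ord \<Longrightarrow> (y, z) \<in> ord \<Longrightarrow> (x, z) \<in> ord"
    and asym: "(x, y) \<in> ord \<Longrightarrow> (y, x) \<in> ord \<Longrightarrow> x = y"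
    and I_0: "0 \<in> I"
    and I_add: "a \<in> I \<Longrightarrow> b \<in> I \<Longrightarrow> a + b \<in> I"
    and I_left: "a \<in> I \<Longrightarrow> p \<in> fcar V \<Longrightarrow> p * a \<in> I"
    and I_right: "a \<in> I \<Longrightarrow> p \<in> fcar V \<Longrightarrow> a * p \<in> I"
    and dg_pos: "x \<in> V \<Longrightarrow> dg x \<ge> 1"
    and swap: "x \<in> V \<Longrightarrow> y \<in> V \<Longrightarrow>
      \<exists>q\<in>fpol V dg (dg x + dg y - 1). gen x * gen y - gen y * gen x - q \<in> I"
begin

abbreviation "R \<equiv> \<lambda>x y. (x, y) \<in> ord"

lemma I_fscale: "a \<in> I \<Longrightarrow> fscale c a \<in> I"
  using I_left[of a "fscale c 1"] fcar_fscale[OF fcar_1, of c V] by (simp add: fscale_mult_left)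

lemma I_sum: "(\<And>x. x \<in> A \<Longrightarrow> f x \<in> I) \<Longrightarrow> sum f A \<in> I"
  by (induction A rule: infinite_finite_induct) (auto simp: I_0 I_add)

lemma swap_word:
  assumes "set a \<subseteq> V" "set b \<subseteq> V" "x \<in> V" "y \<in> V"
  shows "\<exists>q\<in>fpol V dg (sum_list (map dg (a @ x # y # b)) - 1).
    fmono (a @ x # y # b) - fmono (a @ y # x # b) - q \<in> I"
proof -
  obtain q where q: "q \<in> fpol V dg (dg x + dg y - 1)" "gen x * gen y - gen y * gen x - q \<in> I"
    using swap assms by blast
  have "fmono a * (gen x * gen y - gen y * gen x - q) * fmono b \<in> I"
    using q assms by (intro I_left I_right) (auto simp: fcar_fmono)
  moreover have "fmono a * (gen x * gen y - gen y * gen x - q) * fmono b =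
      fmono (a @ x # y # b) - fmono (a @ y # x # b) - fmono a * q * fmono b"
    by (simp add: left_diff_distrib right_diff_distrib fmono_mult flip: mult.assoc)
  moreover have "fmono a * q * fmono b \<in> fpol V dg (sum_list (map dg a) + (dg x + dg y - 1) + sum_list (map dg b))"
    using q assms by (intro fpol_mult) (auto simp: fpol_fmono)
  moreover have "sum_list (map dg a) + (dg x + dg y - 1) + sum_list (map dg b) = sum_list (map dg (a @ x # y # b)) - 1"
    using dg_pos[OF assms(3)] by simp
  ultimately show ?thesis by metis
qed

lemma fmono_move:
  assumes "set a \<subseteq> V" "set b \<subseteq> V" "x \<in> V" "set c \<subseteq> V"
  shows "\<exists>q\<in>fpol V dg (sum_list (map dg (c @ x # a @ b)) - 1). fmono (c @ x # a @ b) - fmono (c @ a @ x # b) - q \<in> I"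
  using assms
proof (induction a arbitrary: c)
  case Nil
  then show ?case by (intro bexI[of _ 0]) (auto simp: I_0 fpol_0)
next
  case (Cons y a)
  obtain q1 where q1: "q1 \<in> fpol V dg (sum_list (map dg (c @ x # y # a @ b)) - 1)"
      "fmono (c @ x # y # a @ b) - fmono (c @ y # x # a @ b) - q1 \<in> I"
    using swap_word[of c "a @ b" x y] Cons.prems by auto
  obtain q2 where q2: "q2 \<in> fpol V dg (sum_list (map dg ((c @ [y]) @ x # a @ b)) - 1)"
      "fmono ((c @ [y]) @ x # a @ b) - fmono ((c @ [y]) @ a @ x # b) - q2 \<in> I"
    using Cons.IH[of "c @ [y]"] Cons.prems by auto
  have "q1 + q2 \<in> fpol V dg (sum_list (map dg (c @ x # (y # a) @ b)) - 1)"
    using q1(1) q2(1) by (intro fpol_add) (simp_all add: ac_simps)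
  moreover have "fmono (c @ x # (y # a) @ b) - fmono (c @ (y # a) @ x # b) - (q1 + q2) \<in> I"
    using I_add[OF q1(2) q2(2)] by (simp add: algebra_simps)
  ultimately show ?case by blast
qed

text \<open>A permutation is a product of adjacent transpositions, each of which costs terms of smaller weight.\<close>

lemma fmono_perm:
  assumes "mset xs = mset ys" "set xs \<subseteq> V"
  shows "\<exists>q\<in>fpol V dg (sum_list (map dg xs) - 1). fmono xs - fmono ys - q \<in> I"
  using assms
proof (induction xs arbitrary: ys)
  case Nil
  then show ?case by (intro bexI[of _ 0]) (auto simp: I_0 fpol_0)
next
  case (Cons x xs)
  show ?case
  proof (cases "xs = []")
    case True
    then have "ys = [x]" using Cons.prems by (metis mset_single_iff_right mset.simps)
    then show ?thesis using True by (intro bexI[of _ 0]) (auto simp: I_0 fpol_0)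
  next
    case False
  from Cons have "x \<in> set ys" by (metis list.set_intros(1) set_mset_mset)
  then obtain a b where ys: "ys = a @ x # b" by (metis split_list)
  then have m: "mset xs = mset (a @ b)" using Cons.prems by simp
  then have ab: "set a \<subseteq> V" "set b \<subseteq> V" using Cons.prems(2)
    by (metis le_sup_iff set_append set_mset_mset set_subset_Cons subset_trans)+
  have x: "x \<in> V" using Cons.prems by simp
  obtain q1 where q1: "q1 \<in> fpol V dg (sum_list (map dg xs) - 1)" "fmono xs - fmono (a @ b) - q1 \<in> I"
    using Cons.IH[OF m] Cons.prems by auto
  obtain q2 where q2: "q2 \<in> fpol V dg (sum_list (map dg (x # a @ b)) - 1)"
      "fmono (x # a @ b) - fmono (a @ x # b) - q2 \<in> I"
    using fmono_move[of a b x "[]"] x ab by auto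
  have s: "sum_list (map dg (x # a @ b)) = dg x + sum_list (map dg xs)"
    using m by (simp, metis map_append mset_map sum_list_append sum_mset_sum_list)
  have "gen x * (fmono xs - fmono (a @ b) - q1) \<in> I"
    using q1(2) x by (intro I_left) (auto simp: fcar_fmono)
  then have 1: "fmono (x # xs) - fmono (x # a @ b) - gen x * q1 \<in> I"
    by (simp add: right_diff_distrib fmono_mult)
  have "gen x * q1 + q2 \<in> fpol V dg (sum_list (map dg (x # xs)) - 1)"
  proof (rule fpol_add)
    show "q2 \<in> fpol V dg (sum_list (map dg (x # xs)) - 1)" using q2(1) s by simp
    show "gen x * q1 \<in> fpol V dg (sum_list (map dg (x # xs)) - 1)"
    proof -
      have "xs \<noteq> []" by (fact False)
      then have "sum_list (map dg xs) \<ge> 1"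
        using dg_pos Cons.prems by (cases xs) (auto simp: trans_le_add1)
      moreover have "gen x * q1 \<in> fpol V dg (dg x + (sum_list (map dg xs) - 1))"
        using q1(1) x by (intro fpol_mult) (auto simp: fpol_fmono)
      ultimately show ?thesis by simp
    qed
  qed
  moreover have "fmono (x # xs) - fmono ys - (gen x * q1 + q2) \<in> I"
    using I_add[OF 1 q2(2)] ys by (simp add: algebra_simps)
  ultimately show ?thesis by blast
  qed
qed

text \<open>By induction on the weight: sorting a word changes it by terms of smaller weight only.\<close>

lemma reorder:
  assumes "p \<in> fpol V dg n"
  shows "\<exists>q\<in>fpol V dg n. (\<forall>m\<in>ks q. sorted_wrt R (letters m)) \<and> p - q \<in> I"
  using assms
proof (induction n arbitrary: p rule: less_induct)
  case (less n)
  let ?N = "{q \<in> fpol V dg n. \<forall>m\<in>ks q. sorted_wrt R (letters m)}"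
  have N0: "0 \<in> ?N" by (simp add: fpol_0)
  have Nadd: "p + q \<in> ?N" if "p \<in> ?N" "q \<in> ?N" for p q
    using that Poly_Mapping.keys_add[of p q] fpol_add by blast
  have Nsc: "fscale c p \<in> ?N" if "p \<in> ?N" for c p
    using that keys_fscale[of c p] fpol_fscale by blast
  have mono: "\<exists>q\<in>?N. fmono xs - q \<in> I" if xs: "set xs \<subseteq> V" "sum_list (map dg xs) \<le> n" for xs
  proof (cases "xs = []")
    case True
    then show ?thesis using xs by (intro bexI[of _ "fmono xs"]) (auto simp: I_0 fpol_fmono, simp add: fmono_def)
  next
    case False
    then have pos: "sum_list (map dg xs) \<ge> 1"
      using dg_pos xs by (cases xs) (auto simp: trans_le_add1)
    obtain ys where ys: "mset ys = mset xs" "sorted_wrt R ys"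
      using sorted_wrt_exists[of V R xs] tot trns xs by blast
    have ysV: "set ys \<subseteq> V" and dys: "sum_list (map dg ys) = sum_list (map dg xs)"
      using ys(1) xs by (metis set_mset_mset, metis mset_map sum_mset_sum_list)
    obtain q where q: "q \<in> fpol V dg (sum_list (map dg xs) - 1)" "fmono xs - fmono ys - q \<in> I"
      using fmono_perm[of xs ys] ys xs by auto
    obtain q' where q': "q' \<in> fpol V dg (sum_list (map dg xs) - 1)"
        "\<forall>m\<in>ks q'. sorted_wrt R (letters m)" "q - q' \<in> I"
      using less.IH[OF _ q(1)] pos xs by fastforce
    have "fmono ys \<in> ?N"
      using ys ysV dys xs by (auto simp: fpol_fmono) (auto simp: fmono_def)
    moreover have "q' \<in> ?N" using q' xs fpol_mono[OF q'(1), of n] by simp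
    ultimately have "fmono ys + q' \<in> ?N" by (rule Nadd)
    moreover have "fmono xs - (fmono ys + q') \<in> I"
      using I_add[OF q(2) q'(3)] by (simp add: algebra_simps)
    ultimately show ?thesis by blast
  qed
  have "\<forall>m\<in>ks p. \<exists>q. q \<in> ?N \<and> fmono (letters m) - q \<in> I"
    using mono less.prems unfolding fpol_def by blast
  from bchoice[OF this] obtain Q
    where Q: "\<And>m. m \<in> ks p \<Longrightarrow> Q m \<in> ?N" "\<And>m. m \<in> ks p \<Longrightarrow> fmono (letters m) - Q m \<in> I"
    by blast
  define q where "q = (\<Sum>m\<in>ks p. fscale (lk p m) (Q m))"
  have "(\<forall>x\<in>A. f x \<in> ?N) \<Longrightarrow> sum f A \<in> ?N" for A :: "'g fmon set" and f
  proof (induction A rule: infinite_finite_induct)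
    case (insert a A)
    then show ?case using Nadd[of "f a" "sum f A"] by simp
  qed (use N0 in simp_all)
  from this[of "ks p" "\<lambda>m. fscale (lk p m) (Q m)"] have "q \<in> ?N"
    unfolding q_def using Q(1) Nsc by blast
  moreover have "p - q = (\<Sum>m\<in>ks p. fscale (lk p m) (fmono (letters m) - Q m))"
    unfolding q_def fscale_diff_right sum_subtractf by (simp only: falg_expand[symmetric])
  then have "p - q \<in> I" using Q(2) by (auto intro!: I_sum I_fscale)
  ultimately show ?case by blast
qed

end

text \<open>Monomials are distinct characters of the multiplicative monoid of all functions \<open>y\<close>, so Dedekind's
argument applies.\<close>

lemma monomials_independent:
  fixes c :: "'g multiset \<Rightarrow> complex"
  assumes "finite F" "\<And>y. (\<Sum>m\<in>F. c m * prod_mset (image_mset y m)) = 0" "m \<in> F"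
  shows "c m = 0"
  using assms
proof (induction F arbitrary: c m rule: finite_induct)
  case empty
  then show ?case by simp
next
  case (insert m0 F)
  let ?ch = "\<lambda>y m. prod_mset (image_mset y m) :: complex"
  have F: "c m = 0" if m: "m \<in> F" for m
  proof -
    have "m \<noteq> m0" using m insert.hyps by auto
    then obtain x where x: "count m x \<noteq> count m0 x" by (meson multiset_eqI)
    (* a point that separates the characters m and m0 *)
    define y0 :: "'g \<Rightarrow> complex" where "y0 = (\<lambda>z. if z = x then 2 else 1)"
    have y0: "?ch y0 m = 2 ^ count m x" for m
      by (induction m) (auto simp: y0_def)
    have "c m * (?ch y0 m - ?ch y0 m0) = 0"
    proof (rule insert.IH[of "\<lambda>m. c m * (?ch y0 m - ?ch y0 m0)"])
      fix y
      have *: "?ch (\<lambda>z. y z * y0 z) m = ?ch y m * ?ch y0 m" for m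
        by (induction m) auto
      have "(\<Sum>m\<in>insert m0 F. c m * ?ch (\<lambda>z. y z * y0 z) m) - ?ch y0 m0 * (\<Sum>m\<in>insert m0 F. c m * ?ch y m) = 0"
        using insert.prems(1)[of y] insert.prems(1)[of "\<lambda>z. y z * y0 z"] by simp
      then have "(\<Sum>m\<in>insert m0 F. c m * (?ch y0 m - ?ch y0 m0) * ?ch y m) = 0"
        unfolding * sum_distrib_left sum_subtractf[symmetric] by (simp add: algebra_simps)
      then show "(\<Sum>m\<in>F. c m * (?ch y0 m - ?ch y0 m0) * ?ch y m) = 0"
        using insert.hyps by simp
    qed (use m in auto)
    moreover have "(2::complex) ^ count m x \<noteq> 2 ^ count m0 x"
    proof
      assume "(2::complex) ^ count m x = 2 ^ count m0 x"
      then have "of_nat (2 ^ count m x) = (of_nat (2 ^ count m0 x) :: complex)" by simp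
      then have "(2::nat) ^ count m x = 2 ^ count m0 x" by (simp only: of_nat_eq_iff)
      then show False using x by simp
    qed
    ultimately show ?thesis by (simp add: y0)
  qed
  have "c m0 = 0"
    using insert.prems(1)[of "\<lambda>_. 1"] insert.hyps F by simp
  then show ?case using F insert.prems by auto
qed

text \<open>If the symbols of the letters can be given arbitrary values \<open>y x\<close>, then the part of top degree of
\<open>q\<close>, read as a commutative polynomial in \<open>y\<close>, vanishes identically. Distinct words of \<open>q\<close> must
remain distinct as multisets, which is the case for ordered words.\<close>

lemma symbols_independent:
  fixes q :: "'g falg"
  assumes inj: "inj_on (\<lambda>m. mset (letters m)) (ks q)"
    and le: "\<And>m. m \<in> ks q \<Longrightarrow> sum_list (map dg (letters m)) \<le> n"
    and m0: "m0 \<in> ks q" "sum_list (map dg (letters m0)) = n"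
    and sur: "\<And>y. \<exists>h \<xi>. (\<forall>m\<in>ks q. \<forall>x\<in>set (letters m). has_symbol (dg x) \<xi> (h x) (y x)) \<and>
      top_coeff n \<xi> (app (ua.ev h q) 1) = 0"
  shows False
proof -
  let ?ms = "\<lambda>m. mset (letters m)"
  let ?F = "{m \<in> ks q. sum_list (map dg (letters m)) = n}"
  have injF: "inj_on ?ms ?F" using inj by (rule inj_on_subset) auto
  let ?c = "\<lambda>M. lk q (the_inv_into ?F ?ms M)"
  have c: "?c (?ms m) = lk q m" if "m \<in> ?F" for m
    using the_inv_into_f_f[OF injF that] by simp
  have "(\<Sum>M\<in>?ms ` ?F. ?c M * prod_mset (image_mset y M)) = 0" for y
  proof -
    obtain h \<xi> where h: "\<And>m x. m \<in> ks q \<Longrightarrow> x \<in> set (letters m) \<Longrightarrow> has_symbol (dg x) \<xi> (h x) (y x)"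
      and t: "top_coeff n \<xi> (app (ua.ev h q) 1) = 0"
      using sur[of y] by blast
    have "has_symbol n \<xi> (ua.ev h q) (\<Sum>m\<in>ks q. if m \<in> ?F then lk q m * prod_list (map y (letters m)) else 0)"
      unfolding ua.ev_def
    proof (rule has_symbol_sum)
      fix m assume m: "m \<in> ks q"
      have *: "has_symbol (sum_list (map dg (letters m))) \<xi> (cst (lk q m) * prod_list (map h (letters m)))
          (lk q m * prod_list (map y (letters m)))"
        using h[OF m] by (intro has_symbol_scale has_symbol_prod_list) auto
      show "has_symbol n \<xi> (cst (lk q m) * prod_list (map h (letters m)))
          (if m \<in> ?F then lk q m * prod_list (map y (letters m)) else 0)"
      proof (cases "sum_list (map dg (letters m)) = n")
        case True
        then show ?thesis using * m by simp
      next
        case False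
        then have "has_symbol n \<xi> (cst (lk q m) * prod_list (map h (letters m))) 0"
          using has_symbol_less[OF *] le[OF m] by simp
        then show ?thesis using False by simp
      qed
    qed
    from has_symbol_top[OF this] t
    have "(\<Sum>m\<in>ks q. if m \<in> ?F then lk q m * prod_list (map y (letters m)) else 0) = 0"
      by (rule trans[OF sym])
    then have "(\<Sum>m\<in>?F. lk q m * prod_list (map y (letters m))) = 0"
      by (subst (asm) sum.If_cases) (simp_all add: Int_def conj_commute)
    moreover have "prod_mset (image_mset y (?ms m)) = prod_list (map y (letters m))" for m
      by (simp add: prod_mset_prod_list flip: mset_map)
    ultimately show ?thesis
      by (subst sum.reindex[OF injF], unfold o_def)
        (metis (no_types, lifting) c sum.cong)
  qed
  then have "?c (?ms m0) = 0"
    by (rule monomials_independent[rotated]) (use m0 in auto)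
  then show False using c[of m0] m0 by (auto simp: in_keys_iff)
qed

section \<open>The ideal of the last column\<close>

text \<open>The ideal of \<open>S\<close> generated by the variables of column \<open>N\<close>, and the polynomials in the variables of the
first \<open>N\<close> columns.\<close>

definition col_ideal :: "nat \<Rightarrow> S set"
  where "col_ideal N = {s. \<forall>M\<in>ks s. \<exists>i \<alpha>. (i, N, \<alpha>) \<in># M}"

definition cols_le :: "nat \<Rightarrow> S set"
  where "cols_le N = {s. \<forall>M\<in>ks s. \<forall>i j \<alpha>. (i, j, \<alpha>) \<in># M \<longrightarrow> j \<le> N}"

definition subspace :: "S set \<Rightarrow> bool"
  where "subspace T \<longleftrightarrow> 0 \<in> T \<and> (\<forall>s\<in>T. \<forall>t\<in>T. s + t \<in> T) \<and> (\<forall>c. \<forall>s\<in>T. sng 0 c * s \<in> T)"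

lemma subspace_keys: "subspace {s. \<forall>M\<in>ks s. P M}"
  unfolding subspace_def
proof (intro conjI allI ballI)
  show "s + t \<in> {s. \<forall>M\<in>ks s. P M}" if "s \<in> {s. \<forall>M\<in>ks s. P M}" "t \<in> {s. \<forall>M\<in>ks s. P M}" for s t :: S
    using that Poly_Mapping.keys_add[of s t] by blast
  show "sng 0 c * s \<in> {s. \<forall>M\<in>ks s. P M}" if "s \<in> {s. \<forall>M\<in>ks s. P M}" for c and s :: S
    using that by (auto simp: in_keys_iff lookup_single_mult)
qed simp

lemma subspace_col_ideal: "subspace (col_ideal N)" and subspace_cols_le: "subspace (cols_le N)"
  unfolding col_ideal_def cols_le_def by (rule subspace_keys)+

lemma subspace_sum: "subspace T \<Longrightarrow> (\<And>x. x \<in> A \<Longrightarrow> f x \<in> T) \<Longrightarrow> sum f A \<in> T"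
  by (induction A rule: infinite_finite_induct) (auto simp: subspace_def)
lemma subspace_sum_mset: "subspace T \<Longrightarrow> (\<forall>x. x \<in># A \<longrightarrow> f x \<in> T) \<Longrightarrow> (\<Sum>x\<in>#A. f x) \<in> T"
  by (induction A) (auto simp: subspace_def)

definition preserves :: "S set \<Rightarrow> U \<Rightarrow> bool"
  where "preserves T u \<longleftrightarrow> (\<forall>s\<in>T. app u s \<in> T)"

lemma preserves_0: "subspace T \<Longrightarrow> preserves T 0" and preserves_1: "preserves T 1"
  and preserves_add: "subspace T \<Longrightarrow> preserves T u \<Longrightarrow> preserves T v \<Longrightarrow> preserves T (u + v)"
  and preserves_mult: "preserves T u \<Longrightarrow> preserves T v \<Longrightarrow> preserves T (u * v)"
  and preserves_cst: "subspace T \<Longrightarrow> preserves T (cst c)"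
  by (auto simp: preserves_def app_simps subspace_def)

lemma preserves_keysI:
  assumes T: "T = {s. \<forall>M\<in>ks s. P M}" and "\<And>M. P M \<Longrightarrow> app u (smono M) \<in> T"
  shows "preserves T u"
  unfolding preserves_def
proof
  fix s assume "s \<in> T"
  have sub: "subspace T" unfolding T by (rule subspace_keys)
  have e: "app u s = (\<Sum>M\<in>ks s. sng 0 (lk s M) * app u (smono M))"
    using arg_cong[OF S_expand[of s], of "app u"] by (simp only: app_sum_right app_scale)
  show "app u s \<in> T"
    unfolding e
  proof (rule subspace_sum[OF sub])
    fix M assume "M \<in> ks s"
    then have "app u (smono M) \<in> T" using assms(2) \<open>s \<in> T\<close> T by blast
    then show "sng 0 (lk s M) * app u (smono M) \<in> T" using sub by (auto simp: subspace_def)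
  qed
qed

lemma app_E_smono: "app (E x) (smono M) = smono (add_mset x M) + (\<Sum>a\<in>#M. smono (M - {#a#}) * left_mult x a)"
proof -
  have 1: "svar x * smono M = smono (add_mset x M)"
    by (simp add: svar_def flip: smono_add)
  then show ?thesis by (simp add: E.rep_eq der_smono der_mono_def)
qed

lemma smono_mult_svar: "smono M * svar a = smono (add_mset a M)"
  by (simp add: svar_def flip: smono_add)

text \<open>Left multiplication changes the row of a matrix unit but not its column.\<close>

lemma preserves_col_ideal: "preserves (col_ideal N) (E x)"
proof (rule preserves_keysI[OF col_ideal_def])
  fix M :: "idx multiset" assume "\<exists>i \<alpha>. (i, N, \<alpha>) \<in># M"
  then obtain i \<alpha> where b: "(i, N, \<alpha>) \<in># M" by blast
  obtain k l \<beta> where x: "x = (k, l, \<beta>)" by (cases x)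
  have "smono (M - {#a#}) * left_mult x a \<in> col_ideal N" if a: "a \<in># M" for a :: idx
  proof (cases "a = (i, N, \<alpha>)")
    case True
    then have "left_mult x a = 0 \<or> left_mult x a = svar (k, N, \<alpha>)" by (auto simp: left_mult_def x)
    then show ?thesis by (auto simp: smono_mult_svar) (auto simp: col_ideal_def smono_def)
  next
    case False
    have "(i, N, \<alpha>) \<in># add_mset a (M - {#a#})" using b a by simp
    then have "(i, N, \<alpha>) \<in># M - {#a#}" using False by (simp only: set_mset_add_mset_insert insert_iff) simp
    moreover have "left_mult x a = 0 \<or> (\<exists>b. left_mult x a = svar b)" by (cases a) (auto simp: left_mult_def x)
    ultimately show ?thesis by (auto simp: smono_mult_svar) (auto simp: col_ideal_def smono_def)
  qed
  moreover have "smono (add_mset x M) \<in> col_ideal N"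
    using b by (auto simp: col_ideal_def smono_def)
  moreover from calculation(1) have "(\<Sum>a\<in>#M. smono (M - {#a#}) * left_mult x a) \<in> col_ideal N"
    by (intro subspace_sum_mset[OF subspace_col_ideal]) blast
  ultimately show "app (E x) (smono M) \<in> col_ideal N"
    unfolding app_E_smono using subspace_col_ideal[of N] by (auto simp: subspace_def)
qed

lemma preserves_cols_le: "j \<le> N \<Longrightarrow> preserves (cols_le N) (E (i, j, \<alpha>))"
proof (rule preserves_keysI[OF cols_le_def])
  fix M :: "idx multiset" assume j: "j \<le> N" and M: "\<forall>i j \<alpha>. (i, j, \<alpha>) \<in># M \<longrightarrow> j \<le> N"
  have "smono (M - {#a#}) * left_mult (i, j, \<alpha>) a \<in> cols_le N" if a: "a \<in># M" for a
  proof -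
    obtain k l \<beta> where x: "a = (k, l, \<beta>)" by (cases a)
    then have "l \<le> N" using M a by auto
    moreover have "left_mult (i, j, \<alpha>) a = 0 \<or> left_mult (i, j, \<alpha>) a = svar (i, l, \<alpha>)" by (auto simp: left_mult_def x)
    ultimately show ?thesis using M
      by (auto simp: smono_mult_svar) (auto simp: cols_le_def smono_def dest: in_diffD)
  qed
  moreover have "smono (add_mset (i, j, \<alpha>) M) \<in> cols_le N"
    using j M by (auto simp: cols_le_def smono_def)
  moreover from calculation(1) have "(\<Sum>a\<in>#M. smono (M - {#a#}) * left_mult (i, j, \<alpha>) a) \<in> cols_le N"
    by (intro subspace_sum_mset[OF subspace_cols_le]) blast
  ultimately show "app (E (i, j, \<alpha>)) (smono M) \<in> cols_le N"
    unfolding app_E_smono using subspace_cols_le[of N] by (auto simp: subspace_def)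
qed

lemma col_ideal_cols_le: "s \<in> col_ideal N \<Longrightarrow> s \<in> cols_le K \<Longrightarrow> K < N \<Longrightarrow> s = 0"
proof (rule ccontr)
  assume s: "s \<in> col_ideal N" "s \<in> cols_le K" "K < N" "s \<noteq> 0"
  then obtain M where "M \<in> ks s" by (meson all_not_in_conv keys_eq_empty)
  then show False using s by (fastforce simp: col_ideal_def cols_le_def)
qed

lemma one_cols_le: "1 \<in> cols_le N"
  by (simp add: cols_le_def)

section \<open>The generators in the concrete model\<close>

definition starts :: "nat \<Rightarrow> nat list \<Rightarrow> bool"
  where "starts \<alpha> w \<longleftrightarrow> w \<noteq> [] \<and> hd w = \<alpha>"

text \<open>These are the coefficients of \<open>T = (1 - \<Sum>\<^sub>\<alpha> E\<^sub>\<alpha> (u\<^sub>\<alpha> + c)\<^sup>-\<^sup>1)\<^sup>-\<^sup>1\<close>. The part of \<open>T\<close> that starts with \<open>u\<^sub>\<alpha>\<^sup>-\<^sup>1\<close> is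
\<open>(u\<^sub>\<alpha> + c)\<^sup>-\<^sup>1 E\<^sub>\<alpha> T\<close>; multiplication by \<open>u\<^sub>\<alpha> + c\<close> turns this into the recursion in the first letter.\<close>

fun tU :: "nat \<Rightarrow> complex \<Rightarrow> nat \<Rightarrow> nat \<Rightarrow> nat list \<Rightarrow> U" where
  "tU N c i j [] = (if i = j then 1 else 0)"
| "tU N c i j (\<alpha> # w) = (\<Sum>a\<in>{1..N}. E (i, a, \<alpha>) * tU N c a j w) -
    (if starts \<alpha> w then cst c * tU N c i j w else 0)"

lemma sum_delta_l: "(i::nat) \<in> {1..N} \<Longrightarrow> (\<Sum>a\<in>{1..N}. (if i = a then 1 else 0) * f a) = (f i :: U)"
  by (simp add: if_distrib[of "\<lambda>x. x * _"] cong: if_cong)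
lemma sum_delta_r: "(i::nat) \<in> {1..N} \<Longrightarrow> (\<Sum>a\<in>{1..N}. f a * (if a = i then 1 else 0)) = (f i :: U)"
  by (simp add: if_distrib[of "\<lambda>x. _ * x"] cong: if_cong)

lemma tU_single: "j \<in> {1..N} \<Longrightarrow> tU N c i j [\<alpha>] = E (i, j, \<alpha>)"
  using sum_delta_r[of j N "\<lambda>a. E (i, a, \<alpha>)"] by (simp add: starts_def)

lemma cst_left: "x * (cst c * y) = cst c * (x * y)"
  by (metis ua.cst_comm mult.assoc)

text \<open>The recursion says that \<open>t(w)\<close> is the matrix product of the factors \<open>E\<^bsub>w p\<^esub> - c [w\<^sub>p = w\<^bsub>p-1\<^esub>]\<close>, where \<open>[_]\<close> is
\<open>1\<close> or \<open>0\<close>. The correction involves a pair of neighbouring factors and can be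
attributed to the right one as well as to the left one, so the same recursion holds for the last letter.\<close>

lemma tU_snoc:
  assumes "i \<in> {1..N}" "j \<in> {1..N}"
  shows "tU N c i j (w @ [\<beta>]) = (\<Sum>a\<in>{1..N}. tU N c i a w * E (a, j, \<beta>)) -
    (if w \<noteq> [] \<and> last w = \<beta> then cst c * tU N c i j w else 0)"
  using assms(1)
proof (induction w arbitrary: i)
  case Nil
  then show ?case using sum_delta_l[of i N "\<lambda>a. E (a, j, \<beta>)"] tU_single[OF assms(2)] by simp
next
  case (Cons \<alpha> w)
  show ?case
  proof (cases "w = []")
    case True
    have "(\<Sum>a\<in>{1..N}. E (i, a, \<alpha>) * tU N c a j [\<beta>]) = (\<Sum>a\<in>{1..N}. tU N c i a [\<alpha>] * E (a, j, \<beta>))"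
      by (intro sum.cong refl) (simp only: tU_single assms(2))
    then show ?thesis using True tU_single[OF assms(2)] by (auto simp: starts_def)
  next
    case False
    define l where "l = (if last w = \<beta> then c else 0)"
    define h where "h = (if starts \<alpha> w then c else 0)"
    have IH: "tU N c a j (w @ [\<beta>]) = (\<Sum>b\<in>{1..N}. tU N c a b w * E (b, j, \<beta>)) - cst l * tU N c a j w"
      if "a \<in> {1..N}" for a
      using Cons.IH[OF that] False by (auto simp: l_def ua.cst_0)
    have c: "tU N c a b (\<alpha> # w) = (\<Sum>d\<in>{1..N}. E (a, d, \<alpha>) * tU N c d b w) - cst h * tU N c a b w" for a b
      by (simp add: h_def ua.cst_0)
    have "tU N c i j ((\<alpha> # w) @ [\<beta>]) = (\<Sum>a\<in>{1..N}. E (i, a, \<alpha>) * tU N c a j (w @ [\<beta>])) - cst h * tU N c i j (w @ [\<beta>])"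
      using False by (simp add: h_def starts_def ua.cst_0)
    also have "\<dots> = (\<Sum>a\<in>{1..N}. \<Sum>b\<in>{1..N}. E (i, a, \<alpha>) * tU N c a b w * E (b, j, \<beta>)) - cst l * (\<Sum>a\<in>{1..N}. E (i, a, \<alpha>) * tU N c a j w)
        - cst h * (\<Sum>b\<in>{1..N}. tU N c i b w * E (b, j, \<beta>)) + cst h * (cst l * tU N c i j w)"
    proof -
      have "(\<Sum>a\<in>{1..N}. E (i, a, \<alpha>) * tU N c a j (w @ [\<beta>])) =
          (\<Sum>a\<in>{1..N}. (\<Sum>b\<in>{1..N}. E (i, a, \<alpha>) * tU N c a b w * E (b, j, \<beta>)) - cst l * (E (i, a, \<alpha>) * tU N c a j w))"
        by (intro sum.cong refl) (simp add: IH right_diff_distrib sum_distrib_left mult.assoc cst_left[of _ l])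
      then show ?thesis
        unfolding IH[OF Cons.prems] by (simp add: sum_subtractf right_diff_distrib sum_distrib_left)
    qed
    also have "\<dots> = (\<Sum>b\<in>{1..N}. tU N c i b (\<alpha> # w) * E (b, j, \<beta>)) - cst l * tU N c i j (\<alpha> # w)"
    proof -
      have "(\<Sum>b\<in>{1..N}. tU N c i b (\<alpha> # w) * E (b, j, \<beta>)) =
          (\<Sum>b\<in>{1..N}. \<Sum>a\<in>{1..N}. E (i, a, \<alpha>) * tU N c a b w * E (b, j, \<beta>)) - cst h * (\<Sum>b\<in>{1..N}. tU N c i b w * E (b, j, \<beta>))"
        unfolding c by (simp add: left_diff_distrib sum_distrib_left sum_distrib_right sum_subtractf mult.assoc)
      also have "(\<Sum>b\<in>{1..N}. \<Sum>a\<in>{1..N}. E (i, a, \<alpha>) * tU N c a b w * E (b, j, \<beta>)) =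
          (\<Sum>a\<in>{1..N}. \<Sum>b\<in>{1..N}. E (i, a, \<alpha>) * tU N c a b w * E (b, j, \<beta>))"
        by (rule sum.swap)
      finally show ?thesis
        unfolding c right_diff_distrib cst_left[of "cst l" h] by simp
    qed
    finally show ?thesis using False by (simp add: l_def ua.cst_0 del: tU.simps)
  qed
qed

text \<open>For \<open>c = 0\<close> there are no corrections, and contracting an inner index concatenates words.\<close>

lemma tU_append:
  assumes "i \<in> {1..N}"
  shows "(\<Sum>a\<in>{1..N}. tU N 0 i a v * tU N 0 a j w) = tU N 0 i j (v @ w)"
  using assms
proof (induction v arbitrary: i)
  case Nil
  then show ?case using sum_delta_l[of i N "\<lambda>a. tU N 0 a j w"] by simp
next
  case (Cons \<alpha> v)
  have "(\<Sum>a\<in>{1..N}. tU N 0 i a (\<alpha> # v) * tU N 0 a j w) =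
      (\<Sum>a\<in>{1..N}. \<Sum>b\<in>{1..N}. E (i, b, \<alpha>) * (tU N 0 b a v * tU N 0 a j w))"
    by (simp add: ua.cst_0 sum_distrib_right mult.assoc cong: if_cong)
  also have "\<dots> = (\<Sum>b\<in>{1..N}. E (i, b, \<alpha>) * (\<Sum>a\<in>{1..N}. tU N 0 b a v * tU N 0 a j w))"
    unfolding sum_distrib_left by (rule sum.swap)
  also have "\<dots> = tU N 0 i j ((\<alpha> # v) @ w)"
  proof -
    have "(\<Sum>b\<in>{1..N}. E (i, b, \<alpha>) * (\<Sum>a\<in>{1..N}. tU N 0 b a v * tU N 0 a j w)) =
        (\<Sum>b\<in>{1..N}. E (i, b, \<alpha>) * tU N 0 b j (v @ w))"
      by (intro sum.cong refl) (simp only: Cons.IH)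
    then show ?thesis by (simp add: ua.cst_0 cong: if_cong)
  qed
  finally show ?case .
qed

subsection \<open>Commutators with matrix units\<close>

text \<open>A matrix unit \<open>E\<^sub>i\<^sub>j\<^sub>|\<^sub>\<alpha>\<close> breaks the matrix product \<open>t(w)\<close> at every letter \<open>\<alpha>\<close>, before and after that
letter. In the induction the corrections with \<open>c\<close> cancel: the term of the left-hand side that breaks
\<open>w\<close> at its first letter compensates the one that comes from \<open>E\<^sub>i\<^sub>a t\<^sub>a\<^sub>l(w) = t\<^sub>i\<^sub>l(\<alpha>w) + c t\<^sub>i\<^sub>l(w)\<close> when \<open>w\<close>
starts with \<open>\<alpha>\<close>.\<close>

lemma E_tU_comm:
  assumes "i \<in> {1..N}" "j \<in> {1..N}" "k \<in> {1..N}"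
  shows "E (i, j, \<alpha>) * tU N c k l w - tU N c k l w * E (i, j, \<alpha>) =
    (\<Sum>q<length w. if w ! q = \<alpha> then tU N c k j (take q w) * tU N c i l (drop q w) -
      tU N c k j (take (Suc q) w) * tU N c i l (drop (Suc q) w) else 0)"
  using assms(3)
proof (induction w arbitrary: k)
  case Nil
  then show ?case by simp
next
  case (Cons \<beta> w)
  let ?t = "tU N c"
  define h where "h = (if starts \<beta> w then c else 0)"
  define F where "F k = (\<Sum>q<length w. if w ! q = \<alpha> then ?t k j (take q w) * ?t i l (drop q w) -
      ?t k j (take (Suc q) w) * ?t i l (drop (Suc q) w) else 0)" for k
  have IH: "E (i, j, \<alpha>) * ?t k l w = ?t k l w * E (i, j, \<alpha>) + F k" if "k \<in> {1..N}" for k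
    using Cons.IH[OF that] by (simp add: F_def algebra_simps)
  have t: "?t a b (\<beta> # w) = (\<Sum>d\<in>{1..N}. E (a, d, \<beta>) * ?t d b w) - cst h * ?t a b w" for a b
    by (simp add: h_def ua.cst_0)
  define A where "A = (if \<alpha> = \<beta> then (if j = k then ?t i l (\<beta> # w) + cst h * ?t i l w else 0) - E (k, j, \<alpha>) * ?t i l w else 0)"
  have "E (i, j, \<alpha>) * E (k, a, \<beta>) * ?t a l w = E (k, a, \<beta>) * E (i, j, \<alpha>) * ?t a l w +
      ((if \<alpha> = \<beta> \<and> j = k then E (i, a, \<beta>) * ?t a l w else 0) - (if \<alpha> = \<beta> \<and> a = i then E (k, j, \<alpha>) * ?t a l w else 0))" for a
    using arg_cong[OF E_comm[of i j \<alpha> k a \<beta>], of "\<lambda>x. x * ?t a l w"]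
    by (auto simp: algebra_simps split: if_splits)
  then have "(\<Sum>a\<in>{1..N}. E (i, j, \<alpha>) * E (k, a, \<beta>) * ?t a l w) = (\<Sum>a\<in>{1..N}. E (k, a, \<beta>) * E (i, j, \<alpha>) * ?t a l w) +
      ((\<Sum>a\<in>{1..N}. if \<alpha> = \<beta> \<and> j = k then E (i, a, \<beta>) * ?t a l w else 0) - (\<Sum>a\<in>{1..N}. if \<alpha> = \<beta> \<and> a = i then E (k, j, \<alpha>) * ?t a l w else 0))"
    by (simp add: sum.distrib sum_subtractf)
  also have "(\<Sum>a\<in>{1..N}. if \<alpha> = \<beta> \<and> j = k then E (i, a, \<beta>) * ?t a l w else 0) =
      (if \<alpha> = \<beta> \<and> j = k then ?t i l (\<beta> # w) + cst h * ?t i l w else 0)"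
    by (cases "\<alpha> = \<beta> \<and> j = k") (auto simp: t simp del: tU.simps)
  also have "(\<Sum>a\<in>{1..N}. if \<alpha> = \<beta> \<and> a = i then E (k, j, \<alpha>) * ?t a l w else 0) = (if \<alpha> = \<beta> then E (k, j, \<alpha>) * ?t i l w else 0)"
    using assms(1) by (auto simp del: tU.simps)
  finally have 1: "(\<Sum>a\<in>{1..N}. E (i, j, \<alpha>) * E (k, a, \<beta>) * ?t a l w) = (\<Sum>a\<in>{1..N}. E (k, a, \<beta>) * E (i, j, \<alpha>) * ?t a l w) + A"
    by (auto simp: A_def simp del: tU.simps)
  have "E (i, j, \<alpha>) * ?t k l (\<beta> # w) = (\<Sum>a\<in>{1..N}. E (i, j, \<alpha>) * E (k, a, \<beta>) * ?t a l w) - cst h * (E (i, j, \<alpha>) * ?t k l w)"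
    unfolding t by (simp add: right_diff_distrib sum_distrib_left mult.assoc cst_left)
  also have "\<dots> = (\<Sum>a\<in>{1..N}. E (k, a, \<beta>) * (E (i, j, \<alpha>) * ?t a l w)) + A - cst h * (E (i, j, \<alpha>) * ?t k l w)"
    unfolding 1 by (simp add: mult.assoc)
  also have "\<dots> = ?t k l (\<beta> # w) * E (i, j, \<alpha>) + (\<Sum>a\<in>{1..N}. E (k, a, \<beta>) * F a) + A - cst h * F k"
    unfolding t using Cons.prems
    by (simp add: IH distrib_left sum.distrib left_diff_distrib sum_distrib_right mult.assoc algebra_simps)
  finally have lhs: "E (i, j, \<alpha>) * ?t k l (\<beta> # w) - ?t k l (\<beta> # w) * E (i, j, \<alpha>) =
      (\<Sum>a\<in>{1..N}. E (k, a, \<beta>) * F a) + A - cst h * F k"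
    by simp
  define H where "H q = (if w ! q = \<alpha> then ?t k j (\<beta> # take q w) * ?t i l (drop q w) -
      ?t k j (\<beta> # take (Suc q) w) * ?t i l (drop (Suc q) w) else 0)" for q
  define B where "B = (if \<beta> = \<alpha> then (if k = j then ?t i l (\<beta> # w) else 0) - E (k, j, \<beta>) * ?t i l w else 0)"
  (* the corrections of t(beta # take q w); there is none for the empty prefix *)
  define hq where "hq q = (if q = 0 then 0 else h)" for q :: nat
  have tq: "?t k j (\<beta> # take q w) = (\<Sum>d\<in>{1..N}. E (k, d, \<beta>) * ?t d j (take q w)) - cst (hq q) * ?t k j (take q w)" for q
    by (cases w; cases q) (simp_all add: h_def hq_def starts_def ua.cst_0)
  have "(if w ! q = \<alpha> then ?t k j (\<beta> # take q w) * ?t i l (drop q w) -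
      ?t k j (\<beta> # take (Suc q) w) * ?t i l (drop (Suc q) w) else 0) =
      (\<Sum>a\<in>{1..N}. E (k, a, \<beta>) * (if w ! q = \<alpha> then ?t a j (take q w) * ?t i l (drop q w) -
      ?t a j (take (Suc q) w) * ?t i l (drop (Suc q) w) else 0))
      - cst h * (if w ! q = \<alpha> then ?t k j (take q w) * ?t i l (drop q w) -
      ?t k j (take (Suc q) w) * ?t i l (drop (Suc q) w) else 0) + (if q = 0 \<and> w ! q = \<alpha> \<and> k = j then cst h * ?t i l w else 0)" for q
    unfolding tq by (simp add: hq_def right_diff_distrib left_diff_distrib sum_distrib_right sum_subtractf mult.assoc ua.cst_0)
  then have "(\<Sum>q<length w. H q) = (\<Sum>q<length w. \<Sum>a\<in>{1..N}. E (k, a, \<beta>) * (if w ! q = \<alpha> then ?t a j (take q w) * ?t i l (drop q w) -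
      ?t a j (take (Suc q) w) * ?t i l (drop (Suc q) w) else 0)) - cst h * F k + (\<Sum>q<length w. if q = 0 \<and> w ! q = \<alpha> \<and> k = j then cst h * ?t i l w else 0)"
    unfolding H_def F_def by (simp add: sum.distrib sum_subtractf sum_distrib_left)
  also have "(\<Sum>q<length w. if q = 0 \<and> w ! q = \<alpha> \<and> k = j then cst h * ?t i l w else 0) =
      (if \<alpha> = \<beta> \<and> k = j then cst h * ?t i l w else 0)"
    by (cases w) (auto simp: sum.lessThan_Suc_shift h_def starts_def ua.cst_0 simp del: tU.simps sum.lessThan_Suc)
  also have "(\<Sum>q<length w. \<Sum>a\<in>{1..N}. E (k, a, \<beta>) * (if w ! q = \<alpha> then ?t a j (take q w) * ?t i l (drop q w) -
      ?t a j (take (Suc q) w) * ?t i l (drop (Suc q) w) else 0)) = (\<Sum>a\<in>{1..N}. E (k, a, \<beta>) * F a)"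
    unfolding F_def sum_distrib_left by (rule sum.swap)
  finally have H: "(\<Sum>q<length w. H q) = (\<Sum>a\<in>{1..N}. E (k, a, \<beta>) * F a) - cst h * F k + (if \<alpha> = \<beta> \<and> k = j then cst h * ?t i l w else 0)" .
  have "(\<Sum>q<length (\<beta> # w). if (\<beta> # w) ! q = \<alpha> then ?t k j (take q (\<beta> # w)) * ?t i l (drop q (\<beta> # w)) -
      ?t k j (take (Suc q) (\<beta> # w)) * ?t i l (drop (Suc q) (\<beta> # w)) else 0) = B + (\<Sum>q<length w. H q)"
    unfolding length_Cons sum.lessThan_Suc_shift B_def H_def
    by (simp add: tU_single[OF assms(2)] del: tU.simps(2) cong: if_cong)
  also have "\<dots> = (\<Sum>a\<in>{1..N}. E (k, a, \<beta>) * F a) + A - cst h * F k"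
    unfolding H A_def B_def by (auto simp del: tU.simps)
  finally show ?case unfolding lhs by simp
qed

text \<open>Summed over all copies, the terms of \<open>E_tU_comm\<close> telescope to the two ends of the word, where they
carry the factors \<open>\<delta>\<^sub>k\<^sub>j\<close> and \<open>\<delta>\<^sub>i\<^sub>l\<close>.\<close>

lemma diag_tU_comm:
  assumes "i \<in> {1..N}" "j \<in> {1..N}" "k \<in> {1..N}" "set w \<subseteq> {1..L}" "i \<noteq> l" "k \<noteq> j"
  shows "(\<Sum>\<alpha>\<in>{1..L}. E (i, j, \<alpha>)) * tU N c k l w = tU N c k l w * (\<Sum>\<alpha>\<in>{1..L}. E (i, j, \<alpha>))"
proof -
  let ?f = "\<lambda>q. tU N c k j (take q w) * tU N c i l (drop q w)"
  have "(\<Sum>\<alpha>\<in>{1..L}. E (i, j, \<alpha>)) * tU N c k l w - tU N c k l w * (\<Sum>\<alpha>\<in>{1..L}. E (i, j, \<alpha>)) =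
    (\<Sum>\<alpha>\<in>{1..L}. \<Sum>q<length w. if w ! q = \<alpha> then ?f q - ?f (Suc q) else 0)"
    by (simp add: sum_distrib_left sum_distrib_right E_tU_comm[OF assms(1-3)] flip: sum_subtractf)
  also have "\<dots> = (\<Sum>q<length w. \<Sum>\<alpha>\<in>{1..L}. if w ! q = \<alpha> then ?f q - ?f (Suc q) else 0)"
    by (rule sum.swap)
  also have "\<dots> = (\<Sum>q<length w. ?f q - ?f (Suc q))"
    using assms(4) by (intro sum.cong refl) (auto simp: subset_iff)
  also have "\<dots> = ?f 0 - ?f (length w)"
    by (rule sum_lessThan_telescope')
  also have "\<dots> = 0" using assms(5,6) by simp
  finally show ?thesis by simp
qed

subsection \<open>Filtered subalgebras and the projection\<close>

text \<open>The images in the model of the filtered pieces of \<open>U(gl(N)\<^sup>L)\<close>, generated inside the model.\<close>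

inductive Fmod :: "nat \<Rightarrow> nat \<Rightarrow> nat \<Rightarrow> U \<Rightarrow> bool" for L N where
  Fmod_cst: "Fmod L N n (cst c)"
| Fmod_E: "i \<in> {1..N} \<Longrightarrow> j \<in> {1..N} \<Longrightarrow> \<alpha> \<in> {1..L} \<Longrightarrow> Fmod L N (Suc n) (E (i, j, \<alpha>))"
| Fmod_add: "Fmod L N n u \<Longrightarrow> Fmod L N n v \<Longrightarrow> Fmod L N n (u + v)"
| Fmod_mult: "Fmod L N n u \<Longrightarrow> Fmod L N m v \<Longrightarrow> n + m \<le> k \<Longrightarrow> Fmod L N k (u * v)"

definition Umod :: "nat \<Rightarrow> nat \<Rightarrow> U set"
  where "Umod L N = {u. \<exists>n. Fmod L N n u}"

lemma Fmod_1: "Fmod L N n 1" and Fmod_0: "Fmod L N n 0"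
  using Fmod_cst[of L N n 1] Fmod_cst[of L N n 0] by (simp_all add: ua.cst_1 ua.cst_0)
lemma Fmod_mono: "Fmod L N n u \<Longrightarrow> n \<le> m \<Longrightarrow> Fmod L N m u"
  using Fmod_mult[OF _ Fmod_1[of L N 0], of n u m] by simp
lemma Fmod_scale: "Fmod L N n u \<Longrightarrow> Fmod L N n (cst c * u)"
  using Fmod_mult[OF Fmod_cst[of L N 0 c], of n u n] by simp
lemma Fmod_uminus: "Fmod L N n u \<Longrightarrow> Fmod L N n (- u)"
  using Fmod_scale[of L N n u "-1"] by (simp add: ua.cst_uminus ua.cst_1)
lemma Fmod_diff: "Fmod L N n u \<Longrightarrow> Fmod L N n v \<Longrightarrow> Fmod L N n (u - v)"
  using Fmod_add[OF _ Fmod_uminus, of L N n u v] by simp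
lemma Fmod_sum: "(\<And>x. x \<in> A \<Longrightarrow> Fmod L N n (f x)) \<Longrightarrow> Fmod L N n (sum f A)"
  by (induction A rule: infinite_finite_induct) (auto simp: Fmod_0 Fmod_add)
lemma Fmod_prod_list:
  "(\<And>x. x \<in> set xs \<Longrightarrow> Fmod L N (d x) (f x)) \<Longrightarrow> Fmod L N (sum_list (map d xs)) (prod_list (map f xs))"
  by (induction xs) (auto simp: Fmod_1 intro: Fmod_mult)

lemma Fmod_tU:
  assumes "i \<in> {1..N}" "j \<in> {1..N}" "set w \<subseteq> {1..L}"
  shows "Fmod L N (length w) (tU N c i j w)"
  using assms(1,3)
proof (induction w arbitrary: i)
  case Nil
  then show ?case by (simp add: Fmod_1 Fmod_0)
next
  case (Cons \<alpha> w)
  have "Fmod L N (Suc (length w)) (E (i, a, \<alpha>) * tU N c a j w)" if "a \<in> {1..N}" for a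
    using Fmod_mult[OF Fmod_E[of i N a \<alpha> L 0] Cons.IH[OF that]] Cons.prems that by simp
  moreover have "Fmod L N (Suc (length w)) (if starts \<alpha> w then cst c * tU N c i j w else 0)"
    using Fmod_mono[OF Fmod_scale[OF Cons.IH[OF Cons.prems(1)]]] Cons.prems by (simp add: Fmod_0)
  ultimately show ?case unfolding tU.simps length_Cons by (intro Fmod_diff Fmod_sum)
qed

lemma Umod_add: "u \<in> Umod L N \<Longrightarrow> v \<in> Umod L N \<Longrightarrow> u + v \<in> Umod L N"
  unfolding Umod_def mem_Collect_eq by (metis Fmod_add Fmod_mono nat_le_linear)
lemma Umod_cst: "cst c \<in> Umod L N"
  unfolding Umod_def by (blast intro: Fmod_cst)
lemma Umod_Fmod: "Fmod L N n u \<Longrightarrow> u \<in> Umod L N"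
  unfolding Umod_def by blast
lemma Umod_uminus: "u \<in> Umod L N \<Longrightarrow> - u \<in> Umod L N"
  unfolding Umod_def by (blast intro: Fmod_uminus)
lemma Umod_diff: "u \<in> Umod L N \<Longrightarrow> v \<in> Umod L N \<Longrightarrow> u - v \<in> Umod L N"
  using Umod_add[OF _ Umod_uminus, of u L N v] by simp
lemma Umod_E: "i \<in> {1..N} \<Longrightarrow> j \<in> {1..N} \<Longrightarrow> \<alpha> \<in> {1..L} \<Longrightarrow> E (i, j, \<alpha>) \<in> Umod L N"
  unfolding Umod_def by (blast intro: Fmod_E)

text \<open>The image of the left ideal \<open>I\<^sup>+(N)\<close>.\<close>

inductive_set Imod :: "nat \<Rightarrow> nat \<Rightarrow> U set" for L N where
  Imod_0: "0 \<in> Imod L N"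
| Imod_E: "i \<in> {1..N} \<Longrightarrow> \<alpha> \<in> {1..L} \<Longrightarrow> E (i, N, \<alpha>) \<in> Imod L N"
| Imod_add: "u \<in> Imod L N \<Longrightarrow> v \<in> Imod L N \<Longrightarrow> u + v \<in> Imod L N"
| Imod_left: "u \<in> Umod L N \<Longrightarrow> v \<in> Imod L N \<Longrightarrow> u * v \<in> Imod L N"

lemma Imod_uminus: "u \<in> Imod L N \<Longrightarrow> - u \<in> Imod L N"
  using Imod_left[OF Umod_cst, of u L N "-1"] by (simp add: ua.cst_uminus ua.cst_1)
lemma Imod_diff: "u \<in> Imod L N \<Longrightarrow> v \<in> Imod L N \<Longrightarrow> u - v \<in> Imod L N"
  using Imod_add[OF _ Imod_uminus, of u L N v] by simp
lemma Imod_sum: "(\<And>x. x \<in> A \<Longrightarrow> f x \<in> Imod L N) \<Longrightarrow> sum f A \<in> Imod L N"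
  by (induction A rule: infinite_finite_induct) (auto simp: Imod_0 Imod_add)
lemma Imod_scale: "u \<in> Imod L N \<Longrightarrow> cst c * u \<in> Imod L N"
  by (rule Imod_left[OF Umod_cst])

lemma Imod_right_E:
  assumes "k \<in> {1..K}" "l \<in> {1..K}" "\<alpha> \<in> {1..L}"
  shows "u \<in> Imod L (Suc K) \<Longrightarrow> u * E (k, l, \<alpha>) \<in> Imod L (Suc K)"
proof (induction rule: Imod.induct)
  case (Imod_E i \<beta>)
  have "E (i, Suc K, \<beta>) * E (k, l, \<alpha>) = E (k, l, \<alpha>) * E (i, Suc K, \<beta>) - (if \<beta> = \<alpha> \<and> l = i then E (k, Suc K, \<beta>) else 0)"
    using E_comm[of i "Suc K" \<beta> k l \<alpha>] assms by (simp add: algebra_simps)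
  moreover have "E (k, l, \<alpha>) * E (i, Suc K, \<beta>) \<in> Imod L (Suc K)"
    using Imod_E assms by (intro Imod.Imod_left Umod_E Imod.Imod_E) auto
  moreover have "(if \<beta> = \<alpha> \<and> l = i then E (k, Suc K, \<beta>) else 0) \<in> Imod L (Suc K)"
    using Imod_E assms by (auto intro!: Imod.Imod_E Imod_0)
  ultimately show ?case using Imod_diff by simp
qed (auto simp: Imod_0 distrib_right mult.assoc intro: Imod_add Imod_left)

text \<open>The commutator of \<open>E\<^bsub>iN\<^esub>\<close> with \<open>E\<^sub>k\<^sub>l\<close> for \<open>k, l < N\<close> is a multiple of \<open>E\<^bsub>kN\<^esub>\<close>. Therefore reduction modulo the left
ideal is compatible with products of elements of \<open>U(gl(N-1)\<^sup>L) + I\<^sup>+(N)\<close>.\<close>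

lemma Imod_right:
  assumes "u \<in> Imod L (Suc K)" "h \<in> Umod L K"
  shows "u * h \<in> Imod L (Suc K)"
proof -
  obtain n where "Fmod L K n h" using assms(2) by (auto simp: Umod_def)
  then show ?thesis using assms(1)
  proof (induction arbitrary: u rule: Fmod.induct)
    case (Fmod_cst n c)
    then show ?case by (metis Imod_scale ua.cst_comm)
  next
    case (Fmod_E i j \<alpha> n)
    then show ?case by (rule Imod_right_E)
  next
    case (Fmod_add n u v)
    then show ?case by (simp add: distrib_left Imod_add)
  next
    case (Fmod_mult n u m v k)
    then show ?case by (simp flip: mult.assoc)
  qed
qed

lemma tU_last_col:
  assumes "i \<in> {1..N}" "w \<noteq> [] \<or> i \<noteq> N" "set w \<subseteq> {1..L}"
  shows "tU N c i N w \<in> Imod L N"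
  using assms(2,3)
proof (induction w rule: rev_induct)
  case Nil
  then show ?case by (simp add: Imod_0)
next
  case (snoc \<beta> w)
  have N: "N \<in> {1..N}" using assms(1) by auto
  have "tU N c i a w * E (a, N, \<beta>) \<in> Imod L N" if "a \<in> {1..N}" for a
    using that snoc.prems Fmod_tU[OF assms(1) that, of w L c] by (intro Imod_left Imod_E) (auto intro: Umod_Fmod)
  moreover have "(if w \<noteq> [] \<and> last w = \<beta> then cst c * tU N c i N w else 0) \<in> Imod L N"
    using snoc by (auto simp: Imod_0 intro!: Imod_scale)
  ultimately show ?case
    unfolding tU_snoc[OF assms(1) N] by (intro Imod_diff Imod_sum)
qed

text \<open>In the recursion for the last letter \<open>\<beta>\<close> the summand with the index \<open>N\<close> is \<open>t\<^bsub>iN\<^esub>(w) E\<^bsub>Nj|\<beta>\<^esub>\<close>. Moving the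
matrix unit to the left produces the commutator \<open>E_tU_comm\<close>, all of whose terms end in column \<open>N\<close>
except the very last one, which is \<open>t\<^sub>i\<^sub>j(w)\<close> if \<open>w\<close> ends with \<open>\<beta>\<close>. This one term changes the correction
from \<open>c\<close> to \<open>c - 1\<close>.\<close>

lemma tU_project:
  assumes "i \<in> {1..K}" "j \<in> {1..K}" "set w \<subseteq> {1..L}"
  shows "tU (Suc K) c i j w - tU K (c - 1) i j w \<in> Imod L (Suc K)"
  using assms(2,3)
proof (induction w arbitrary: j rule: rev_induct)
  case Nil
  then show ?case by (simp add: Imod_0)
next
  case (snoc \<beta> w)
  let ?N = "Suc K"
  let ?t = "tU ?N c" and ?t' = "tU K (c - 1)"
  have w: "set w \<subseteq> {1..L}" and b: "\<beta> \<in> {1..L}" using snoc.prems by auto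
  have iN: "i \<in> {1..?N}" and jN: "j \<in> {1..?N}" and NN: "?N \<in> {1..?N}" using assms(1) snoc.prems by auto
  define l where "l = (w \<noteq> [] \<and> last w = \<beta>)"
  define r where "r = (if l then 1 else 0 :: complex)"
  have e1: "?t i j (w @ [\<beta>]) = (\<Sum>a\<in>{1..K}. ?t i a w * E (a, j, \<beta>)) + ?t i ?N w * E (?N, j, \<beta>) - cst (c * r) * ?t i j w"
    unfolding tU_snoc[OF iN jN] by (auto simp: l_def r_def ua.cst_0 simp del: tU.simps)
  have e2: "?t' i j (w @ [\<beta>]) = (\<Sum>a\<in>{1..K}. ?t' i a w * E (a, j, \<beta>)) - cst ((c - 1) * r) * ?t' i j w"
    unfolding tU_snoc[OF assms(1) snoc.prems(1)] by (auto simp: l_def r_def ua.cst_0)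
  have FNt: "tU ?N c i j' (take q w) \<in> Umod L ?N" if "j' \<in> {1..?N}" for j' q
    using that w iN set_take_subset[of q w] by (intro Umod_Fmod[OF Fmod_tU]) auto
  have com: "E (?N, j, \<beta>) * ?t i ?N w - ?t i ?N w * E (?N, j, \<beta>) + cst r * ?t i j w \<in> Imod L ?N"
  proof (cases w rule: rev_cases)
    case Nil
    then show ?thesis using assms(1) by (simp add: r_def l_def ua.cst_0 Imod_0)
  next
    case (snoc w' \<gamma>)
    define f where "f q = (if w ! q = \<beta> then ?t i j (take q w) * ?t ?N ?N (drop q w) -
      ?t i j (take (Suc q) w) * ?t ?N ?N (drop (Suc q) w) else 0)" for q
    have mem: "?t i j (take q w) * ?t ?N ?N (drop q w) \<in> Imod L ?N" if "q < length w" for q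
      using that w set_drop_subset[of q w] by (intro Imod_left FNt jN tU_last_col NN) auto
    have 1: "f q \<in> Imod L ?N" if "q < length w'" for q
      using mem[of q] mem[of "Suc q"] that snoc by (auto simp: f_def Imod_0 intro!: Imod_diff)
    have "f (length w') + cst r * ?t i j w = (if \<gamma> = \<beta> then ?t i j w' * ?t ?N ?N [\<gamma>] else 0)"
      using snoc by (simp add: f_def r_def l_def ua.cst_0 ua.cst_1 del: tU.simps(2))
    then have 2: "f (length w') + cst r * ?t i j w \<in> Imod L ?N"
      using mem[of "length w'"] snoc by (auto simp: Imod_0 simp del: tU.simps(2))
    have "E (?N, j, \<beta>) * ?t i ?N w - ?t i ?N w * E (?N, j, \<beta>) = (\<Sum>q<length w'. f q) + f (length w')"
      unfolding E_tU_comm[OF NN jN iN] using snoc by (simp add: f_def del: tU.simps(2))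
    then show ?thesis using Imod_add[OF Imod_sum[of "{..<length w'}" f] 2] 1 by (simp add: add.assoc)
  qed
  have m1: "(\<Sum>a\<in>{1..K}. (?t i a w - ?t' i a w) * E (a, j, \<beta>)) \<in> Imod L ?N"
    using snoc.IH w snoc.prems(1) b by (intro Imod_sum Imod_right_E) auto
  have m2: "E (?N, j, \<beta>) * ?t i ?N w \<in> Imod L ?N"
    using w assms(1) iN jN NN b by (intro Imod_left Umod_E tU_last_col) auto
  have m3: "cst r * (?t i j w - ?t' i j w) \<in> Imod L ?N" "cst (c * r) * (?t i j w - ?t' i j w) \<in> Imod L ?N"
    using snoc.IH[OF snoc.prems(1) w] by (auto intro: Imod_scale)
  have "?t i j (w @ [\<beta>]) - ?t' i j (w @ [\<beta>]) =
      (\<Sum>a\<in>{1..K}. (?t i a w - ?t' i a w) * E (a, j, \<beta>)) + E (?N, j, \<beta>) * ?t i ?N w -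
      (E (?N, j, \<beta>) * ?t i ?N w - ?t i ?N w * E (?N, j, \<beta>) + cst r * ?t i j w) +
      cst r * (?t i j w - ?t' i j w) - cst (c * r) * (?t i j w - ?t' i j w)"
    unfolding e1 e2 left_diff_distrib right_diff_distrib sum_subtractf ua.cst_diff ua.cst_mult ua.cst_1
    by (simp del: tU.simps)
  then show ?case
    using Imod_diff[OF Imod_add[OF Imod_diff[OF Imod_add[OF m1 m2] com] m3(1)] m3(2)] by simp
qed

lemma Imod_col_ideal: "u \<in> Imod L N \<Longrightarrow> app u 1 \<in> col_ideal N"
proof (induction rule: Imod.induct)
  case (Imod_E i \<alpha>)
  have "app (E (i, N, \<alpha>)) 1 = smono {#(i, N, \<alpha>)#}"
    using app_E_smono[of "(i, N, \<alpha>)" "{#}"] by (simp add: smono_def)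
  then show ?case by (auto simp: col_ideal_def smono_def)
next
  case (Imod_left u v)
  obtain n where "Fmod L N n u" using Imod_left.hyps by (auto simp: Umod_def)
  then have "preserves (col_ideal N) u"
    by (induction rule: Fmod.induct) (auto intro: preserves_cst preserves_add preserves_mult preserves_col_ideal subspace_col_ideal)
  then show ?case using Imod_left.IH by (simp add: preserves_def app_simps)
qed (use subspace_col_ideal[of N] in \<open>auto simp: app_simps subspace_def\<close>)

lemma Umod_cols_le: "u \<in> Umod L N \<Longrightarrow> app u 1 \<in> cols_le N"
proof -
  assume "u \<in> Umod L N"
  then obtain n where "Fmod L N n u" by (auto simp: Umod_def)
  then have "preserves (cols_le N) u"
    by (induction rule: Fmod.induct) (auto intro: preserves_cst preserves_add preserves_mult preserves_cols_le subspace_cols_le)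
  then show ?thesis using one_cols_le by (auto simp: preserves_def)
qed

lemma Imod_Umod_app: "u \<in> Imod L (Suc K) \<Longrightarrow> u \<in> Umod L K \<Longrightarrow> app u 1 = 0"
  using col_ideal_cols_le[OF Imod_col_ideal Umod_cols_le] by blast

section \<open>Change of the shift parameter\<close>

text \<open>The words \<open>v\<close>, with coefficients, in the expansion of \<open>t(w; s + c)\<close> through the \<open>t(v; s)\<close>.\<close>

fun shift_word :: "complex \<Rightarrow> nat list \<Rightarrow> (nat list \<times> complex) list" where
  "shift_word c [] = [([], 1)]"
| "shift_word c (\<alpha> # w) = map (\<lambda>(v, z). (\<alpha> # v, z)) (shift_word c w) @
    (if starts \<alpha> w then map (\<lambda>(v, z). (v, - c * z)) (shift_word c w) else [])"

lemma shift_word_props: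
  "(v, z) \<in> set (shift_word c w) \<Longrightarrow> (w = [] \<longleftrightarrow> v = []) \<and> (w \<noteq> [] \<longrightarrow> hd v = hd w) \<and> length v \<le> length w \<and> set v \<subseteq> set w"
proof (induction w arbitrary: v z)
  case Nil
  then show ?case by simp
next
  case (Cons \<alpha> w)
  from Cons.prems consider v' where "v = \<alpha> # v'" "(v', z) \<in> set (shift_word c w)"
    | z' where "starts \<alpha> w" "(v, z') \<in> set (shift_word c w)"
    by (auto split: if_splits)
  then show ?case
  proof cases
    case 1
    then show ?thesis using Cons.IH[OF 1(2)] by auto
  next
    case 2
    then show ?thesis using Cons.IH[OF 2(2)] by (auto simp: starts_def)
  qed
qed

text \<open>All words that occur in the expansion of \<open>w\<close> start with the letter of \<open>w\<close>, so the recursions for the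
two parameters have their corrections at the same places and differ by the multiple \<open>c'\<close>.\<close>

lemma tU_shift:
  "tU N (c + c') i j w = (\<Sum>(v, z)\<leftarrow>shift_word c' w. cst z * tU N c i j v)"
proof (induction w arbitrary: i)
  case Nil
  then show ?case by (simp add: ua.cst_1)
next
  case (Cons \<alpha> w)
  let ?S' = "\<lambda>xs f. \<Sum>(v, z)\<leftarrow>xs. cst z * (f v :: U)"
  let ?S = "?S' (shift_word c' w)"
  have S_sum: "?S' xs (\<lambda>v. \<Sum>a\<in>A. g a v) = (\<Sum>a\<in>A. ?S' xs (g a))" for A :: "nat set" and g xs
    by (induction xs) (auto simp: sum.distrib sum_distrib_left)
  have S_mult: "?S' xs (\<lambda>v. x * g v) = x * ?S' xs g" for x g xs
    by (induction xs) (auto simp: distrib_left cst_left[of x])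
  have S_diff: "?S' xs (\<lambda>v. f v - g v) = ?S' xs f - ?S' xs g" for f g xs
    by (induction xs) (auto simp: algebra_simps)
  have S_cong: "?S f = ?S g" if "\<And>v z. (v, z) \<in> set (shift_word c' w) \<Longrightarrow> f v = g v" for f g
    using that by (intro arg_cong[where f = sum_list] map_cong) auto
  have st: "starts \<alpha> v = starts \<alpha> w" if "(v, z) \<in> set (shift_word c' w)" for v z
    using shift_word_props[OF that] by (auto simp: starts_def)
  define h where "h = (if starts \<alpha> w then 1 else 0 :: complex)"
  have "?S (\<lambda>v. tU N c i j (\<alpha> # v)) = ?S (\<lambda>v. (\<Sum>a\<in>{1..N}. E (i, a, \<alpha>) * tU N c a j v) - cst (h * c) * tU N c i j v)"
    by (rule S_cong) (auto simp: st h_def ua.cst_0)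
  also have "\<dots> = (\<Sum>a\<in>{1..N}. E (i, a, \<alpha>) * ?S (tU N c a j)) - cst (h * c) * ?S (tU N c i j)"
    by (simp only: S_diff S_sum S_mult)
  finally have 1: "?S (\<lambda>v. tU N c i j (\<alpha> # v)) =
    (\<Sum>a\<in>{1..N}. E (i, a, \<alpha>) * tU N (c + c') a j w) - cst (h * c) * tU N (c + c') i j w"
    by (simp only: Cons.IH)
  have S2': "(\<Sum>(v, z)\<leftarrow>map (\<lambda>(v, z). (v, - c' * z)) xs. cst z * tU N c i j v) = - (cst c' * ?S' xs (tU N c i j))" for xs
    by (induction xs) (auto simp: ua.cst_mult ua.cst_uminus algebra_simps intro: cst_left)
  have S2: "(\<Sum>(v, z)\<leftarrow>map (\<lambda>(v, z). (v, - c' * z)) (shift_word c' w). cst z * tU N c i j v) = - (cst c' * tU N (c + c') i j w)"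
    unfolding Cons.IH by (rule S2')
  have S3: "(\<Sum>(v, z)\<leftarrow>map (\<lambda>(v, z). (\<alpha> # v, z)) xs. cst z * tU N c i j v) = ?S' xs (\<lambda>v. tU N c i j (\<alpha> # v))" for xs
    by (induction xs) auto
  show ?case
    unfolding shift_word.simps map_append sum_list.append S3 1 using S2
    by (auto simp: h_def ua.cst_0 ua.cst_add algebra_simps)
qed

section \<open>Symbols of the generators\<close>

text \<open>The sum, over the paths from \<open>i\<close> to \<open>j\<close> with edge labels \<open>w\<close>, of the products of the edge weights \<open>\<xi>\<close>.\<close>

fun path_sym :: "nat \<Rightarrow> (idx \<Rightarrow> complex) \<Rightarrow> nat \<Rightarrow> nat \<Rightarrow> nat list \<Rightarrow> complex" where
  "path_sym N \<xi> i j [] = (if i = j then 1 else 0)"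
| "path_sym N \<xi> i j (\<alpha> # w) = (\<Sum>a\<in>{1..N}. \<xi> (i, a, \<alpha>) * path_sym N \<xi> a j w)"

lemma has_symbol_tU: "has_symbol (length w) \<xi> (tU N c i j w) (path_sym N \<xi> i j w)"
proof (induction w arbitrary: i)
  case Nil
  then show ?case by (simp add: has_symbol_1 has_symbol_0)
next
  case (Cons \<alpha> w)
  have "has_symbol (Suc (length w)) \<xi> (if starts \<alpha> w then cst c * tU N c i j w else 0) 0"
    using has_symbol_less[OF has_symbol_scale[OF Cons.IH[of i]]] by (auto simp: has_symbol_0)
  moreover have "has_symbol (Suc (length w)) \<xi> (\<Sum>a\<in>{1..N}. E (i, a, \<alpha>) * tU N c a j w) (path_sym N \<xi> i j (\<alpha> # w))"
    unfolding path_sym.simps using has_symbol_mult[OF has_symbol_E Cons.IH] by (intro has_symbol_sum) simp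
  ultimately show ?case using has_symbol_diff by fastforce
qed

text \<open>The weight of the excursion from \<open>i\<close> to \<open>j\<close> along \<open>w\<close> is the prescribed value minus the contribution
of the paths that return to \<open>{1..d}\<close> earlier; this is a triangular system with respect to length.\<close>

function path_weight :: "nat \<Rightarrow> (nat \<times> nat \<times> nat list \<Rightarrow> complex) \<Rightarrow> nat \<Rightarrow> nat \<Rightarrow> nat list \<Rightarrow> complex" where
  "path_weight d y i j w = y (i, j, w) -
    (\<Sum>k\<in>{1..<length w}. \<Sum>b\<in>{1..d}. path_weight d y i b (take k w) * y (b, j, drop k w))"
  by auto
termination by (relation "measure (\<lambda>(d, y, i, j, w). length w)") auto

declare path_weight.simps [simp del]

text \<open>At the vertex \<open>(j, v)\<close> the word \<open>v\<close> has still to be read before \<open>j\<close> is reached; so \<open>(j, [])\<close> has to be the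
vertex \<open>j\<close> itself.\<close>

definition vertex :: "nat \<Rightarrow> nat \<Rightarrow> nat list \<Rightarrow> nat"
  where "vertex d j v = (if v = [] then j else d + 1 + to_nat (j, v))"

lemma vertex_inj:
  "j \<in> {1..d} \<Longrightarrow> j' \<in> {1..d} \<Longrightarrow> vertex d j v = vertex d j' v' \<longleftrightarrow> j = j' \<and> v = v'"
  by (auto simp: vertex_def split: if_splits)

definition verts :: "nat \<Rightarrow> nat \<Rightarrow> nat \<Rightarrow> (nat \<times> nat list) set"
  where "verts d L n = {1..d} \<times> {v. set v \<subseteq> {1..L} \<and> length v < n}"

lemma verts_inj: "inj_on (\<lambda>(j, v). vertex d j v) (verts d L n)"
  by (auto simp: inj_on_def verts_def vertex_inj simp del: atLeastAtMost_iff)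

lemma finite_verts: "finite (verts d L n)"
proof -
  have "finite {v. set v \<subseteq> {1..L} \<and> length v \<le> n}"
    by (rule finite_lists_length_le) simp
  then have "finite {v. set v \<subseteq> {1..L} \<and> length v < n}"
    by (rule finite_subset[rotated]) auto
  then show ?thesis by (simp add: verts_def)
qed

text \<open>From \<open>i \<le> d\<close> a weighted edge labelled \<open>\<alpha>\<close> leads to \<open>(j, v)\<close>, with the weight that belongs to the word \<open>\<alpha>v\<close>.
All other edges have weight \<open>1\<close> and only read the next letter of the word in the vertex.\<close>

definition path_point :: "nat \<Rightarrow> nat \<Rightarrow> nat \<Rightarrow> (nat \<times> nat \<times> nat list \<Rightarrow> complex) \<Rightarrow> idx \<Rightarrow> complex"
  where "path_point d L n y = (\<lambda>(i, a, \<alpha>).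
    if i \<le> d then
      (if a \<in> (\<lambda>(j, v). vertex d j v) ` verts d L n
       then (case the_inv_into (verts d L n) (\<lambda>(j, v). vertex d j v) a of (j, v) \<Rightarrow> path_weight d y i j (\<alpha> # v))
       else 0)
    else if \<exists>j v. j \<in> {1..d} \<and> i = vertex d j (\<alpha> # v) \<and> a = vertex d j v then 1 else 0)"

lemma path_point_start:
  assumes "i \<le> d" "(j, v) \<in> verts d L n"
  shows "path_point d L n y (i, vertex d j v, \<alpha>) = path_weight d y i j (\<alpha> # v)"
proof -
  have "the_inv_into (verts d L n) (\<lambda>(j, v). vertex d j v) (vertex d j v) = (j, v)"
    using the_inv_into_f_f[OF verts_inj assms(2)] by simp
  moreover have "vertex d j v \<in> (\<lambda>(j, v). vertex d j v) ` verts d L n"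
    using assms(2) by (rule image_eqI[rotated]) simp
  ultimately show ?thesis using assms(1) by (simp add: path_point_def)
qed

lemma path_point_inner:
  assumes "j \<in> {1..d}"
  shows "path_point d L n y (vertex d j (\<beta> # v), a, \<alpha>) = (if \<alpha> = \<beta> \<and> a = vertex d j v then 1 else 0)"
proof -
  have "\<not> vertex d j (\<beta> # v) \<le> d" by (simp add: vertex_def)
  moreover have "(\<exists>j' v'. j' \<in> {1..d} \<and> vertex d j (\<beta> # v) = vertex d j' (\<alpha> # v') \<and> a = vertex d j' v') \<longleftrightarrow>
      \<alpha> = \<beta> \<and> a = vertex d j v"
  proof
    assume "\<exists>j' v'. j' \<in> {1..d} \<and> vertex d j (\<beta> # v) = vertex d j' (\<alpha> # v') \<and> a = vertex d j' v'"
    then obtain j' v' where "j' \<in> {1..d}" "vertex d j (\<beta> # v) = vertex d j' (\<alpha> # v')" "a = vertex d j' v'" by blast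
    then show "\<alpha> = \<beta> \<and> a = vertex d j v" using vertex_inj[OF assms, of j' "\<beta> # v" "\<alpha> # v'"] by auto
  qed (use assms in blast)
  ultimately show ?thesis by (simp only: path_point_def prod.case if_False)
qed

lemma path_sym_inner:
  assumes "j \<in> {1..d}" "\<And>k. k \<le> length v \<Longrightarrow> vertex d j (drop k v) \<in> {1..N}" "l \<le> d"
  shows "path_sym N (path_point d L n y) (vertex d j v) l w =
    (if take (length v) w = v then path_sym N (path_point d L n y) j l (drop (length v) w) else 0)"
  using assms(2)
proof (induction v arbitrary: w)
  case Nil
  then show ?case by (simp add: vertex_def)
next
  case (Cons \<beta> v)
  show ?case
  proof (cases w)
    case Nil
    then show ?thesis using assms by (auto simp: vertex_def)
  next
    case w: (Cons \<alpha> w')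
    have v: "vertex d j v \<in> {1..N}" using Cons.prems[of 1] by simp
    have "path_sym N (path_point d L n y) (vertex d j (\<beta> # v)) l w =
        (\<Sum>a\<in>{1..N}. if a = vertex d j v then (if \<alpha> = \<beta> then path_sym N (path_point d L n y) a l w' else 0) else 0)"
      unfolding w path_sym.simps path_point_inner[OF assms(1)] by (intro sum.cong refl) auto
    also have "\<dots> = (if \<alpha> = \<beta> then path_sym N (path_point d L n y) (vertex d j v) l w' else 0)"
      using v by (subst sum.delta) auto
    also have "path_sym N (path_point d L n y) (vertex d j v) l w' =
        (if take (length v) w' = v then path_sym N (path_point d L n y) j l (drop (length v) w') else 0)"
      using Cons.prems[of "Suc _"] by (intro Cons.IH) simp
    finally show ?thesis using w by auto
  qed
qed

text \<open>A path that reads \<open>w\<close> consists of a first excursion, which is determined by its end point \<open>b \<le> d\<close> and a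
prefix of \<open>w\<close>, and a path that reads the rest. By induction the sum over the proper prefixes is the
sum subtracted in \<^const>\<open>path_weight\<close>.\<close>

lemma path_sym_path_point:
  assumes N: "\<And>j v. (j, v) \<in> verts d L n \<Longrightarrow> vertex d j v \<in> {1..N}"
    and "i \<in> {1..d}" "l \<in> {1..d}" "w \<noteq> []" "length w \<le> n" "set w \<subseteq> {1..L}"
  shows "path_sym N (path_point d L n y) i l w = y (i, l, w)"
  using assms(2,4-)
proof (induction w arbitrary: i rule: length_induct)
  case (1 w)
  let ?p = "path_sym N (path_point d L n y)"
  obtain \<alpha> w' where w: "w = \<alpha> # w'" using 1 by (cases w) auto
  have wL: "set w' \<subseteq> {1..L}" "length w' < n" using 1 w by auto
  let ?f = "\<lambda>(j, v). vertex d j v"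
  have sub: "?f ` verts d L n \<subseteq> {1..N}" using N by auto
  have "?p i l w = (\<Sum>a\<in>?f ` verts d L n. path_point d L n y (i, a, \<alpha>) * ?p a l w')"
    unfolding w path_sym.simps using sub 1 by (intro sum.mono_neutral_right) (auto simp: path_point_def)
  also have "\<dots> = (\<Sum>(j, v)\<in>verts d L n. path_point d L n y (i, vertex d j v, \<alpha>) * ?p (vertex d j v) l w')"
    by (subst sum.reindex[OF verts_inj]) (auto simp: case_prod_beta)
  also have "\<dots> = (\<Sum>(j, v)\<in>verts d L n. if take (length v) w' = v then path_weight d y i j (\<alpha> # v) * ?p j l (drop (length v) w') else 0)"
  proof (intro sum.cong refl, clarify)
    fix j v assume jv: "(j, v) \<in> verts d L n"
    have "vertex d j (drop k v) \<in> {1..N}" for k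
      using jv set_drop_subset[of k v] by (intro N) (auto simp: verts_def)
    then have "?p (vertex d j v) l w' = (if take (length v) w' = v then ?p j l (drop (length v) w') else 0)"
      using jv assms(3) by (intro path_sym_inner) (auto simp: verts_def)
    moreover have "path_point d L n y (i, vertex d j v, \<alpha>) = path_weight d y i j (\<alpha> # v)"
      using 1 jv by (intro path_point_start) auto
    ultimately show "path_point d L n y (i, vertex d j v, \<alpha>) * ?p (vertex d j v) l w' =
        (if take (length v) w' = v then path_weight d y i j (\<alpha> # v) * ?p j l (drop (length v) w') else 0)" by simp
  qed
  also have "\<dots> = (\<Sum>j\<in>{1..d}. \<Sum>v\<in>{v. set v \<subseteq> {1..L} \<and> length v < n}.
      if take (length v) w' = v then path_weight d y i j (\<alpha> # v) * ?p j l (drop (length v) w') else 0)"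
    unfolding verts_def by (rule sum.cartesian_product[symmetric])
  also have "\<dots> = (\<Sum>j\<in>{1..d}. \<Sum>k\<le>length w'. path_weight d y i j (\<alpha> # take k w') * ?p j l (drop k w'))"
  proof (intro sum.cong refl)
    fix j
    let ?V = "{v. set v \<subseteq> {1..L} \<and> length v < n}" and ?g = "\<lambda>k. take k w'"
    have fin: "finite ?V"
      by (rule finite_subset[OF _ finite_lists_length_le[of "{1..L}" n]]) auto
    have "(\<Sum>v\<in>?V. if take (length v) w' = v then path_weight d y i j (\<alpha> # v) * ?p j l (drop (length v) w') else 0) =
        (\<Sum>v\<in>?g ` {..length w'}. path_weight d y i j (\<alpha> # v) * ?p j l (drop (length v) w'))"
    proof (rule sum.mono_neutral_cong_right[OF fin])
      show "?g ` {..length w'} \<subseteq> ?V"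
        using wL set_take_subset[of _ w'] by fastforce
      show "\<forall>v\<in>?V - ?g ` {..length w'}. (if take (length v) w' = v then path_weight d y i j (\<alpha> # v) * ?p j l (drop (length v) w') else 0) = 0"
      proof
        fix v assume v: "v \<in> ?V - ?g ` {..length w'}"
        have "take (length v) w' \<noteq> v"
        proof
          assume a: "take (length v) w' = v"
          then have "length v \<le> length w'" by (metis length_take min.absorb_iff2 min.commute)
          then have "v \<in> ?g ` {..length w'}" using a by (intro image_eqI[of _ _ "length v"]) auto
          then show False using v by blast
        qed
        then show "(if take (length v) w' = v then path_weight d y i j (\<alpha> # v) * ?p j l (drop (length v) w') else 0) = 0" by simp
      qed
    qed auto
    also have "\<dots> = (\<Sum>k\<le>length w'. path_weight d y i j (\<alpha> # take k w') * ?p j l (drop k w'))"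
    proof (subst sum.reindex)
      show "inj_on ?g {..length w'}"
        by (rule inj_onI) (metis atMost_iff length_take min.absorb2)
    qed (auto intro!: sum.cong simp: min_absorb2)
    finally show "(\<Sum>v\<in>?V. if take (length v) w' = v then path_weight d y i j (\<alpha> # v) * ?p j l (drop (length v) w') else 0) =
        (\<Sum>k\<le>length w'. path_weight d y i j (\<alpha> # take k w') * ?p j l (drop k w'))" .
  qed
  also have "\<dots> = (\<Sum>k\<le>length w'. \<Sum>j\<in>{1..d}. path_weight d y i j (take (Suc k) w) * ?p j l (drop (Suc k) w))"
    unfolding w by (subst sum.swap) simp
  also have "\<dots> = (\<Sum>j\<in>{1..d}. path_weight d y i j w * ?p j l []) +
      (\<Sum>k<length w'. \<Sum>j\<in>{1..d}. path_weight d y i j (take (Suc k) w) * ?p j l (drop (Suc k) w))"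
    unfolding lessThan_Suc_atMost[symmetric] sum.lessThan_Suc by (simp add: w add.commute)
  also have "(\<Sum>j\<in>{1..d}. path_weight d y i j w * ?p j l []) = path_weight d y i l w"
    using assms(3) by (simp add: if_distrib[of "\<lambda>x. _ * x"] cong: if_cong)
  also have "(\<Sum>k<length w'. \<Sum>j\<in>{1..d}. path_weight d y i j (take (Suc k) w) * ?p j l (drop (Suc k) w)) =
      (\<Sum>k<length w'. \<Sum>j\<in>{1..d}. path_weight d y i j (take (Suc k) w) * y (j, l, drop (Suc k) w))"
  proof (intro sum.cong refl)
    fix k j assume k: "k \<in> {..<length w'}" and j: "j \<in> {1..d}"
    have "?p j l (drop (Suc k) w) = y (j, l, drop (Suc k) w)"
    proof (rule 1(1)[rule_format])
      show "set (drop (Suc k) w) \<subseteq> {1..L}" using 1(5) set_drop_subset[of "Suc k" w] by auto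
    qed (use k j 1 w in auto)
    then show "path_weight d y i j (take (Suc k) w) * ?p j l (drop (Suc k) w) =
        path_weight d y i j (take (Suc k) w) * y (j, l, drop (Suc k) w)" by simp
  qed
  also have "\<dots> = (\<Sum>k\<in>{1..<length w}. \<Sum>j\<in>{1..d}. path_weight d y i j (take k w) * y (j, l, drop k w))"
    unfolding w length_Cons One_nat_def sum.shift_bounds_Suc_ivl by (simp add: atLeast0LessThan)
  also have "path_weight d y i l w + \<dots> = y (i, l, w)"
    by (subst path_weight.simps) simp
  finally show ?case .
qed

section \<open>Polynomial dependence on the parameter\<close>

text \<open>The vanishing of the coefficients from \<open>n\<close> on allows padding when two such functions are added.\<close>

definition poly_fun :: "(complex \<Rightarrow> U) \<Rightarrow> bool"
  where "poly_fun f \<longleftrightarrow> (\<exists>n a. (\<forall>k\<ge>n. a k = 0) \<and> (\<forall>c. f c = (\<Sum>k<n. cst (c ^ k) * a k)))"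

lemma poly_fun_const: "poly_fun (\<lambda>_. u)"
  unfolding poly_fun_def
  by (rule exI[of _ 1], rule exI[of _ "\<lambda>k. if k = 0 then u else 0"]) (simp add: ua.cst_1)

lemma poly_fun_add:
  assumes "poly_fun f" "poly_fun g"
  shows "poly_fun (\<lambda>c. f c + g c)"
proof -
  obtain n a m b where f: "\<forall>k\<ge>n. a k = 0" "\<And>c. f c = (\<Sum>k<n. cst (c ^ k) * a k)"
    and g: "\<forall>k\<ge>m. b k = 0" "\<And>c. g c = (\<Sum>k<m. cst (c ^ k) * b k)"
    using assms unfolding poly_fun_def by blast
  have "f c = (\<Sum>k<max n m. cst (c ^ k) * a k)" for c
    unfolding f(2) by (rule sum.mono_neutral_left) (use f(1) in auto)
  moreover have "g c = (\<Sum>k<max n m. cst (c ^ k) * b k)" for c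
    unfolding g(2) by (rule sum.mono_neutral_left) (use g(1) in auto)
  ultimately show ?thesis unfolding poly_fun_def
    using f(1) g(1) by (intro exI[of _ "max n m"] exI[of _ "\<lambda>k. a k + b k"]) (simp add: distrib_left sum.distrib)
qed

lemma poly_fun_left:
  assumes "poly_fun f"
  shows "poly_fun (\<lambda>c. u * f c)"
proof -
  obtain n a where f: "\<forall>k\<ge>n. a k = 0" "\<And>c. f c = (\<Sum>k<n. cst (c ^ k) * a k)"
    using assms unfolding poly_fun_def by blast
  then show ?thesis unfolding poly_fun_def
    by (intro exI[of _ n] exI[of _ "\<lambda>k. u * a k"]) (simp add: sum_distrib_left cst_left[of u])
qed

lemma poly_fun_cst:
  assumes "poly_fun f"
  shows "poly_fun (\<lambda>c. cst c * f c)"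
proof -
  obtain n a where f: "\<forall>k\<ge>n. a k = 0" "\<And>c. f c = (\<Sum>k<n. cst (c ^ k) * a k)"
    using assms unfolding poly_fun_def by blast
  have "cst c * f c = (\<Sum>k<Suc n. cst (c ^ k) * (case k of 0 \<Rightarrow> 0 | Suc k \<Rightarrow> a k))" for c
    unfolding f(2) sum.lessThan_Suc_shift by (simp add: sum_distrib_left ua.cst_mult mult.assoc)
  then show ?thesis unfolding poly_fun_def
    using f(1) by (intro exI[of _ "Suc n"] exI[of _ "\<lambda>k. case k of 0 \<Rightarrow> 0 | Suc k \<Rightarrow> a k"])
      (auto split: nat.splits)
qed

lemma poly_fun_sum: "(\<And>x. x \<in> A \<Longrightarrow> poly_fun (f x)) \<Longrightarrow> poly_fun (\<lambda>c. \<Sum>x\<in>A. f x c)"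
  by (induction A rule: infinite_finite_induct) (auto simp: poly_fun_const poly_fun_add)

text \<open>The parameter enters the recursion only through the scalar factor of the correction.\<close>

lemma poly_fun_tU_mult: "poly_fun f \<Longrightarrow> poly_fun (\<lambda>c. tU N c i j w * f c)"
proof (induction w arbitrary: i)
  case Nil
  then show ?case by (cases "i = j") (simp_all add: poly_fun_const)
next
  case (Cons \<alpha> w)
  have e: "tU N c i j (\<alpha> # w) * f c = (\<Sum>a\<in>{1..N}. E (i, a, \<alpha>) * (tU N c a j w * f c)) +
      (if starts \<alpha> w then - 1 else 0) * (cst c * (tU N c i j w * f c))" for c
    by (auto simp: sum_distrib_right left_diff_distrib mult.assoc)
  show ?case unfolding e using Cons by (intro poly_fun_add poly_fun_sum poly_fun_left poly_fun_cst)
qed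

lemma poly_fun_ev: "poly_fun (\<lambda>c. ua.ev (\<lambda>(i, j, w). tU N c i j w) p)"
proof -
  have "poly_fun (\<lambda>c. prod_list (map (\<lambda>(i, j, w). tU N c i j w) xs))" for xs
    by (induction xs) (auto simp: poly_fun_const intro!: poly_fun_tU_mult)
  then show ?thesis unfolding ua.ev_def by (intro poly_fun_sum poly_fun_left)
qed

lemma poly_fun_zero:
  assumes "poly_fun f" "\<And>n::nat. app (f (- of_nat n)) 1 = 0"
  shows "app (f c) 1 = 0"
proof -
  obtain n a where f: "\<And>c. f c = (\<Sum>k<n. cst (c ^ k) * a k)"
    using assms(1) unfolding poly_fun_def by blast
  have lk: "lk (app (f c) 1) M = (\<Sum>k<n. lk (app (a k) 1) M * c ^ k)" for c M
    by (simp add: f app_simps lookup_sum lookup_single_mult) (simp add: mult.commute)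
  show ?thesis
  proof (rule poly_mapping_eqI)
    fix M
    let ?b = "\<lambda>k. if k < n then lk (app (a k) 1) M else 0"
    have s: "lk (app (f c) 1) M = (\<Sum>k\<le>n. ?b k * c ^ k)" for c
      unfolding lk by (simp add: atMost_Suc_eq_insert_0 lessThan_Suc_atMost[symmetric])
    have "?b k = 0" if "k \<le> n" for k
    proof (rule ccontr)
      assume "?b k \<noteq> 0"
      then have "finite {z. (\<Sum>k\<le>n. ?b k * z ^ k) = 0}"
        using that unfolding polyfun_finite_roots by blast
      moreover have "range (\<lambda>n::nat. - of_nat n :: complex) \<subseteq> {z. (\<Sum>k\<le>n. ?b k * z ^ k) = 0}"
      proof (rule image_subsetI)
        fix m :: nat
        have "(\<Sum>k\<le>n. ?b k * (- of_nat m) ^ k) = 0"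
          unfolding s[symmetric] assms(2) by simp
        then show "- of_nat m \<in> {z. (\<Sum>k\<le>n. ?b k * z ^ k) = 0}" by blast
      qed
      ultimately have "finite (range (\<lambda>n::nat. - of_nat n :: complex))"
        by (rule finite_subset[rotated])
      then show False using finite_imageD[of "\<lambda>n::nat. - of_nat n :: complex" UNIV] by (auto simp: inj_def)
    qed
    then show "lk (app (f c) 1) M = lk 0 M" unfolding s by simp
  qed
qed

section \<open>Commutation relations\<close>

type_synonym fam = "nat \<Rightarrow> nat \<Rightarrow> nat \<Rightarrow> nat \<Rightarrow> nat \<Rightarrow> U"

text \<open>Integer combinations of families, uniformly in the size and in the four matrix indices. Uniformity
is what allows an identity for the indices \<open>i, j, k, l\<close> to be used under a sum over one of them.\<close>

inductive span :: "fam set \<Rightarrow> fam \<Rightarrow> bool" for P where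
  span_base: "f \<in> P \<Longrightarrow> span P f"
| span_zero: "span P (\<lambda>N i j k l. 0)"
| span_diff: "span P f \<Longrightarrow> span P g \<Longrightarrow> span P (\<lambda>N i j k l. f N i j k l - g N i j k l)"
| span_cong: "span P f \<Longrightarrow>
    (\<And>N i j k l. i \<in> {1..N} \<Longrightarrow> j \<in> {1..N} \<Longrightarrow> k \<in> {1..N} \<Longrightarrow> l \<in> {1..N} \<Longrightarrow> f N i j k l = g N i j k l) \<Longrightarrow>
    span P g"

lemma span_add:
  assumes "span P f" "span P g"
  shows "span P (\<lambda>N i j k l. f N i j k l + g N i j k l)"
  using span_diff[OF assms(1) span_diff[OF span_zero assms(2)]] by simp

lemma span_sum:
  "(\<And>x. x \<in> A \<Longrightarrow> span P (f x)) \<Longrightarrow> span P (\<lambda>N i j k l. \<Sum>x\<in>A. f x N i j k l)"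
  by (induction A rule: infinite_finite_induct) (auto simp: span_zero span_add)

lemma span_trans: "span P f \<Longrightarrow> (\<And>p. p \<in> P \<Longrightarrow> span Q p) \<Longrightarrow> span Q f"
  by (induction rule: span.induct) (auto intro: span_zero span_diff span_cong)

lemma span_mono: "span P f \<Longrightarrow> P \<subseteq> Q \<Longrightarrow> span Q f"
  by (rule span_trans) (auto intro: span_base)

lemma span_map:
  assumes "span P f"
    and base: "\<And>p. p \<in> P \<Longrightarrow> span Q (T p)"
    and diff: "\<And>f g. T (\<lambda>N i j k l. f N i j k l - g N i j k l) = (\<lambda>N i j k l. T f N i j k l - T g N i j k l)"
    and cong: "\<And>f g N i j k l. (\<And>N i j k l. i \<in> {1..N} \<Longrightarrow> j \<in> {1..N} \<Longrightarrow> k \<in> {1..N} \<Longrightarrow> l \<in> {1..N} \<Longrightarrow> f N i j k l = g N i j k l) \<Longrightarrow>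
      i \<in> {1..N} \<Longrightarrow> j \<in> {1..N} \<Longrightarrow> k \<in> {1..N} \<Longrightarrow> l \<in> {1..N} \<Longrightarrow> T f N i j k l = T g N i j k l"
  shows "span Q (T f)"
  using assms(1)
proof (induction rule: span.induct)
  case (span_base f)
  then show ?case by (rule base)
next
  case span_zero
  have "T (\<lambda>N i j k l. 0) = (\<lambda>N i j k l. 0)"
    using diff[of "\<lambda>N i j k l. 0" "\<lambda>N i j k l. 0"] by simp
  then show ?case by (simp add: span.span_zero)
next
  case (span_diff f g)
  then show ?case by (simp add: diff span.span_diff)
next
  case (span_cong f g)
  show ?case by (rule span.span_cong[OF span_cong.IH]) (rule cong[OF span_cong.hyps(2)])
qed

abbreviation eU where "eU N \<equiv> tU N 0"

text \<open>Products of generators with row indices \<open>i, k\<close> and column indices \<open>j, l\<close>: in \<open>fA\<close> the indices are paired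
as \<open>il, kj\<close>, in \<open>fB\<close> as \<open>ij, kl\<close>, and \<open>fB'\<close> is \<open>fB\<close> with the factors exchanged.\<close>

definition fA :: "nat list \<Rightarrow> nat list \<Rightarrow> fam" where "fA v v' = (\<lambda>N i j k l. eU N i l v * eU N k j v')"
definition fB :: "nat list \<Rightarrow> nat list \<Rightarrow> fam" where "fB v v' = (\<lambda>N i j k l. eU N i j v * eU N k l v')"
definition fB' :: "nat list \<Rightarrow> nat list \<Rightarrow> fam" where "fB' v v' = (\<lambda>N i j k l. eU N k l v' * eU N i j v)"
definition fC :: "nat list \<Rightarrow> nat list \<Rightarrow> fam"
  where "fC v v' = (\<lambda>N i j k l. eU N i j v * eU N k l v' - eU N k l v' * eU N i j v)"

definition wpairs :: "nat \<Rightarrow> nat \<Rightarrow> (nat list \<times> nat list) set"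
  where "wpairs L n = {(v, v'). set v \<subseteq> {1..L} \<and> set v' \<subseteq> {1..L} \<and> 1 \<le> length v + length v' \<and> length v + length v' \<le> n}"

lemma wpairs_mono: "n \<le> m \<Longrightarrow> wpairs L n \<subseteq> wpairs L m"
  by (auto simp: wpairs_def)

definition sAB :: "nat \<Rightarrow> nat \<Rightarrow> fam set"
  where "sAB L n = (\<lambda>(v, v'). fA v v') ` wpairs L n \<union> (\<lambda>(v, v'). fB v v') ` wpairs L n"

definition sAB' :: "nat \<Rightarrow> nat \<Rightarrow> fam set"
  where "sAB' L n = (\<lambda>(v, v'). fA v v') ` wpairs L n \<union> (\<lambda>(v, v'). fB' v v') ` wpairs L n"

lemma sAB_mono: "n \<le> m \<Longrightarrow> sAB L n \<subseteq> sAB L m" and sAB'_mono: "n \<le> m \<Longrightarrow> sAB' L n \<subseteq> sAB' L m"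
  using wpairs_mono[of n m L] unfolding sAB_def sAB'_def by blast+

lemma span_fA: "(v, v') \<in> wpairs L n \<Longrightarrow> span (sAB L n) (fA v v')"
  and span_fB: "(v, v') \<in> wpairs L n \<Longrightarrow> span (sAB L n) (fB v v')"
  and span'_fA: "(v, v') \<in> wpairs L n \<Longrightarrow> span (sAB' L n) (fA v v')"
  and span'_fB': "(v, v') \<in> wpairs L n \<Longrightarrow> span (sAB' L n) (fB' v v')"
  by (rule span_base, force simp: sAB_def sAB'_def)+

definition comm_upto :: "nat \<Rightarrow> nat \<Rightarrow> bool"
  where "comm_upto L n \<longleftrightarrow> (\<forall>v v'. (v, v') \<in> wpairs L n \<longrightarrow> span (sAB L (length v + length v' - 1)) (fC v v'))"

text \<open>Exchanging the factors costs a commutator, which is a combination of shorter products. So modulo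
shorter products the two orders of the factors are interchangeable.\<close>

lemma span_fB'_of_comm:
  assumes "comm_upto L n" "(v, v') \<in> wpairs L m" "m \<le> n"
  shows "span (sAB L m) (fB' v v')"
proof -
  have "span (sAB L (length v + length v' - 1)) (fC v v')"
    using assms wpairs_mono[OF assms(3)] unfolding comm_upto_def by blast
  then have "span (sAB L m) (fC v v')"
    by (rule span_mono[OF _ sAB_mono]) (use assms(2) in \<open>auto simp: wpairs_def\<close>)
  from span_diff[OF span_fB[OF assms(2)] this] show ?thesis
    by (simp add: fB_def fC_def fB'_def)
qed

lemma span'_fB:
  assumes "comm_upto L n" "(v, v') \<in> wpairs L m" "m \<le> n"
  shows "span (sAB' L m) (fB v v')"
  using assms(2,3)
proof (induction m arbitrary: v v' rule: less_induct)
  case (less m)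
  have vv: "(v, v') \<in> wpairs L n" using less.prems wpairs_mono by blast
  have l: "1 \<le> length v + length v'" "length v + length v' \<le> m" using less.prems by (auto simp: wpairs_def)
  define m' where "m' = length v + length v' - 1"
  have m': "m' < m" using l by (simp add: m'_def)
  have "span (sAB L m') (fC v v')"
    using assms(1) vv unfolding comm_upto_def m'_def by blast
  then have "span (sAB' L m) (fC v v')"
  proof (rule span_trans)
    fix p assume "p \<in> sAB L m'"
    then have "span (sAB' L m') p"
      unfolding sAB_def using less.IH[OF m'] span'_fA m' less.prems by auto
    then show "span (sAB' L m) p" using sAB'_mono m' by (meson less_imp_le span_mono)
  qed
  from span_add[OF span'_fB'[OF less.prems(1)] this] show ?case
    by (simp add: fB_def fC_def fB'_def)
qed

lemma span'_fC:
  assumes "comm_upto L n" "(v, v') \<in> wpairs L n"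
  shows "span (sAB' L (length v + length v' - 1)) (fC v v')"
proof -
  let ?m = "length v + length v' - 1"
  have "?m \<le> n" using assms(2) by (auto simp: wpairs_def)
  have "span (sAB L ?m) (fC v v')" using assms unfolding comm_upto_def by blast
  then show ?thesis
    by (rule span_trans) (use span'_fA span'_fB[OF assms(1) _ \<open>?m \<le> n\<close>] in \<open>auto simp: sAB_def\<close>)
qed

lemma eU_Cons: "eU N i j (\<alpha> # w) = (\<Sum>a\<in>{1..N}. E (i, a, \<alpha>) * eU N a j w)"
  by (simp add: ua.cst_0 cong: if_cong)

text \<open>Split off the first letter, \<open>e\<^sub>i\<^sub>j(\<alpha>w\<^sub>1) = \<Sum>\<^sub>a E\<^sub>i\<^sub>a e\<^sub>a\<^sub>j(w\<^sub>1)\<close>, and use the Leibniz rule. One term is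
\<open>\<Sum>\<^sub>a E\<^sub>i\<^sub>a [e\<^sub>a\<^sub>j(w\<^sub>1), e\<^sub>k\<^sub>l(w')]\<close>, where \<open>E\<^sub>i\<^sub>a\<close> is absorbed by the first factor of each product. The other one
consists by \<open>E_tU_comm\<close> of terms \<open>\<Sum>\<^sub>a e\<^sub>k\<^sub>a(x) e\<^sub>i\<^sub>l(y) e\<^sub>a\<^sub>j(w\<^sub>1)\<close> with \<open>w' = xy\<close>. Exchanging the first two
factors gives \<open>e\<^sub>i\<^sub>l(y) e\<^sub>k\<^sub>j(xw\<^sub>1)\<close> and a shorter commutator. The latter is expanded in products whose
second factor carries the index \<open>a\<close>, which can then be contracted with \<open>e\<^sub>a\<^sub>j(w\<^sub>1)\<close>.\<close>

lemma comm_upto_Suc: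
  assumes S: "comm_upto L n"
  shows "comm_upto L (Suc n)"
  unfolding comm_upto_def
proof (intro allI impI)
  fix w w' assume ww: "(w, w') \<in> wpairs L (Suc n)"
  let ?m = "length w + length w' - 1"
  show "span (sAB L ?m) (fC w w')"
  proof (cases "w = [] \<or> w' = []")
    case True
    then have "fC w w' = (\<lambda>N i j k l. 0)" by (auto simp: fC_def intro!: ext)
    then show ?thesis by (simp add: span_zero)
  next
    case False
    then obtain \<alpha> w1 where w: "w = \<alpha> # w1" by (cases w) auto
    have m: "?m = length w1 + length w'" using w by simp
    have mn: "?m \<le> n" using ww w by (simp add: wpairs_def)
    have L: "set w1 \<subseteq> {1..L}" "set w' \<subseteq> {1..L}" "\<alpha> \<in> {1..L}" and lw': "length w' \<ge> 1"
      using ww w False by (auto simp: wpairs_def Suc_le_eq)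
    (* contraction from the left and from the right *)
    define T1 :: "fam \<Rightarrow> fam" where "T1 F = (\<lambda>N i j k l. \<Sum>a\<in>{1..N}. E (i, a, \<alpha>) * F N a j k l)" for F
    define T2 :: "fam \<Rightarrow> fam" where "T2 F = (\<lambda>N i j k l. \<Sum>a\<in>{1..N}. F N k a i l * eU N a j w1)" for F
    define H :: "nat list \<Rightarrow> nat list \<Rightarrow> fam"
      where "H x y = (\<lambda>N i j k l. \<Sum>a\<in>{1..N}. eU N k a x * eU N i l y * eU N a j w1)" for x y
    define G :: fam where "G = (\<lambda>N i j k l. \<Sum>a\<in>{1..N}. (E (i, a, \<alpha>) * eU N k l w' - eU N k l w' * E (i, a, \<alpha>)) * eU N a j w1)"
    have sT1: "span (sAB L ?m) (T1 (fC w1 w'))"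
    proof (rule span_map[of "sAB L (length w1 + length w' - 1)" _ _ T1])
      show "span (sAB L (length w1 + length w' - 1)) (fC w1 w')"
        using S L lw' mn m unfolding comm_upto_def by (auto simp: wpairs_def)
      show "span (sAB L ?m) (T1 p)" if "p \<in> sAB L (length w1 + length w' - 1)" for p
      proof -
        have "T1 (fA v v') = fA (\<alpha> # v) v'" "T1 (fB v v') = fB (\<alpha> # v) v'" for v v'
          by (simp_all only: T1_def fA_def fB_def eU_Cons sum_distrib_right mult.assoc)
        moreover have "(\<alpha> # v, v') \<in> wpairs L ?m" if "(v, v') \<in> wpairs L (length w1 + length w' - 1)" for v v'
          using that L m lw' by (auto simp: wpairs_def)
        ultimately show ?thesis using that span_fA span_fB by (auto simp: sAB_def)
      qed
    qed (simp_all add: T1_def right_diff_distrib sum_subtractf)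
    have sH: "span (sAB L ?m) (H x y)" if xy: "x @ y = w'" for x y
    proof -
      have lxy: "length x + length y = length w'" "set x \<subseteq> {1..L}" "set y \<subseteq> {1..L}" using xy L by auto
      have "span (sAB L ?m) (T2 (fC x y))"
      proof (rule span_map[of "sAB' L (length x + length y - 1)" _ _ T2])
        show "span (sAB' L (length x + length y - 1)) (fC x y)"
          by (rule span'_fC[OF S]) (use lxy lw' m mn in \<open>auto simp: wpairs_def\<close>)
        show "span (sAB L ?m) (T2 p)" if p: "p \<in> sAB' L (length x + length y - 1)" for p
        proof -
          have 1: "span (sAB L ?m) (T2 (fA v v'))" if v: "(v, v') \<in> wpairs L (length x + length y - 1)" for v v'
          proof (rule span_cong)
            show "span (sAB L ?m) (fB' (v' @ w1) v)"
              by (rule span_fB'_of_comm[OF S _ mn]) (use v L lxy m in \<open>auto simp: wpairs_def\<close>)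
            show "fB' (v' @ w1) v N i j k l = T2 (fA v v') N i j k l" if "i \<in> {1..N}" for N i j k l
              using tU_append[OF that, of v' j w1] by (simp add: fB'_def T2_def fA_def mult.assoc flip: sum_distrib_left)
          qed
          have 2: "span (sAB L ?m) (T2 (fB' v v'))" if v: "(v, v') \<in> wpairs L (length x + length y - 1)" for v v'
          proof (rule span_cong)
            show "span (sAB L ?m) (fA v' (v @ w1))"
              by (rule span_fA) (use v L lxy m in \<open>auto simp: wpairs_def\<close>)
            show "fA v' (v @ w1) N i j k l = T2 (fB' v v') N i j k l" if "k \<in> {1..N}" for N i j k l
              using tU_append[OF that, of v j w1] by (simp add: fB'_def T2_def fA_def mult.assoc flip: sum_distrib_left)
          qed
          show ?thesis using p 1 2 by (auto simp: sAB'_def)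
        qed
      qed (simp_all add: T2_def left_diff_distrib sum_subtractf)
      moreover have "span (sAB L ?m) (fA y (x @ w1))"
        by (rule span_fA) (use L lxy lw' m in \<open>auto simp: wpairs_def\<close>)
      ultimately have "span (sAB L ?m) (\<lambda>N i j k l. T2 (fC x y) N i j k l + fA y (x @ w1) N i j k l)"
        by (rule span_add)
      then show ?thesis
      proof (rule span_cong)
        fix N i j k l :: nat assume k: "k \<in> {1..N}"
        have "H x y N i j k l = T2 (fC x y) N i j k l + (\<Sum>a\<in>{1..N}. eU N i l y * (eU N k a x * eU N a j w1))"
          unfolding H_def T2_def fC_def by (simp add: left_diff_distrib sum_subtractf mult.assoc)
        then show "T2 (fC x y) N i j k l + fA y (x @ w1) N i j k l = H x y N i j k l"
          using tU_append[OF k, of x j w1] by (simp add: fA_def flip: sum_distrib_left)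
      qed
    qed
    have "span (sAB L ?m) (\<lambda>(N::nat) i j k l. \<Sum>q<length w'. if w' ! q = \<alpha>
        then H (take q w') (drop q w') N i j k l - H (take (Suc q) w') (drop (Suc q) w') N i j k l else 0)"
    proof (rule span_sum)
      fix q
      show "span (sAB L ?m) (\<lambda>(N::nat) i j k l. if w' ! q = \<alpha>
        then H (take q w') (drop q w') N i j k l - H (take (Suc q) w') (drop (Suc q) w') N i j k l else 0)"
        using span_diff[OF sH[of "take q w'" "drop q w'"] sH[of "take (Suc q) w'" "drop (Suc q) w'"]]
        by (cases "w' ! q = \<alpha>") (simp_all add: span_zero)
    qed
    then have sG: "span (sAB L ?m) G"
    proof (rule span_cong)
      fix N i j k l :: nat assume r: "i \<in> {1..N}" "k \<in> {1..N}"
      have "G N i j k l = (\<Sum>a\<in>{1..N}. \<Sum>q<length w'. (if w' ! q = \<alpha> then eU N k a (take q w') * eU N i l (drop q w') * eU N a j w1 -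
        eU N k a (take (Suc q) w') * eU N i l (drop (Suc q) w') * eU N a j w1 else 0))"
        unfolding G_def using r
        by (intro sum.cong refl)
          (auto simp: E_tU_comm sum_distrib_right left_diff_distrib if_distrib[of "\<lambda>x. x * _"] cong: if_cong)
      also have "\<dots> = (\<Sum>q<length w'. \<Sum>a\<in>{1..N}. (if w' ! q = \<alpha> then eU N k a (take q w') * eU N i l (drop q w') * eU N a j w1 -
        eU N k a (take (Suc q) w') * eU N i l (drop (Suc q) w') * eU N a j w1 else 0))"
        by (rule sum.swap)
      also have "\<dots> = (\<Sum>q<length w'. if w' ! q = \<alpha>
        then H (take q w') (drop q w') N i j k l - H (take (Suc q) w') (drop (Suc q) w') N i j k l else 0)"
        by (intro sum.cong refl) (auto simp: H_def sum_subtractf)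
      finally show "(\<Sum>q<length w'. if w' ! q = \<alpha>
        then H (take q w') (drop q w') N i j k l - H (take (Suc q) w') (drop (Suc q) w') N i j k l else 0) = G N i j k l" by simp
    qed
    have "fC w w' = (\<lambda>N i j k l. T1 (fC w1 w') N i j k l + G N i j k l)"
      unfolding w fC_def T1_def G_def eU_Cons
      by (intro ext) (simp add: sum_distrib_left sum_distrib_right mult.assoc right_diff_distrib left_diff_distrib sum_subtractf)
    then show ?thesis using span_add[OF sT1 sG] by simp
  qed
qed

lemma comm_upto_all: "comm_upto L n"
proof (induction n)
  case 0
  then show ?case by (auto simp: comm_upto_def wpairs_def)
qed (rule comm_upto_Suc)

subsection \<open>Normal ordering\<close>

definition tgen :: "nat \<Rightarrow> complex \<Rightarrow> triple \<Rightarrow> U"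
  where "tgen N c = (\<lambda>(i, j, w). tU N c i j w)"

text \<open>The allowed monomials depend on the two words only through the sum of their lengths, and they do not
change when \<open>j\<close> and \<open>l\<close> are exchanged.\<close>

definition allowed_upto :: "nat \<Rightarrow> triple rel \<Rightarrow> nat \<Rightarrow> nat \<Rightarrow> nat \<Rightarrow> nat \<Rightarrow> nat \<Rightarrow> triple list set"
  where "allowed_upto L ord i j k l n = {m. mon_degree m \<le> n \<and>
        ((\<exists>z\<in>words L. m = [(i, j, z)] \<or> m = [(k, l, z)] \<or> m = [(i, l, z)] \<or> m = [(k, j, z)]) \<or>
         (\<exists>z\<in>words L. \<exists>z'\<in>words L. m = normal_pair ord (i, j, z) (k, l, z') \<or>
                                  m = normal_pair ord (i, l, z) (k, j, z')))}"

lemma allowed_upto_allowed: "allowed_monomials L ord (i, j, w) (k, l, w') = allowed_upto L ord i j k l (length w + length w' - 1)"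
  by (simp add: allowed_monomials_def allowed_upto_def)

lemma allowed_upto_swap: "allowed_upto L ord i l k j n = allowed_upto L ord i j k l n"
  by (auto simp: allowed_upto_def)

lemma allowed_upto_mono: "n \<le> m \<Longrightarrow> allowed_upto L ord i j k l n \<subseteq> allowed_upto L ord i j k l m"
  by (auto simp: allowed_upto_def)

definition eval_rhs :: "nat \<Rightarrow> (triple list \<Rightarrow>\<^sub>0 int) \<Rightarrow> U"
  where "eval_rhs N r = (\<Sum>m\<in>ks r. of_int (lk r m) * prod_list (map (tgen N 0) m))"

lemma eval_rhs_superset:
  "finite A \<Longrightarrow> ks r \<subseteq> A \<Longrightarrow> eval_rhs N r = (\<Sum>m\<in>A. of_int (lk r m) * prod_list (map (tgen N 0) m))"
  unfolding eval_rhs_def by (rule sum.mono_neutral_left) (auto simp: in_keys_iff)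

lemma eval_rhs_diff: "eval_rhs N (r - r') = eval_rhs N r - eval_rhs N r'"
proof -
  have *: "finite (ks r \<union> ks r')" by simp
  show ?thesis
    by (simp add: eval_rhs_superset[OF *, of "r - r'"] eval_rhs_superset[OF *, of r] eval_rhs_superset[OF *, of r']
        Poly_Mapping.keys_diff lookup_minus left_diff_distrib sum_subtractf)
qed

text \<open>The same integer combination of normal monomials has to serve for all sizes \<open>N \<ge> D\<close>.\<close>

definition normalizable :: "nat \<Rightarrow> triple list set \<Rightarrow> (nat \<Rightarrow> U) \<Rightarrow> bool"
  where "normalizable D M h \<longleftrightarrow> (\<exists>r. ks r \<subseteq> M \<and> (\<forall>N\<ge>D. h N = eval_rhs N r))"

lemma normalizable_mono: "normalizable D M h \<Longrightarrow> M \<subseteq> M' \<Longrightarrow> normalizable D M' h"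
  by (auto simp: normalizable_def)
lemma normalizable_0: "normalizable D M (\<lambda>N. 0)"
  unfolding normalizable_def by (rule exI[of _ 0]) (simp add: eval_rhs_def)
lemma normalizable_diff: "normalizable D M f \<Longrightarrow> normalizable D M g \<Longrightarrow> normalizable D M (\<lambda>N. f N - g N)"
  unfolding normalizable_def
proof (elim exE)
  fix r r' assume "ks r \<subseteq> M \<and> (\<forall>N\<ge>D. f N = eval_rhs N r)" "ks r' \<subseteq> M \<and> (\<forall>N\<ge>D. g N = eval_rhs N r')"
  then show "\<exists>r. ks r \<subseteq> M \<and> (\<forall>N\<ge>D. f N - g N = eval_rhs N r)"
    using Poly_Mapping.keys_diff[of r r'] by (intro exI[of _ "r - r'"]) (auto simp: eval_rhs_diff)
qed
lemma normalizable_add: "normalizable D M f \<Longrightarrow> normalizable D M g \<Longrightarrow> normalizable D M (\<lambda>N. f N + g N)"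
  using normalizable_diff[of D M f "\<lambda>N. 0 - g N"] normalizable_diff[OF normalizable_0, of D M g] by simp
lemma normalizable_base: "m \<in> M \<Longrightarrow> normalizable D M (\<lambda>N. prod_list (map (tgen N 0) m))"
  unfolding normalizable_def by (rule exI[of _ "sng m 1"]) (simp add: eval_rhs_def)

lemma normalizable_span:
  assumes "span P f" "\<And>p. p \<in> P \<Longrightarrow> normalizable D M (\<lambda>N. p N i j k l)"
    "i \<in> {1..D}" "j \<in> {1..D}" "k \<in> {1..D}" "l \<in> {1..D}"
  shows "normalizable D M (\<lambda>N. f N i j k l)"
  using assms(1)
proof (induction rule: span.induct)
  case (span_cong f g)
  then show ?case using assms(3-) by (auto simp: normalizable_def)
qed (use assms(2) in \<open>auto simp: normalizable_0 normalizable_diff\<close>)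

text \<open>If the factors of a product are in the wrong order, exchange them; the commutator consists of shorter
products of the kinds \<open>fA\<close> and \<open>fB\<close>, and \<open>fA\<close> is \<open>fB\<close> with \<open>j\<close> and \<open>l\<close> exchanged.\<close>

lemma normalizable_fB:
  assumes "i \<in> {1..D}" "j \<in> {1..D}" "k \<in> {1..D}" "l \<in> {1..D}" "(v, v') \<in> wpairs L n"
  shows "normalizable D (allowed_upto L ord i j k l n) (\<lambda>N. fB v v' N i j k l)"
  using assms
proof (induction n arbitrary: i j k l v v' rule: less_induct)
  case (less n)
  have vL: "set v \<subseteq> {1..L}" "set v' \<subseteq> {1..L}" "length v + length v' \<le> n" "1 \<le> length v + length v'"
    using less.prems by (auto simp: wpairs_def)
  have w: "z \<in> words L" if "z \<noteq> []" "set z \<subseteq> {1..L}" for z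
    using that by (auto simp: words_def words0_def)
  consider "v = []" | "v' = []" | "v \<noteq> []" "v' \<noteq> []" by blast
  then show ?case
  proof cases
    case 1
    then have "v' \<in> words L" using w[of v'] vL by (cases "v' = []") auto
    then have "[(k, l, v')] \<in> allowed_upto L ord i j k l n" using vL by (auto simp: allowed_upto_def mon_degree_def)
    from normalizable_base[OF this] show ?thesis
      using 1 by (cases "i = j") (simp_all add: fB_def tgen_def normalizable_0)
  next
    case 2
    then have "v \<in> words L" using w[of v] vL by (cases "v = []") auto
    then have "[(i, j, v)] \<in> allowed_upto L ord i j k l n" using vL by (auto simp: allowed_upto_def mon_degree_def)
    from normalizable_base[OF this] show ?thesis
      using 2 by (cases "k = l") (simp_all add: fB_def tgen_def normalizable_0)
  next
    case 3
    then have m: "normal_pair ord (i, j, v) (k, l, v') \<in> allowed_upto L ord i j k l n"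
      using w vL by (auto simp: allowed_upto_def mon_degree_def normal_pair_def)
    show ?thesis
    proof (cases "((i, j, v), (k, l, v')) \<in> ord")
      case True
      then show ?thesis using normalizable_base[OF m, of D] by (simp add: normal_pair_def fB_def tgen_def)
    next
      case False
      define n' where "n' = length v + length v' - 1"
      have n': "n' < n" using vL by (simp add: n'_def)
      have "span (sAB L n') (fC v v')"
        using comm_upto_all[of L n] less.prems(5) unfolding comm_upto_def n'_def by blast
      then have "normalizable D (allowed_upto L ord i j k l n') (\<lambda>N. fC v v' N i j k l)"
      proof (rule normalizable_span)
        fix p assume "p \<in> sAB L n'"
        then consider x y where "(x, y) \<in> wpairs L n'" "p = fA x y" | x y where "(x, y) \<in> wpairs L n'" "p = fB x y"
          by (auto simp: sAB_def)
        then show "normalizable D (allowed_upto L ord i j k l n') (\<lambda>N. p N i j k l)"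
        proof cases
          case 1
          have "normalizable D (allowed_upto L ord i l k j n') (\<lambda>N. fB x y N i l k j)"
            using less.IH[OF n'] less.prems 1 by blast
          then show ?thesis by (simp add: allowed_upto_swap 1 fA_def fB_def)
        next
          case 2
          then show ?thesis using less.IH[OF n'] less.prems by blast
        qed
      qed (use less.prems in auto)
      then have "normalizable D (allowed_upto L ord i j k l n) (\<lambda>N. fC v v' N i j k l)"
        by (rule normalizable_mono[OF _ allowed_upto_mono]) (use n' in simp)
      from normalizable_add[OF this normalizable_base[OF m, of D]] False show ?thesis
        by (simp add: normal_pair_def fB_def tgen_def fC_def)
    qed
  qed
qed

lemma commutator_normal_form:
  assumes "x \<in> gens d L" "y \<in> gens d L"
  obtains r where "ks r \<subseteq> allowed_monomials L ord x y"
    "\<And>N. N \<ge> d \<Longrightarrow> tgen N 0 x * tgen N 0 y - tgen N 0 y * tgen N 0 x = eval_rhs N r"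
proof -
  obtain i j w k l w' where xy: "x = (i, j, w)" "y = (k, l, w')" by (cases x, cases y)
  have r: "i \<in> {1..d}" "j \<in> {1..d}" "k \<in> {1..d}" "l \<in> {1..d}" and ww: "w \<in> words L" "w' \<in> words L"
    using assms xy by (auto simp: gens_def)
  define n where "n = length w + length w' - 1"
  have "(w, w') \<in> wpairs L (Suc n)" using ww by (auto simp: wpairs_def words_def words0_def n_def Suc_le_eq)
  then have "span (sAB L n) (fC w w')"
    using comm_upto_all[of L "Suc n"] unfolding comm_upto_def n_def by blast
  then have "normalizable d (allowed_upto L ord i j k l n) (\<lambda>N. fC w w' N i j k l)"
  proof (rule normalizable_span)
    fix p assume "p \<in> sAB L n"
    then consider x y where "(x, y) \<in> wpairs L n" "p = fA x y" | x y where "(x, y) \<in> wpairs L n" "p = fB x y"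
      by (auto simp: sAB_def)
    then show "normalizable d (allowed_upto L ord i j k l n) (\<lambda>N. p N i j k l)"
    proof cases
      case 1
      have "normalizable d (allowed_upto L ord i l k j n) (\<lambda>N. fB x y N i l k j)"
        using normalizable_fB[OF r(1,4,3,2)] 1 by blast
      then show ?thesis by (simp add: allowed_upto_swap 1 fA_def fB_def)
    next
      case 2
      then show ?thesis using normalizable_fB[OF r] by blast
    qed
  qed (use r in auto)
  then obtain r where "ks r \<subseteq> allowed_upto L ord i j k l n" "\<And>N. N \<ge> d \<Longrightarrow> fC w w' N i j k l = eval_rhs N r"
    unfolding normalizable_def by blast
  then show ?thesis using that[of r] by (simp add: xy allowed_upto_allowed n_def fC_def tgen_def)
qed

section \<open>The enveloping algebra as a quotient and its model\<close>

lemma free_alg_simps: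
  "carrier (free_alg V) = fcar V" "monoid.mult (free_alg V) = (*)" "one (free_alg V) = 1"
  "ring.zero (free_alg V) = 0" "ring.add (free_alg V) = (+)" "smult (free_alg V) = fscale"
  by (simp_all add: carrier_free_alg) (simp_all add: free_alg_def)

lemma ring_free_alg: "ring (free_alg V)"
proof (rule ringI)
  show "abelian_group (free_alg V)"
  proof (rule abelian_groupI)
    show "\<exists>y\<in>carrier (free_alg V). y \<oplus>\<^bsub>free_alg V\<^esub> x = \<zero>\<^bsub>free_alg V\<^esub>" if "x \<in> carrier (free_alg V)" for x
      using that by (intro bexI[of _ "- x"]) (simp_all add: free_alg_simps fcar_uminus)
  qed (auto simp: free_alg_simps fcar_add fcar_0 algebra_simps)
  show "Group.monoid (free_alg V)"
    by (rule monoidI) (auto simp: free_alg_simps fcar_mult fcar_1 mult.assoc)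
qed (auto simp: free_alg_simps algebra_simps)

lemma a_inv_free_alg: "x \<in> fcar V \<Longrightarrow> \<ominus>\<^bsub>free_alg V\<^esub> x = - x"
  using abelian_group.minus_equality[OF ring.is_abelian_group[OF ring_free_alg], of V "- x" x]
  by (simp add: free_alg_simps fcar_uminus)

lemma ideal_free_algI:
  assumes "K \<subseteq> fcar V" "0 \<in> K" "\<And>a b. a \<in> K \<Longrightarrow> b \<in> K \<Longrightarrow> a + b \<in> K" "\<And>a. a \<in> K \<Longrightarrow> - a \<in> K"
    "\<And>a p. a \<in> K \<Longrightarrow> p \<in> fcar V \<Longrightarrow> p * a \<in> K" "\<And>a p. a \<in> K \<Longrightarrow> p \<in> fcar V \<Longrightarrow> a * p \<in> K"
  shows "ideal K (free_alg V)"
proof (rule idealI[OF ring_free_alg])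
  show "subgroup K (add_monoid (free_alg V))"
  proof
    show "inv\<^bsub>add_monoid (free_alg V)\<^esub> x \<in> K" if "x \<in> K" for x
      using that assms a_inv_free_alg[of x V] by (auto simp: a_inv_def)
  qed (use assms in \<open>auto simp: free_alg_simps\<close>)
qed (use assms in \<open>auto simp: free_alg_simps\<close>)

lemma ideal_free_algD:
  assumes "ideal K (free_alg V)"
  shows "K \<subseteq> fcar V" "0 \<in> K" "a \<in> K \<Longrightarrow> b \<in> K \<Longrightarrow> a + b \<in> K" "a \<in> K \<Longrightarrow> - a \<in> K"
    "a \<in> K \<Longrightarrow> p \<in> fcar V \<Longrightarrow> p * a \<in> K" "a \<in> K \<Longrightarrow> p \<in> fcar V \<Longrightarrow> a * p \<in> K"
proof -
  interpret ideal K "free_alg V" by fact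
  show 1: "K \<subseteq> fcar V" using a_subset by (simp add: free_alg_simps)
  show "0 \<in> K" using additive_subgroup.zero_closed[OF additive_subgroup_axioms] by (simp add: free_alg_simps)
  show "a \<in> K \<Longrightarrow> b \<in> K \<Longrightarrow> a + b \<in> K"
    using additive_subgroup.a_closed[OF additive_subgroup_axioms] by (simp add: free_alg_simps)
  show "- a \<in> K" if a: "a \<in> K"
  proof -
    have "\<ominus>\<^bsub>free_alg V\<^esub> a \<in> K" using a by (rule additive_subgroup.a_inv_closed[OF additive_subgroup_axioms])
    moreover have "\<ominus>\<^bsub>free_alg V\<^esub> a = - a" using a 1 by (intro a_inv_free_alg) auto
    ultimately show ?thesis by simp
  qed
  show "a \<in> K \<Longrightarrow> p \<in> fcar V \<Longrightarrow> p * a \<in> K" using I_l_closed[of a p] by (simp add: free_alg_simps)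
  show "a \<in> K \<Longrightarrow> p \<in> fcar V \<Longrightarrow> a * p \<in> K" using I_r_closed[of a p] by (simp add: free_alg_simps)
qed

lemma genideal_free_alg:
  assumes "S \<subseteq> fcar V"
  shows "ideal (Idl\<^bsub>free_alg V\<^esub> S) (free_alg V)" "S \<subseteq> Idl\<^bsub>free_alg V\<^esub> S"
    "ideal K (free_alg V) \<Longrightarrow> S \<subseteq> K \<Longrightarrow> Idl\<^bsub>free_alg V\<^esub> S \<subseteq> K"
  using ring.genideal_ideal[OF ring_free_alg, of S V] ring.genideal_self[OF ring_free_alg, of S V]
    ring.genideal_minimal[OF ring_free_alg, of K V S] assms by (auto simp: free_alg_simps)

abbreviation glc where "glc L N \<equiv> carrier (gl L N)"
abbreviation eid where "eid L N \<equiv> env_ideal (gl L N)"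
abbreviation ep where "ep L N \<equiv> env_proj (gl L N)"

lemma gl_simps:
  "glc L N = {x. \<forall>\<alpha> i j. x \<alpha> i j \<noteq> 0 \<longrightarrow> \<alpha> \<in> {1..L} \<and> i \<in> {1..N} \<and> j \<in> {1..N}}"
  "lie_add (gl L N) = (\<lambda>x y \<alpha> i j. x \<alpha> i j + y \<alpha> i j)"
  "lie_scale (gl L N) = (\<lambda>c x \<alpha> i j. c * x \<alpha> i j)"
  "lie_bracket (gl L N) = (\<lambda>x y \<alpha> i j. (\<Sum>k=1..N. x \<alpha> i k * y \<alpha> k j) - (\<Sum>k=1..N. y \<alpha> i k * x \<alpha> k j))"
  by (simp_all add: gl_def)

lemma glc_add: "x \<in> glc L N \<Longrightarrow> y \<in> glc L N \<Longrightarrow> lie_add (gl L N) x y \<in> glc L N"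
  unfolding gl_simps mem_Collect_eq by (metis add.right_neutral)
lemma glc_scale: "x \<in> glc L N \<Longrightarrow> lie_scale (gl L N) c x \<in> glc L N"
  unfolding gl_simps mem_Collect_eq by (metis mult_zero_right)
lemma glc_bracket:
  assumes "x \<in> glc L N" "y \<in> glc L N"
  shows "lie_bracket (gl L N) x y \<in> glc L N"
  unfolding gl_simps mem_Collect_eq
proof (intro allI impI)
  fix \<alpha> i j
  assume nz: "(\<Sum>k = 1..N. x \<alpha> i k * y \<alpha> k j) - (\<Sum>k = 1..N. y \<alpha> i k * x \<alpha> k j) \<noteq> 0"
  then have "(\<Sum>k = 1..N. x \<alpha> i k * y \<alpha> k j) \<noteq> 0 \<or> (\<Sum>k = 1..N. y \<alpha> i k * x \<alpha> k j) \<noteq> 0" by auto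
  then obtain k where "x \<alpha> i k * y \<alpha> k j \<noteq> 0 \<or> y \<alpha> i k * x \<alpha> k j \<noteq> 0"
    by (meson sum.not_neutral_contains_not_neutral)
  then show "\<alpha> \<in> {1..L} \<and> i \<in> {1..N} \<and> j \<in> {1..N}"
    using assms unfolding gl_simps mem_Collect_eq by (metis mult_eq_0_iff)
qed

lemma munit_glc: "i \<in> {1..N} \<Longrightarrow> j \<in> {1..N} \<Longrightarrow> \<alpha> \<in> {1..L} \<Longrightarrow> munit i j \<alpha> \<in> glc L N"
  by (auto simp: gl_simps munit_def split: if_splits)

definition env_rels :: "nat \<Rightarrow> nat \<Rightarrow> gl_elem falg set"
  where "env_rels L N =
    {gen (lie_add (gl L N) x y) - gen x - gen y | x y. x \<in> glc L N \<and> y \<in> glc L N} \<union>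
     {gen (lie_scale (gl L N) c x) - fscale c (gen x) | c x. x \<in> glc L N} \<union>
     {gen x * gen y - gen y * gen x - gen (lie_bracket (gl L N) x y) | x y. x \<in> glc L N \<and> y \<in> glc L N}"

lemma fcar_gen: "gen x \<in> fcar V \<longleftrightarrow> x \<in> V"
  by (simp add: fcar_fmono)

lemma env_rels_fcar: "env_rels L N \<subseteq> fcar (glc L N)"
  unfolding env_rels_def
  by (auto intro!: fcar_diff fcar_mult fcar_fscale simp: fcar_gen glc_add glc_scale glc_bracket)

lemma eid_env_rels: "eid L N = Idl\<^bsub>free_alg (glc L N)\<^esub> (env_rels L N)"
  by (simp add: env_ideal_def env_rels_def)

lemma ideal_eid: "ideal (eid L N) (free_alg (glc L N))"
  unfolding eid_env_rels by (rule genideal_free_alg(1)[OF env_rels_fcar])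

lemmas eidD = ideal_free_algD[OF ideal_eid]

lemma eid_diff: "a \<in> eid L N \<Longrightarrow> b \<in> eid L N \<Longrightarrow> a - b \<in> eid L N"
  using eidD(3)[OF _ eidD(4), of a L N b] by simp
lemma eid_sum: "(\<And>x. x \<in> A \<Longrightarrow> f x \<in> eid L N) \<Longrightarrow> sum f A \<in> eid L N"
  by (induction A rule: infinite_finite_induct) (auto simp: eidD(2,3))
lemma eid_fscale: "a \<in> eid L N \<Longrightarrow> fscale c a \<in> eid L N"
  using eidD(5)[of a L N "fscale c 1"] fcar_fscale[OF fcar_1, of c "glc L N"] by (simp add: fscale_mult_left)

lemma eid_rel: "x \<in> env_rels L N \<Longrightarrow> x \<in> eid L N"
  using genideal_free_alg(2)[OF env_rels_fcar] unfolding eid_env_rels by blast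

lemma eid_add:
  assumes "x \<in> glc L N" "y \<in> glc L N"
  shows "gen (lie_add (gl L N) x y) - gen x - gen y \<in> eid L N"
    "gen x * gen y - gen y * gen x - gen (lie_bracket (gl L N) x y) \<in> eid L N"
proof -
  have "gen (lie_add (gl L N) x y) - gen x - gen y \<in> env_rels L N"
    "gen x * gen y - gen y * gen x - gen (lie_bracket (gl L N) x y) \<in> env_rels L N"
    unfolding env_rels_def using assms by blast+
  then show "gen (lie_add (gl L N) x y) - gen x - gen y \<in> eid L N"
    "gen x * gen y - gen y * gen x - gen (lie_bracket (gl L N) x y) \<in> eid L N"
    by (auto intro: eid_rel)
qed

lemma eid_scale:
  assumes "x \<in> glc L N"
  shows "gen (lie_scale (gl L N) c x) - fscale c (gen x) \<in> eid L N"
proof -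
  have "gen (lie_scale (gl L N) c x) - fscale c (gen x) \<in> env_rels L N"
    unfolding env_rels_def using assms by blast
  then show ?thesis by (rule eid_rel)
qed

lemma ep_eq: "ep L N p = {x. x - p \<in> eid L N}"
  unfolding env_proj_def a_r_coset_def r_coset_def
  by (auto simp: free_alg_simps intro: exI[of _ "_ - p"])

lemma ep_iff: "ep L N p = ep L N q \<longleftrightarrow> p - q \<in> eid L N"
proof
  assume "ep L N p = ep L N q"
  moreover have "p \<in> ep L N p" by (simp add: ep_eq eidD(2))
  ultimately show "p - q \<in> eid L N" by (simp add: ep_eq)
next
  assume pq: "p - q \<in> eid L N"
  have "x - p \<in> eid L N \<longleftrightarrow> x - q \<in> eid L N" for x
    using eidD(3)[OF pq, of "x - p"] eid_diff[OF _ pq, of "x - q"] by (auto simp: algebra_simps)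
  then show "ep L N p = ep L N q" by (simp add: ep_eq)
qed

lemma UgL_carrier: "carrier (UgL L N) = ep L N ` fcar (glc L N)"
  unfolding env_def quot_alg_def ring.defs module.defs FactRing_def A_RCOSETS_def' env_proj_def
  by (auto simp: free_alg_simps)

lemma UgL_mult: "p \<in> fcar (glc L N) \<Longrightarrow> q \<in> fcar (glc L N) \<Longrightarrow>
    ep L N p \<otimes>\<^bsub>UgL L N\<^esub> ep L N q = ep L N (p * q)"
  using ideal.rcoset_mult_add[OF ideal_eid, of p L N q]
  by (simp add: env_def quot_alg_def ring.defs module.defs FactRing_def env_proj_def free_alg_simps)

lemma UgL_add: "p \<in> fcar (glc L N) \<Longrightarrow> q \<in> fcar (glc L N) \<Longrightarrow>
    ep L N p \<oplus>\<^bsub>UgL L N\<^esub> ep L N q = ep L N (p + q)"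
  using ideal.a_rcos_sum[OF ideal_eid, of p L N q]
  by (simp add: env_def quot_alg_def ring.defs module.defs FactRing_def env_proj_def free_alg_simps)

lemma UgL_one: "\<one>\<^bsub>UgL L N\<^esub> = ep L N 1"
  by (simp add: env_def quot_alg_def ring.defs module.defs FactRing_def env_proj_def free_alg_simps)

lemma UgL_zero: "\<zero>\<^bsub>UgL L N\<^esub> = ep L N 0"
  by (simp add: env_def quot_alg_def ring.defs module.defs FactRing_def ep_eq)

lemma UgL_smult: "p \<in> fcar (glc L N) \<Longrightarrow> c \<odot>\<^bsub>UgL L N\<^esub> ep L N p = ep L N (fscale c p)"
proof -
  have "ep L N (fscale c x) = ep L N (fscale c p)" if "x \<in> ep L N p" for x
    using that eid_fscale[of "x - p" L N c] by (simp add: ep_iff) (simp add: ep_eq fscale_diff_right)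
  moreover have "p \<in> ep L N p" by (simp add: ep_eq eidD(2))
  ultimately have "(\<Union>x\<in>ep L N p. ep L N (fscale c x)) = ep L N (fscale c p)" by blast
  then show ?thesis
    by (simp add: env_def quot_alg_def ring.defs module.defs free_alg_simps) (simp add: env_proj_def)
qed

lemma ring_UgL: "ring (UgL L N)"
proof (rule ringI)
  show "abelian_group (UgL L N)"
  proof (rule abelian_groupI)
    show "\<exists>y\<in>carrier (UgL L N). y \<oplus>\<^bsub>UgL L N\<^esub> x = \<zero>\<^bsub>UgL L N\<^esub>" if x: "x \<in> carrier (UgL L N)" for x
    proof -
      obtain p where p: "p \<in> fcar (glc L N)" "x = ep L N p" using x by (auto simp: UgL_carrier)
      then show ?thesis
        by (intro bexI[of _ "ep L N (- p)"]) (auto simp: UgL_add UgL_carrier fcar_uminus UgL_zero)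
    qed
  qed (auto simp: UgL_carrier UgL_add UgL_zero fcar_add fcar_0 algebra_simps)
  show "Group.monoid (UgL L N)"
    by (rule monoidI) (auto simp: UgL_carrier UgL_mult UgL_one fcar_mult fcar_1 mult.assoc)
qed (auto simp: UgL_carrier UgL_mult UgL_add fcar_mult fcar_add algebra_simps)

subsection \<open>The homomorphism to the model\<close>

definition lie_model :: "nat \<Rightarrow> nat \<Rightarrow> gl_elem \<Rightarrow> U"
  where "lie_model L N x = (\<Sum>\<alpha>\<in>{1..L}. \<Sum>i\<in>{1..N}. \<Sum>j\<in>{1..N}. cst (x \<alpha> i j) * E (i, j, \<alpha>))"

lemma lie_model_add: "lie_model L N (\<lambda>\<alpha> i j. x \<alpha> i j + y \<alpha> i j) = lie_model L N x + lie_model L N y"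
  by (simp add: lie_model_def ua.cst_add distrib_right sum.distrib)
lemma lie_model_scale: "lie_model L N (\<lambda>\<alpha> i j. c * x \<alpha> i j) = cst c * lie_model L N x"
  by (simp add: lie_model_def ua.cst_mult mult.assoc sum_distrib_left)

lemma cst_cst: "cst a * u * (cst b * v) = cst (a * b) * (u * v)"
  unfolding ua.cst_mult by (metis cst_left mult.assoc)

lemma lie_model_bracket:
  "lie_model L N x * lie_model L N y - lie_model L N y * lie_model L N x = lie_model L N (lie_bracket (gl L N) x y)"
proof -
  let ?I = "{1..N}"
  have "lie_model L N x * lie_model L N y = (\<Sum>\<alpha>\<in>{1..L}. \<Sum>i\<in>?I. \<Sum>j\<in>?I. \<Sum>\<beta>\<in>{1..L}. \<Sum>k\<in>?I. \<Sum>l\<in>?I.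
      cst (x \<alpha> i j * y \<beta> k l) * (E (i, j, \<alpha>) * E (k, l, \<beta>)))"
    unfolding lie_model_def sum_distrib_right by (simp add: sum_distrib_left cst_cst)
  moreover have "lie_model L N y * lie_model L N x = (\<Sum>\<alpha>\<in>{1..L}. \<Sum>i\<in>?I. \<Sum>j\<in>?I. lie_model L N y * (cst (x \<alpha> i j) * E (i, j, \<alpha>)))"
    unfolding lie_model_def[of L N x] by (simp add: sum_distrib_left)
  then have "lie_model L N y * lie_model L N x = (\<Sum>\<alpha>\<in>{1..L}. \<Sum>i\<in>?I. \<Sum>j\<in>?I. \<Sum>\<beta>\<in>{1..L}. \<Sum>k\<in>?I. \<Sum>l\<in>?I.
      cst (x \<alpha> i j * y \<beta> k l) * (E (k, l, \<beta>) * E (i, j, \<alpha>)))"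
    by (simp add: lie_model_def sum_distrib_right cst_cst mult.commute[of "x _ _ _"])
  ultimately have "lie_model L N x * lie_model L N y - lie_model L N y * lie_model L N x =
      (\<Sum>\<alpha>\<in>{1..L}. \<Sum>i\<in>?I. \<Sum>j\<in>?I. \<Sum>\<beta>\<in>{1..L}. \<Sum>k\<in>?I. \<Sum>l\<in>?I.
      cst (x \<alpha> i j * y \<beta> k l) * ((if \<alpha> = \<beta> \<and> j = k then E (i, l, \<alpha>) else 0) - (if \<alpha> = \<beta> \<and> l = i then E (k, j, \<alpha>) else 0)))"
    unfolding E_comm[symmetric] by (simp only: sum_subtractf[symmetric] right_diff_distrib[symmetric])
  also have "\<dots> = (\<Sum>\<alpha>\<in>{1..L}. \<Sum>i\<in>?I. \<Sum>j\<in>?I. \<Sum>\<beta>\<in>{1..L}. if \<alpha> = \<beta> then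
      (\<Sum>k\<in>?I. if j = k then (\<Sum>l\<in>?I. cst (x \<alpha> i j * y \<beta> k l) * E (i, l, \<alpha>)) else 0) -
      (\<Sum>k\<in>?I. \<Sum>l\<in>?I. if l = i then cst (x \<alpha> i j * y \<beta> k l) * E (k, j, \<alpha>) else 0) else 0)"
  proof -
    have d: "cst z * ((if P then a else 0) - (if Q then b else 0)) = (if P then cst z * a else 0) - (if Q then cst z * b else 0)" for z P Q a b
      by (simp add: right_diff_distrib)
    have "(\<Sum>k\<in>?I. \<Sum>l\<in>?I. cst (x \<alpha> i j * y \<beta> k l) * ((if \<alpha> = \<beta> \<and> j = k then E (i, l, \<alpha>) else 0) - (if \<alpha> = \<beta> \<and> l = i then E (k, j, \<alpha>) else 0))) =
      (if \<alpha> = \<beta> then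
      (\<Sum>k\<in>?I. if j = k then (\<Sum>l\<in>?I. cst (x \<alpha> i j * y \<beta> k l) * E (i, l, \<alpha>)) else 0) -
      (\<Sum>k\<in>?I. \<Sum>l\<in>?I. if l = i then cst (x \<alpha> i j * y \<beta> k l) * E (k, j, \<alpha>) else 0) else 0)" for \<alpha> \<beta> i j
    proof (cases "\<alpha> = \<beta>")
      case True
      have "(\<Sum>k\<in>?I. \<Sum>l\<in>?I. if j = k then cst (x \<alpha> i j * y \<beta> k l) * E (i, l, \<alpha>) else 0) =
          (\<Sum>k\<in>?I. if j = k then (\<Sum>l\<in>?I. cst (x \<alpha> i j * y \<beta> k l) * E (i, l, \<alpha>)) else 0)"
        by (intro sum.cong[OF refl]) auto
      then show ?thesis using True by (simp only: d sum_subtractf simp_thms if_True)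
    qed simp
    then show ?thesis by (intro sum.cong refl) blast
  qed
  also have "\<dots> = (\<Sum>\<alpha>\<in>{1..L}. \<Sum>i\<in>?I. \<Sum>j\<in>?I. (\<Sum>l\<in>?I. cst (x \<alpha> i j * y \<alpha> j l) * E (i, l, \<alpha>)) -
      (\<Sum>k\<in>?I. cst (x \<alpha> i j * y \<alpha> k i) * E (k, j, \<alpha>)))"
    by (intro sum.cong refl) simp
  also have "\<dots> = lie_model L N (lie_bracket (gl L N) x y)"
    unfolding lie_model_def gl_simps
  proof (rule sum.cong[OF refl])
    fix \<alpha>
    have 1: "(\<Sum>i\<in>?I. \<Sum>j\<in>?I. \<Sum>l\<in>?I. cst (x \<alpha> i j * y \<alpha> j l) * E (i, l, \<alpha>)) =
        (\<Sum>i\<in>?I. \<Sum>l\<in>?I. \<Sum>j\<in>?I. cst (x \<alpha> i j * y \<alpha> j l) * E (i, l, \<alpha>))"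
      by (intro sum.cong refl sum.swap)
    have "(\<Sum>i\<in>?I. \<Sum>j\<in>?I. \<Sum>k\<in>?I. cst (x \<alpha> i j * y \<alpha> k i) * E (k, j, \<alpha>)) =
        (\<Sum>i\<in>?I. \<Sum>k\<in>?I. \<Sum>j\<in>?I. cst (x \<alpha> i j * y \<alpha> k i) * E (k, j, \<alpha>))"
      by (intro sum.cong refl sum.swap)
    also have "\<dots> = (\<Sum>k\<in>?I. \<Sum>i\<in>?I. \<Sum>j\<in>?I. cst (x \<alpha> i j * y \<alpha> k i) * E (k, j, \<alpha>))"
      by (rule sum.swap)
    also have "\<dots> = (\<Sum>k\<in>?I. \<Sum>j\<in>?I. \<Sum>i\<in>?I. cst (x \<alpha> i j * y \<alpha> k i) * E (k, j, \<alpha>))"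
      by (intro sum.cong refl sum.swap)
    finally show "(\<Sum>i\<in>?I. \<Sum>j\<in>?I. (\<Sum>l\<in>?I. cst (x \<alpha> i j * y \<alpha> j l) * E (i, l, \<alpha>)) -
      (\<Sum>k\<in>?I. cst (x \<alpha> i j * y \<alpha> k i) * E (k, j, \<alpha>))) =
      (\<Sum>i\<in>?I. \<Sum>j\<in>?I. cst ((\<Sum>k\<in>?I. x \<alpha> i k * y \<alpha> k j) - (\<Sum>k\<in>?I. y \<alpha> i k * x \<alpha> k j)) * E (i, j, \<alpha>))"
      using 1 by (simp add: sum_subtractf ua.cst_diff ua.cst_sum left_diff_distrib sum_distrib_right mult.commute[of "y _ _ _"])
  qed
  finally show ?thesis .
qed

abbreviation ev_lie where "ev_lie L N \<equiv> ua.ev (lie_model L N)"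

lemma ev_lie_eid: "p \<in> eid L N \<Longrightarrow> ev_lie L N p = 0"
proof -
  let ?K = "{p \<in> fcar (glc L N). ev_lie L N p = 0}"
  have "ideal ?K (free_alg (glc L N))"
    by (rule ideal_free_algI)
      (auto simp: fcar_0 fcar_add fcar_uminus fcar_mult ua.ev_0 ua.ev_add ua.ev_uminus ua.ev_mult)
  moreover have "env_rels L N \<subseteq> ?K"
  proof
    fix p assume p: "p \<in> env_rels L N"
    have "ev_lie L N p = 0"
      using p lie_model_add[of L N] lie_model_scale[of L N] lie_model_bracket[of L N] unfolding env_rels_def
      by (auto simp: ua.ev_diff ua.ev_mult ua.ev_gen ua.ev_fscale) (simp_all add: gl_simps)
    then show "p \<in> ?K" using p env_rels_fcar by blast
  qed
  ultimately have "eid L N \<subseteq> ?K"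
    unfolding eid_env_rels by (rule genideal_free_alg(3)[OF env_rels_fcar])
  then show "p \<in> eid L N \<Longrightarrow> ev_lie L N p = 0" by blast
qed

lemma lie_model_munit:
  assumes "i \<in> {1..N}" "j \<in> {1..N}" "\<alpha> \<in> {1..L}"
  shows "lie_model L N (munit i j \<alpha>) = E (i, j, \<alpha>)"
proof -
  have "lie_model L N (munit i j \<alpha>) = (\<Sum>t\<in>{1..L} \<times> {1..N} \<times> {1..N}. if t = (\<alpha>, i, j) then E (i, j, \<alpha>) else 0)"
    unfolding lie_model_def sum.cartesian_product by (intro sum.cong refl) (auto simp: munit_def ua.cst_0 ua.cst_1 split: if_splits)
  also have "\<dots> = E (i, j, \<alpha>)" using assms by (subst sum.delta) auto
  finally show ?thesis .
qed

text \<open>The value on a coset, through any of its representatives.\<close>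

definition model :: "nat \<Rightarrow> nat \<Rightarrow> gl_elem falg set \<Rightarrow> U"
  where "model L N Z = ev_lie L N (SOME p. p \<in> Z)"

lemma model_ep: "model L N (ep L N p) = ev_lie L N p"
proof -
  have "p \<in> ep L N p" by (simp add: ep_eq eidD(2))
  then have "(SOME q. q \<in> ep L N p) \<in> ep L N p" by (rule someI)
  then have "ev_lie L N ((SOME q. q \<in> ep L N p) - p) = 0" by (simp add: ep_eq ev_lie_eid)
  then show ?thesis by (simp add: model_def ua.ev_diff)
qed

lemma model_mult: "x \<in> carrier (UgL L N) \<Longrightarrow> y \<in> carrier (UgL L N) \<Longrightarrow> model L N (x \<otimes>\<^bsub>UgL L N\<^esub> y) = model L N x * model L N y"
  by (auto simp: UgL_carrier UgL_mult model_ep ua.ev_mult)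
lemma model_add: "x \<in> carrier (UgL L N) \<Longrightarrow> y \<in> carrier (UgL L N) \<Longrightarrow> model L N (x \<oplus>\<^bsub>UgL L N\<^esub> y) = model L N x + model L N y"
  by (auto simp: UgL_carrier UgL_add model_ep ua.ev_add)
lemma model_one: "model L N \<one>\<^bsub>UgL L N\<^esub> = 1" by (simp add: UgL_one model_ep ua.ev_1)
lemma model_zero: "model L N \<zero>\<^bsub>UgL L N\<^esub> = 0" by (simp add: UgL_zero model_ep ua.ev_0)
lemma model_smult: "x \<in> carrier (UgL L N) \<Longrightarrow> model L N (c \<odot>\<^bsub>UgL L N\<^esub> x) = cst c * model L N x"
  by (auto simp: UgL_carrier UgL_smult model_ep ua.ev_fscale)
lemma UgL_smult_closed: "x \<in> carrier (UgL L N) \<Longrightarrow> c \<odot>\<^bsub>UgL L N\<^esub> x \<in> carrier (UgL L N)"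
  by (auto simp: UgL_carrier UgL_smult intro: fcar_fscale)

lemma model_uminus: "x \<in> carrier (UgL L N) \<Longrightarrow> model L N (\<ominus>\<^bsub>UgL L N\<^esub> x) = - model L N x"
proof -
  interpret ring "UgL L N" by (rule ring_UgL)
  assume x: "x \<in> carrier (UgL L N)"
  then have "model L N (\<ominus>\<^bsub>UgL L N\<^esub> x \<oplus>\<^bsub>UgL L N\<^esub> x) = 0" by (simp add: l_neg model_zero)
  then show ?thesis using x by (simp add: model_add eq_neg_iff_add_eq_0)
qed

lemma model_minus: "x \<in> carrier (UgL L N) \<Longrightarrow> y \<in> carrier (UgL L N) \<Longrightarrow> model L N (x \<ominus>\<^bsub>UgL L N\<^esub> y) = model L N x - model L N y"
  using abelian_group.a_inv_closed[OF ring.is_abelian_group[OF ring_UgL], of y L N]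
  by (simp add: a_minus_def model_add model_uminus)

lemma UE_carrier: "i \<in> {1..N} \<Longrightarrow> j \<in> {1..N} \<Longrightarrow> \<alpha> \<in> {1..L} \<Longrightarrow> UE L N i j \<alpha> \<in> carrier (UgL L N)"
  and model_UE: "i \<in> {1..N} \<Longrightarrow> j \<in> {1..N} \<Longrightarrow> \<alpha> \<in> {1..L} \<Longrightarrow> model L N (UE L N i j \<alpha>) = E (i, j, \<alpha>)"
  by (auto simp: UE_def env_in_def UgL_carrier fcar_gen munit_glc model_ep ua.ev_gen lie_model_munit)

text \<open>The filtration by word length is mapped onto \<^const>\<open>Fmod\<close>.\<close>

lemma ev_lie_Fmod: "p \<in> fpol (glc L N) (\<lambda>_. 1) n \<Longrightarrow> Fmod L N n (ev_lie L N p)"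
  unfolding ua.ev_def
proof (intro Fmod_sum Fmod_scale)
  fix m assume m: "p \<in> fpol (glc L N) (\<lambda>_. 1) n" "m \<in> ks p"
  have "Fmod L N 1 (lie_model L N x)" for x
    unfolding lie_model_def using Fmod_E[of _ N _ _ L 0] by (intro Fmod_sum Fmod_scale) auto
  then have "Fmod L N (sum_list (map (\<lambda>_. 1) (letters m))) (prod_list (map (lie_model L N) (letters m)))"
    by (rule Fmod_prod_list)
  then show "Fmod L N n (prod_list (map (lie_model L N) (letters m)))"
    by (rule Fmod_mono) (use m in \<open>auto simp: fpol_def\<close>)
qed

lemma Fmod_ev_lie: "Fmod L N n u \<Longrightarrow> \<exists>p\<in>fpol (glc L N) (\<lambda>_. 1) n. ev_lie L N p = u"
proof (induction rule: Fmod.induct)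
  case (Fmod_cst n c)
  then show ?case
    by (intro bexI[of _ "fscale c 1"]) (auto simp: ua.ev_fscale ua.ev_1 fpol_1 fpol_fscale)
next
  case (Fmod_E i j \<alpha> n)
  then show ?case
    by (intro bexI[of _ "gen (munit i j \<alpha>)"]) (auto simp: ua.ev_gen lie_model_munit fpol_fmono munit_glc)
next
  case (Fmod_add n u v)
  then obtain p q where "p \<in> fpol (glc L N) (\<lambda>_. 1) n" "ev_lie L N p = u" "q \<in> fpol (glc L N) (\<lambda>_. 1) n" "ev_lie L N q = v"
    by blast
  then show ?case by (intro bexI[of _ "p + q"]) (simp_all add: ua.ev_add fpol_add)
next
  case (Fmod_mult n u m v k)
  then obtain p q where "p \<in> fpol (glc L N) (\<lambda>_. 1) n" "ev_lie L N p = u" "q \<in> fpol (glc L N) (\<lambda>_. 1) m" "ev_lie L N q = v"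
    by blast
  then show ?case using fpol_mono[OF fpol_mult Fmod_mult.hyps(3), of p _ _ q]
    by (intro bexI[of _ "p * q"]) (simp_all add: ua.ev_mult)
qed

lemma model_Umod: "x \<in> carrier (UgL L N) \<Longrightarrow> model L N x \<in> Umod L N"
  unfolding UgL_carrier Umod_def using fcar_fpol ev_lie_Fmod by (fastforce simp: model_ep)

lemma Umod_model: "u \<in> Umod L N \<Longrightarrow> \<exists>x\<in>carrier (UgL L N). model L N x = u"
  unfolding Umod_def UgL_carrier using Fmod_ev_lie fpol_fcar by (fastforce simp: model_ep)

subsection \<open>Poincare-Birkhoff-Witt\<close>

definition matrix_units :: "nat \<Rightarrow> nat \<Rightarrow> gl_elem set"
  where "matrix_units L N = {munit i j \<alpha> | i j \<alpha>. i \<in> {1..N} \<and> j \<in> {1..N} \<and> \<alpha> \<in> {1..L}}"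

lemma munit_eq: "munit i j \<alpha> = munit k l \<beta> \<longleftrightarrow> i = k \<and> j = l \<and> \<alpha> = \<beta>"
  unfolding munit_def fun_eq_iff by (metis zero_neq_one)

lemma matrix_units_glc: "matrix_units L N \<subseteq> glc L N"
  by (auto simp: matrix_units_def intro!: munit_glc)

lemma fcar_mono: "p \<in> fcar V \<Longrightarrow> V \<subseteq> W \<Longrightarrow> p \<in> fcar W"
  by (auto simp: fcar_def)

lemma gen_basis:
  assumes "x \<in> glc L N"
  shows "\<exists>q\<in>fpol (matrix_units L N) (\<lambda>_. 1) 1. gen x - q \<in> eid L N"
proof -
  let ?T = "{1..N} \<times> {1..N} \<times> {1..L}"
  let ?x = "\<lambda>A \<alpha> i j. if (i, j, \<alpha>) \<in> A then x \<alpha> i j else 0"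
  have xA: "?x A \<in> glc L N" for A using assms by (auto simp: gl_simps split: if_splits)
  have "A \<subseteq> ?T \<Longrightarrow> \<exists>q\<in>fpol (matrix_units L N) (\<lambda>_. 1) 1. gen (?x A) - q \<in> eid L N" if "finite A" for A
    using that
  proof (induction A rule: finite_induct)
    case empty
    have "gen (lie_scale (gl L N) 0 (?x {})) - fscale 0 (gen (?x {})) \<in> eid L N"
      by (rule eid_scale[OF xA])
    then show ?case by (intro bexI[of _ 0]) (auto simp: fscale_0 fpol_0 gl_simps)
  next
    case (insert a A)
    obtain i j \<alpha> where a: "a = (i, j, \<alpha>)" by (cases a)
    then have r: "i \<in> {1..N}" "j \<in> {1..N}" "\<alpha> \<in> {1..L}" using insert.prems by auto
    let ?u = "munit i j \<alpha>" and ?c = "x \<alpha> i j"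
    have u: "?u \<in> glc L N" by (rule munit_glc[OF r])
    obtain q where q: "q \<in> fpol (matrix_units L N) (\<lambda>_. 1) 1" "gen (?x A) - q \<in> eid L N" using insert by auto
    have e: "?x (insert a A) = lie_add (gl L N) (?x A) (lie_scale (gl L N) ?c ?u)"
    proof (intro ext)
      fix \<beta> k l
      show "?x (insert a A) \<beta> k l = lie_add (gl L N) (?x A) (lie_scale (gl L N) ?c ?u) \<beta> k l"
        using insert.hyps(2) unfolding gl_simps(2,3) munit_def a by (cases "(k, l, \<beta>) = (i, j, \<alpha>)") auto
    qed
    have 1: "gen (?x (insert a A)) - gen (?x A) - gen (lie_scale (gl L N) ?c ?u) \<in> eid L N"
      unfolding e by (rule eid_add(1)[OF xA glc_scale[OF u]])
    have 2: "gen (lie_scale (gl L N) ?c ?u) - fscale ?c (gen ?u) \<in> eid L N"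
      by (rule eid_scale[OF u])
    have "gen (?x (insert a A)) - (q + fscale ?c (gen ?u)) \<in> eid L N"
      using eidD(3)[OF eidD(3)[OF 1 2] q(2)] by (simp add: algebra_simps)
    moreover have "q + fscale ?c (gen ?u) \<in> fpol (matrix_units L N) (\<lambda>_. 1) 1"
      using q r by (intro fpol_add fpol_fscale) (auto simp: fpol_fmono matrix_units_def)
    ultimately show ?case by blast
  qed
  from this[of ?T] have "\<exists>q\<in>fpol (matrix_units L N) (\<lambda>_. 1) 1. gen (?x ?T) - q \<in> eid L N" by simp
  moreover have "?x ?T = x" using assms by (intro ext) (auto simp: gl_simps)
  ultimately show ?thesis by simp
qed

lemma fcar_basis:
  assumes "p \<in> fcar (glc L N)"
  shows "\<exists>q\<in>fcar (matrix_units L N). p - q \<in> eid L N"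
proof -
  have sub: "q \<in> fcar (matrix_units L N) \<Longrightarrow> q \<in> fcar (glc L N)" for q
    using matrix_units_glc fcar_mono by blast
  have w: "\<exists>q\<in>fcar (matrix_units L N). fmono xs - q \<in> eid L N" if "set xs \<subseteq> glc L N" for xs
    using that
  proof (induction xs)
    case Nil
    then show ?case by (intro bexI[of _ "fmono []"]) (auto simp: fcar_fmono eidD(2))
  next
    case (Cons x xs)
    obtain q where q: "q \<in> fcar (matrix_units L N)" "fmono xs - q \<in> eid L N" using Cons by auto
    obtain r where r: "r \<in> fcar (matrix_units L N)" "gen x - r \<in> eid L N"
      using gen_basis[of x L N] Cons.prems fpol_fcar by fastforce
    have "gen x * (fmono xs - q) + (gen x - r) * q \<in> eid L N"
      using q r sub Cons.prems by (intro eidD(3,5,6)) (auto simp: fcar_gen)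
    then have "fmono (x # xs) - r * q \<in> eid L N"
      using fmono_mult[of "[x]" xs] by (simp add: algebra_simps)
    then show ?case using fcar_mult q r by blast
  qed
  have "\<forall>m\<in>ks p. \<exists>q. q \<in> fcar (matrix_units L N) \<and> fmono (letters m) - q \<in> eid L N"
    using w assms unfolding fcar_def by blast
  from bchoice[OF this] obtain Q where
    Q: "\<And>m. m \<in> ks p \<Longrightarrow> Q m \<in> fcar (matrix_units L N)" "\<And>m. m \<in> ks p \<Longrightarrow> fmono (letters m) - Q m \<in> eid L N"
    by blast
  have "p - (\<Sum>m\<in>ks p. fscale (lk p m) (Q m)) = (\<Sum>m\<in>ks p. fscale (lk p m) (fmono (letters m) - Q m))"
    unfolding fscale_diff_right sum_subtractf by (simp only: falg_expand[symmetric])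
  then have "p - (\<Sum>m\<in>ks p. fscale (lk p m) (Q m)) \<in> eid L N"
    using Q by (auto intro!: eid_sum eid_fscale)
  moreover have "(\<Sum>m\<in>ks p. fscale (lk p m) (Q m)) \<in> fcar (matrix_units L N)"
    using Q by (intro fcar_sum fcar_fscale)
  ultimately show ?thesis by blast
qed

text \<open>An enumeration of the indices supplies a linear order on the matrix units.\<close>

definition basis_order :: "gl_elem rel"
  where "basis_order = {(munit i j \<alpha>, munit k l \<beta>) | i j \<alpha> k l \<beta>. to_nat (i, j, \<alpha>) \<le> to_nat (k, l, \<beta>)}"

lemma reorder_env: "reorder (matrix_units L N) (\<lambda>_. 1) basis_order (eid L N)"
proof
  fix x y z assume "(x, y) \<in> basis_order" "(y, z) \<in> basis_order"
  then show "(x, z) \<in> basis_order" by (fastforce simp: basis_order_def munit_eq)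
next
  fix x y assume "(x, y) \<in> basis_order" "(y, x) \<in> basis_order"
  then show "x = y" by (fastforce simp: basis_order_def munit_eq)
next
  fix x y assume xy: "x \<in> matrix_units L N" "y \<in> matrix_units L N"
  then show "(x, y) \<in> basis_order \<or> (y, x) \<in> basis_order"
    by (auto simp: matrix_units_def basis_order_def) (metis nat_le_linear)
  have x: "x \<in> glc L N" "y \<in> glc L N" using xy matrix_units_glc by auto
  obtain q where q: "q \<in> fpol (matrix_units L N) (\<lambda>_. 1) 1" "gen (lie_bracket (gl L N) x y) - q \<in> eid L N"
    using gen_basis[OF glc_bracket[OF x]] by blast
  have "gen x * gen y - gen y * gen x - gen (lie_bracket (gl L N) x y) \<in> eid L N"
    by (rule eid_add(2)[OF x])
  from eidD(3)[OF this q(2)] have "gen x * gen y - gen y * gen x - q \<in> eid L N" by simp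
  then show "\<exists>q\<in>fpol (matrix_units L N) (\<lambda>_. 1) (1 + 1 - 1). gen x * gen y - gen y * gen x - q \<in> eid L N"
    using q(1) by auto
next
  show "0 \<in> eid L N" by (rule eidD(2))
  fix a b p assume "a \<in> eid L N"
  then show "b \<in> eid L N \<Longrightarrow> a + b \<in> eid L N" by (rule eidD(3))
  assume "p \<in> fcar (matrix_units L N)"
  then have "p \<in> fcar (glc L N)" using matrix_units_glc fcar_mono by blast
  with \<open>a \<in> eid L N\<close> show "p * a \<in> eid L N" "a * p \<in> eid L N" by (auto intro: eidD)
qed simp

text \<open>Reduce \<open>p\<close> to a combination of ordered words in matrix units. The symbol of a matrix unit is a free
coordinate \<open>\<xi>\<close>, so a nonzero combination has a nonzero leading part when it is applied to \<open>1\<close>.\<close>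

lemma ev_lie_app_eq_0:
  assumes "p \<in> fcar (glc L N)" "app (ev_lie L N p) 1 = 0"
  shows "p \<in> eid L N"
proof -
  interpret reorder "matrix_units L N" "\<lambda>_. 1" basis_order "eid L N" by (rule reorder_env)
  obtain p' where p': "p' \<in> fcar (matrix_units L N)" "p - p' \<in> eid L N"
    using fcar_basis[OF assms(1)] by blast
  obtain n where "p' \<in> fpol (matrix_units L N) (\<lambda>_. 1) n" using fcar_fpol[OF p'(1)] by blast
  from reorder[OF this] obtain q where q: "q \<in> fpol (matrix_units L N) (\<lambda>_. 1) n"
    "\<And>m. m \<in> ks q \<Longrightarrow> sorted_wrt (\<lambda>x y. (x, y) \<in> basis_order) (letters m)" "p' - q \<in> eid L N" by blast
  have pq: "p - q \<in> eid L N" using eidD(3)[OF p'(2) q(3)] by simp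
  have ev0: "app (ev_lie L N q) 1 = 0"
    using ev_lie_eid[OF pq] assms(2) by (simp add: ua.ev_diff)
  have lets: "set (letters m) \<subseteq> matrix_units L N" if "m \<in> ks q" for m using that q(1) by (auto simp: fpol_def)
  have "q = 0"
  proof (rule ccontr)
    assume "q \<noteq> 0"
    let ?l = "\<lambda>m::gl_elem fmon. sum_list (map (\<lambda>_. 1) (letters m)) :: nat"
    define n0 where "n0 = Max (?l ` ks q)"
    have ne: "ks q \<noteq> {}" using \<open>q \<noteq> 0\<close> by (metis ex_in_conv in_keys_iff lookup_zero poly_mapping_eqI)
    have "n0 \<in> ?l ` ks q" unfolding n0_def using ne by (intro Max_in) auto
    then obtain m0 where m0: "m0 \<in> ks q" "?l m0 = n0" by auto
    show False
    proof (rule symbols_independent[of q "\<lambda>_. 1" n0 m0])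
      show "inj_on (\<lambda>m. mset (letters m)) (ks q)"
      proof (rule inj_onI)
        fix a b assume ab: "a \<in> ks q" "b \<in> ks q" "mset (letters a) = mset (letters b)"
        have "letters a = letters b"
        proof (rule sorted_wrt_unique[of "matrix_units L N" "\<lambda>x y. (x, y) \<in> basis_order"])
          show "x = y" if "(x, y) \<in> basis_order" "(y, x) \<in> basis_order" for x y using that by (rule asym)
        qed (fact lets[OF ab(1)] q(2)[OF ab(1)] q(2)[OF ab(2)] ab(3))+
        then show "a = b" by (metis fmon.exhaust_sel)
      qed
      show "?l m \<le> n0" if "m \<in> ks q" for m
        unfolding n0_def using that by (intro Max_ge) auto
      fix y :: "gl_elem \<Rightarrow> complex"
      have "has_symbol 1 (\<lambda>(i, j, \<alpha>). y (munit i j \<alpha>)) (lie_model L N x) (y x)" if x: "x \<in> matrix_units L N" for x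
      proof -
        obtain i j \<alpha> where "x = munit i j \<alpha>" "i \<in> {1..N}" "j \<in> {1..N}" "\<alpha> \<in> {1..L}"
          using x by (auto simp: matrix_units_def)
        then show ?thesis using has_symbol_E[of "\<lambda>(i, j, \<alpha>). y (munit i j \<alpha>)" "(i, j, \<alpha>)"] lie_model_munit by simp
      qed
      then show "\<exists>h \<xi>. (\<forall>m\<in>ks q. \<forall>x\<in>set (letters m). has_symbol 1 \<xi> (h x) (y x)) \<and> top_coeff n0 \<xi> (app (ua.ev h q) 1) = 0"
        using lets ev0 by (intro exI[of _ "lie_model L N"] exI[of _ "\<lambda>(i, j, \<alpha>). y (munit i j \<alpha>)"]) (auto simp: top_0 dest: subsetD)
    qed (use m0 in auto)
  qed
  then show ?thesis using pq by simp
qed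

lemma model_app_inj:
  assumes "x \<in> carrier (UgL L N)" "y \<in> carrier (UgL L N)" "app (model L N x) 1 = app (model L N y) 1"
  shows "x = y"
proof -
  obtain p q where pq: "p \<in> fcar (glc L N)" "x = ep L N p" "q \<in> fcar (glc L N)" "y = ep L N q"
    using assms by (auto simp: UgL_carrier)
  have "app (ev_lie L N (p - q)) 1 = 0" using assms(3) pq by (simp add: model_ep ua.ev_diff app_simps)
  then have "p - q \<in> eid L N" using pq by (intro ev_lie_app_eq_0 fcar_diff)
  then show ?thesis using pq by (simp add: ep_iff)
qed

lemma model_inj: "x \<in> carrier (UgL L N) \<Longrightarrow> y \<in> carrier (UgL L N) \<Longrightarrow> model L N x = model L N y \<Longrightarrow> x = y"
  using model_app_inj by metis

lemma Umod_app_0: "u \<in> Umod L N \<Longrightarrow> app u 1 = 0 \<Longrightarrow> u = 0"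
proof -
  assume u: "u \<in> Umod L N" "app u 1 = 0"
  then obtain x where x: "x \<in> carrier (UgL L N)" "model L N x = u" using Umod_model by blast
  have "\<zero>\<^bsub>UgL L N\<^esub> \<in> carrier (UgL L N)" by (simp add: ring.ring_simprules(2) ring_UgL)
  then have "x = \<zero>\<^bsub>UgL L N\<^esub>" using model_app_inj x u(2) by (simp add: model_zero app_simps)
  then show ?thesis using x(2) model_zero by simp
qed

definition unmodel :: "nat \<Rightarrow> nat \<Rightarrow> U \<Rightarrow> gl_elem falg set"
  where "unmodel L N u = (THE x. x \<in> carrier (UgL L N) \<and> model L N x = u)"

lemma unmodel: "u \<in> Umod L N \<Longrightarrow> unmodel L N u \<in> carrier (UgL L N)" "u \<in> Umod L N \<Longrightarrow> model L N (unmodel L N u) = u"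
proof -
  assume "u \<in> Umod L N"
  then have "\<exists>!x. x \<in> carrier (UgL L N) \<and> model L N x = u" using Umod_model model_inj by metis
  from theI'[OF this] show "unmodel L N u \<in> carrier (UgL L N)" "model L N (unmodel L N u) = u"
    by (simp_all add: unmodel_def)
qed

lemma env_filt_iff: "x \<in> carrier (UgL L N) \<Longrightarrow> x \<in> env_filt (gl L N) n \<longleftrightarrow> Fmod L N n (model L N x)"
proof -
  assume x: "x \<in> carrier (UgL L N)"
  have e: "env_filt (gl L N) n = ep L N ` fpol (glc L N) (\<lambda>_. 1) n"
    by (simp add: env_filt_def free_alg_simps fcar_def fpol_def sum_list_triv conj_commute ball_conj_distrib)
  show ?thesis
  proof
    assume "x \<in> env_filt (gl L N) n"
    then show "Fmod L N n (model L N x)" unfolding e using ev_lie_Fmod by (auto simp: model_ep)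
  next
    assume "Fmod L N n (model L N x)"
    then obtain p where p: "p \<in> fpol (glc L N) (\<lambda>_. 1) n" "ev_lie L N p = model L N x" using Fmod_ev_lie by blast
    then have "ep L N p = x"
      using model_inj[of "ep L N p" L N x] x fpol_fcar[OF p(1)] by (simp add: UgL_carrier model_ep)
    then show "x \<in> env_filt (gl L N) n" using p(1) e by blast
  qed
qed

subsection \<open>The left ideal and the projection\<close>

lemma Iplus_Imod_subset: "Iplus L N \<subseteq> {z \<in> carrier (UgL L N). model L N z \<in> Imod L N}"
proof -
  interpret R: ring "UgL L N" by (rule ring_UgL)
  let ?K = "{z \<in> carrier (UgL L N). model L N z \<in> Imod L N}"
  have "additive_subgroup ?K (UgL L N)"
  proof
    show "inv\<^bsub>add_monoid (UgL L N)\<^esub> x \<in> ?K" if "x \<in> ?K" for x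
      using that model_uminus[of x L N] Imod_uminus R.a_inv_closed[of x] unfolding a_inv_def by simp
  qed (auto simp: model_add model_zero Imod_add Imod_0)
  moreover have "\<forall>a\<in>carrier (UgL L N). \<forall>x\<in>?K. a \<otimes>\<^bsub>UgL L N\<^esub> x \<in> ?K"
    by (auto simp: model_mult intro!: Imod_left model_Umod)
  moreover have "{UE L N i N \<alpha> |i \<alpha>. i \<in> {1..N} \<and> \<alpha> \<in> {1..L}} \<subseteq> ?K"
    using UE_carrier[of _ N N] model_UE[of _ N N] Imod_E by fastforce
  ultimately show ?thesis unfolding Iplus_def left_idl_def by blast
qed

lemma Imod_Iplus: "u \<in> Imod L N \<Longrightarrow> \<exists>z\<in>Iplus L N. model L N z = u"
proof (induction rule: Imod.induct)
  case Imod_0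
  have "\<zero>\<^bsub>UgL L N\<^esub> \<in> Iplus L N"
    unfolding Iplus_def left_idl_def by (rule InterI, clarify) (erule additive_subgroup.zero_closed)
  then show ?case using model_zero by blast
next
  case (Imod_E i \<alpha>)
  then have "UE L N i N \<alpha> \<in> Iplus L N" unfolding Iplus_def left_idl_def by blast
  moreover have "model L N (UE L N i N \<alpha>) = E (i, N, \<alpha>)" using Imod_E by (intro model_UE) auto
  ultimately show ?case by blast
next
  case (Imod_add u v)
  then obtain x y where xy: "x \<in> Iplus L N" "y \<in> Iplus L N" "model L N x = u" "model L N y = v" by blast
  have "x \<oplus>\<^bsub>UgL L N\<^esub> y \<in> Iplus L N"
    unfolding Iplus_def left_idl_def
  proof (rule InterI, clarify)
    fix I assume I: "additive_subgroup I (UgL L N)" "\<forall>a\<in>carrier (UgL L N). \<forall>x\<in>I. a \<otimes>\<^bsub>UgL L N\<^esub> x \<in> I"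
      "{UE L N i N \<alpha> |i \<alpha>. i \<in> {1..N} \<and> \<alpha> \<in> {1..L}} \<subseteq> I"
    then have "x \<in> I" "y \<in> I" using xy(1,2) unfolding Iplus_def left_idl_def by blast+
    then show "x \<oplus>\<^bsub>UgL L N\<^esub> y \<in> I" by (rule additive_subgroup.a_closed[OF I(1)])
  qed
  moreover have "model L N (x \<oplus>\<^bsub>UgL L N\<^esub> y) = u + v"
    using xy Iplus_Imod_subset by (subst model_add) auto
  ultimately show ?case by blast
next
  case (Imod_left u v)
  then obtain y where y: "y \<in> Iplus L N" "model L N y = v" by blast
  obtain x where x: "x \<in> carrier (UgL L N)" "model L N x = u" using Umod_model Imod_left.hyps by blast
  have "x \<otimes>\<^bsub>UgL L N\<^esub> y \<in> Iplus L N"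
    using x(1) y(1) unfolding Iplus_def left_idl_def by blast
  moreover have "model L N (x \<otimes>\<^bsub>UgL L N\<^esub> y) = u * v"
    using x y Iplus_Imod_subset by (subst model_mult) auto
  ultimately show ?case by blast
qed

lemma Iplus_iff: "z \<in> carrier (UgL L N) \<Longrightarrow> z \<in> Iplus L N \<longleftrightarrow> model L N z \<in> Imod L N"
  using Iplus_Imod_subset Imod_Iplus model_inj by blast

lemma glc_mono: "K \<le> N \<Longrightarrow> glc L K \<subseteq> glc L N"
  by (fastforce simp: gl_simps)

lemma lie_model_mono:
  assumes "K \<le> N" "x \<in> glc L K"
  shows "lie_model L N x = lie_model L K x"
  unfolding lie_model_def
proof (rule sum.cong[OF refl])
  fix \<alpha>
  have z: "x \<alpha> i j = 0" if "i \<notin> {1..K} \<or> j \<notin> {1..K}" for i j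
    using assms(2) that unfolding gl_simps by blast
  have "(\<Sum>i\<in>{1..K}. \<Sum>j\<in>{1..K}. cst (x \<alpha> i j) * E (i, j, \<alpha>)) = (\<Sum>i\<in>{1..K}. \<Sum>j\<in>{1..N}. cst (x \<alpha> i j) * E (i, j, \<alpha>))"
    using assms(1) z by (intro sum.cong sum.mono_neutral_left refl) (auto simp: ua.cst_0)
  also have "\<dots> = (\<Sum>i\<in>{1..N}. \<Sum>j\<in>{1..N}. cst (x \<alpha> i j) * E (i, j, \<alpha>))"
    using assms(1) z by (intro sum.mono_neutral_left) (auto simp: ua.cst_0)
  finally show "(\<Sum>i\<in>{1..N}. \<Sum>j\<in>{1..N}. cst (x \<alpha> i j) * E (i, j, \<alpha>)) =
      (\<Sum>i\<in>{1..K}. \<Sum>j\<in>{1..K}. cst (x \<alpha> i j) * E (i, j, \<alpha>))" by simp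
qed

lemma ev_lie_mono: "K \<le> N \<Longrightarrow> p \<in> fcar (glc L K) \<Longrightarrow> ev_lie L N p = ev_lie L K p"
  by (rule ua.ev_cong) (auto simp: fcar_def intro: lie_model_mono)

lemma env_incl_ep:
  assumes "K \<le> N" "p \<in> fcar (glc L K)"
  shows "env_incl (gl L N) (ep L K p) = ep L N p"
proof -
  have sub: "q \<in> eid L N" if q: "q \<in> eid L K" for q
  proof (rule ev_lie_app_eq_0)
    have "q \<in> fcar (glc L K)" using q eidD(1) by blast
    then show "q \<in> fcar (glc L N)" "app (ev_lie L N q) 1 = 0"
      using fcar_mono[OF _ glc_mono[OF assms(1)]] ev_lie_mono[OF assms(1)] ev_lie_eid[OF q] by (auto simp: app_simps)
  qed
  have "(\<exists>a\<in>eid L N. \<exists>b. b - p \<in> eid L K \<and> x = a + b) \<longleftrightarrow> x - p \<in> eid L N" for x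
  proof
    assume "\<exists>a\<in>eid L N. \<exists>b. b - p \<in> eid L K \<and> x = a + b"
    then obtain a b where "a \<in> eid L N" "b - p \<in> eid L K" "x = a + b" by blast
    then show "x - p \<in> eid L N" using eidD(3)[of a L N "b - p"] sub by (simp add: algebra_simps)
  next
    assume "x - p \<in> eid L N"
    then show "\<exists>a\<in>eid L N. \<exists>b. b - p \<in> eid L K \<and> x = a + b"
      by (intro bexI[of _ "x - p"] exI[of _ p]) (auto simp: eidD(2))
  qed
  then show ?thesis
    unfolding env_incl_def set_add_def' by (auto simp: free_alg_simps ep_eq)
qed

lemma env_incl_carrier: "K \<le> N \<Longrightarrow> y \<in> carrier (UgL L K) \<Longrightarrow> env_incl (gl L N) y \<in> carrier (UgL L N)"
  and model_env_incl: "K \<le> N \<Longrightarrow> y \<in> carrier (UgL L K) \<Longrightarrow> model L N (env_incl (gl L N) y) = model L K y"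
  using fcar_mono[OF _ glc_mono] by (auto simp: UgL_carrier env_incl_ep model_ep ev_lie_mono)

lemma model_diag:
  assumes "a \<in> gl_sub d N"
  shows "env_in (gl L N) (diag_emb L a) \<in> carrier (UgL L N)"
    "model L N (env_in (gl L N) (diag_emb L a)) = (\<Sum>i\<in>{1..N}. \<Sum>j\<in>{1..N}. cst (a i j) * (\<Sum>\<alpha>\<in>{1..L}. E (i, j, \<alpha>)))"
proof -
  have 1: "diag_emb L a \<in> glc L N"
    using assms by (fastforce simp: diag_emb_def gl_sub_def gl_simps split: if_splits)
  then show "env_in (gl L N) (diag_emb L a) \<in> carrier (UgL L N)"
    by (auto simp: env_in_def UgL_carrier fcar_gen)
  have "model L N (env_in (gl L N) (diag_emb L a)) = (\<Sum>\<alpha>\<in>{1..L}. \<Sum>i\<in>{1..N}. \<Sum>j\<in>{1..N}. cst (a i j) * E (i, j, \<alpha>))"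
    unfolding env_in_def model_ep ua.ev_gen lie_model_def by (intro sum.cong refl) (simp add: diag_emb_def)
  also have "\<dots> = (\<Sum>i\<in>{1..N}. \<Sum>\<alpha>\<in>{1..L}. \<Sum>j\<in>{1..N}. cst (a i j) * E (i, j, \<alpha>))"
    by (rule sum.swap)
  also have "\<dots> = (\<Sum>i\<in>{1..N}. \<Sum>j\<in>{1..N}. \<Sum>\<alpha>\<in>{1..L}. cst (a i j) * E (i, j, \<alpha>))"
    by (intro sum.cong refl sum.swap)
  finally show "model L N (env_in (gl L N) (diag_emb L a)) = (\<Sum>i\<in>{1..N}. \<Sum>j\<in>{1..N}. cst (a i j) * (\<Sum>\<alpha>\<in>{1..L}. E (i, j, \<alpha>)))"
    by (simp add: sum_distrib_left)
qed

definition centralizes :: "nat \<Rightarrow> nat \<Rightarrow> nat \<Rightarrow> U \<Rightarrow> bool"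
  where "centralizes d L N u \<longleftrightarrow> (\<forall>i\<in>{1..N}. \<forall>j\<in>{1..N}. d < i \<longrightarrow> d < j \<longrightarrow>
    (\<Sum>\<alpha>\<in>{1..L}. E (i, j, \<alpha>)) * u = u * (\<Sum>\<alpha>\<in>{1..L}. E (i, j, \<alpha>)))"

lemma centralizes_centr:
  assumes "x \<in> carrier (UgL L N)" "centralizes d L N (model L N x)"
  shows "x \<in> centr d L N"
  unfolding centr_def mem_Collect_eq
proof (intro conjI ballI)
  interpret ring "UgL L N" by (rule ring_UgL)
  fix a assume a: "a \<in> gl_sub d N"
  let ?D = "\<lambda>i j. \<Sum>\<alpha>\<in>{1..L}. E (i, j, \<alpha>)"
  have "cst (a i j) * ?D i j * model L N x = model L N x * (cst (a i j) * ?D i j)" if "i \<in> {1..N}" "j \<in> {1..N}" for i j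
  proof (cases "a i j = 0")
    case False
    then have "d < i" "d < j" using a by (auto simp: gl_sub_def)
    then have "?D i j * model L N x = model L N x * ?D i j" using assms(2) that by (auto simp: centralizes_def)
    then show ?thesis by (metis cst_left mult.assoc)
  qed (simp add: ua.cst_0)
  then have "model L N (env_in (gl L N) (diag_emb L a)) * model L N x = model L N x * model L N (env_in (gl L N) (diag_emb L a))"
    unfolding model_diag(2)[OF a] sum_distrib_left[of "model L N x"] sum_distrib_right by (intro sum.cong refl) blast
  then show "env_in (gl L N) (diag_emb L a) \<otimes>\<^bsub>UgL L N\<^esub> x = x \<otimes>\<^bsub>UgL L N\<^esub> env_in (gl L N) (diag_emb L a)"
    using model_diag(1)[OF a] assms(1) by (intro model_inj) (auto simp: model_mult)
qed (rule assms(1))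

lemma centralizes_minus: "centralizes d L N u \<Longrightarrow> centralizes d L N v \<Longrightarrow> centralizes d L N (u - v)"
  and centralizes_add: "centralizes d L N u \<Longrightarrow> centralizes d L N v \<Longrightarrow> centralizes d L N (u + v)"
  by (auto simp: centralizes_def left_diff_distrib right_diff_distrib distrib_left distrib_right)

lemma centralizes_cst: "centralizes d L N (cst c)"
  unfolding centralizes_def by (metis ua.cst_comm)

lemma centralizes_mult: "centralizes d L N u \<Longrightarrow> centralizes d L N v \<Longrightarrow> centralizes d L N (u * v)"
proof -
  have "x * (u * v) = u * v * x" if "x * u = u * x" "x * v = v * x" for x
    using that by (metis mult.assoc)
  then show "centralizes d L N u \<Longrightarrow> centralizes d L N v \<Longrightarrow> centralizes d L N (u * v)"
    unfolding centralizes_def by blast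
qed

lemma centralizes_mono: "centralizes d L N u \<Longrightarrow> d \<le> d' \<Longrightarrow> centralizes d' L N u"
  by (auto simp: centralizes_def)

lemma centralizes_Umod: "u \<in> Umod L K \<Longrightarrow> centralizes K L (Suc K) u"
proof -
  assume "u \<in> Umod L K"
  then obtain n where "Fmod L K n u" by (auto simp: Umod_def)
  then show ?thesis
  proof (induction rule: Fmod.induct)
    case (Fmod_E i j \<alpha> n)
    have "E (Suc K, Suc K, \<beta>) * E (i, j, \<alpha>) = E (i, j, \<alpha>) * E (Suc K, Suc K, \<beta>)" for \<beta>
      using E_comm[of "Suc K" "Suc K" \<beta> i j \<alpha>] Fmod_E by (auto simp: algebra_simps)
    then have "(\<Sum>\<beta>\<in>{1..L}. E (Suc K, Suc K, \<beta>)) * E (i, j, \<alpha>) = E (i, j, \<alpha>) * (\<Sum>\<beta>\<in>{1..L}. E (Suc K, Suc K, \<beta>))"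
      by (simp add: sum_distrib_left sum_distrib_right)
    moreover have "a = Suc K" if "a \<in> {1..Suc K}" "K < a" for a using that by auto
    ultimately show ?case unfolding centralizes_def by metis
  qed (auto intro: centralizes_cst centralizes_add centralizes_mult)
qed

text \<open>The difference of two candidates for the value lies in the left ideal and in \<open>U(gl(K)\<^sup>L)\<close>; it is zero since
its value on \<open>1\<close> lies in the ideal of the last column and involves only the other columns.\<close>

lemma centr_proj_eq:
  assumes "x \<in> carrier (UgL L (Suc K))" "centralizes K L (Suc K) (model L (Suc K) x)"
    and y: "y \<in> carrier (UgL L K)" and xy: "model L (Suc K) x - model L K y \<in> Imod L (Suc K)"
  shows "centr_proj L (Suc K) x = y"
proof -
  interpret ring "UgL L (Suc K)" by (rule ring_UgL)
  let ?N = "Suc K"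
  have inc: "env_incl (gl L ?N) z \<in> carrier (UgL L ?N)" "model L ?N (env_incl (gl L ?N) z) = model L K z"
    if "z \<in> carrier (UgL L K)" for z
    using env_incl_carrier[OF _ that, of ?N] model_env_incl[OF _ that, of ?N] by simp_all
  have J: "x \<ominus>\<^bsub>UgL L ?N\<^esub> env_incl (gl L ?N) z \<in> Jideal L ?N \<longleftrightarrow> model L ?N x - model L K z \<in> Imod L ?N"
    if z: "z \<in> carrier (UgL L K)" for z
  proof -
    have c: "x \<ominus>\<^bsub>UgL L ?N\<^esub> env_incl (gl L ?N) z \<in> carrier (UgL L ?N)" using assms(1) inc[OF z] by simp
    have t: "model L ?N (x \<ominus>\<^bsub>UgL L ?N\<^esub> env_incl (gl L ?N) z) = model L ?N x - model L K z"
      using assms(1) inc[OF z] by (simp add: model_minus)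
    have "x \<ominus>\<^bsub>UgL L ?N\<^esub> env_incl (gl L ?N) z \<in> centr K L ?N"
      using c t assms(2) centralizes_Umod[OF model_Umod[OF z]] by (intro centralizes_centr) (auto intro: centralizes_minus)
    then show ?thesis using Iplus_iff[OF c] t by (simp add: Jideal_def)
  qed
  show ?thesis
    unfolding centr_proj_def diff_Suc_1
  proof (rule the_equality)
    show "y \<in> carrier (UgL L K) \<and> x \<ominus>\<^bsub>UgL L ?N\<^esub> env_incl (gl L ?N) y \<in> Jideal L ?N"
      using y xy J by blast
    fix z assume z: "z \<in> carrier (UgL L K) \<and> x \<ominus>\<^bsub>UgL L ?N\<^esub> env_incl (gl L ?N) z \<in> Jideal L ?N"
    then have "model L ?N x - model L K z \<in> Imod L ?N" using J by blast
    from Imod_diff[OF this xy] have "model L K y - model L K z \<in> Imod L ?N" by simp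
    moreover have "model L K y - model L K z \<in> Umod L K" using y z by (intro Umod_diff model_Umod) auto
    ultimately have "app (model L K y - model L K z) 1 = 0" by (rule Imod_Umod_app)
    then show "z = y" using z y by (intro model_app_inj[of z L K y]) (auto simp: app_simps)
  qed
qed

section \<open>The generators as coefficients of the inverse matrix\<close>

subsection \<open>Series in the model\<close>

text \<open>The coefficient at the word \<open>v\<close> of the \<open>(i, k)\<close> entry of \<open>\<Sum>\<^sub>\<alpha> E\<^sub>\<alpha> (u\<^sub>\<alpha> + c)\<^sup>-\<^sup>1\<close>.\<close>

definition E_series :: "nat \<Rightarrow> complex \<Rightarrow> nat \<Rightarrow> nat \<Rightarrow> nat list \<Rightarrow> U"
  where "E_series L c i k v = (\<Sum>\<alpha>\<in>{1..L}. if v \<noteq> [] \<and> set v \<subseteq> {\<alpha>} then cst ((- c) ^ (length v - 1)) * E (i, k, \<alpha>) else 0)"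

lemma E_series_Nil: "E_series L c i k [] = 0"
  by (simp add: E_series_def)

lemma E_series_single: "\<alpha> \<in> {1..L} \<Longrightarrow> E_series L c i k [\<alpha>] = E (i, k, \<alpha>)"
  by (simp add: E_series_def ua.cst_1)

lemma E_series_Cons:
  assumes "v \<noteq> []"
  shows "E_series L c i k (\<alpha> # v) = (if hd v = \<alpha> then cst (- c) * E_series L c i k v else 0)"
proof -
  obtain m where m: "length v = Suc m" using assms by (cases v) auto
  have "set v \<subseteq> {\<beta>} \<Longrightarrow> hd v = \<beta>" for \<beta> using assms hd_in_set[of v] by blast
  moreover define e where "e = - c"
  ultimately show ?thesis unfolding E_series_def e_def[symmetric]
    using m by (auto simp: sum_distrib_left ua.cst_mult mult.assoc intro!: sum.cong sum.neutral)
qed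

lemma E_series_snoc:
  assumes "v \<noteq> []"
  shows "E_series L c i k (v @ [\<alpha>]) = (if last v = \<alpha> then cst (- c) * E_series L c i k v else 0)"
proof -
  obtain m where m: "length v = Suc m" using assms by (cases v) auto
  have "set v \<subseteq> {\<beta>} \<Longrightarrow> last v = \<beta>" for \<beta> using assms last_in_set[of v] by blast
  moreover define e where "e = - c"
  ultimately show ?thesis unfolding E_series_def e_def[symmetric]
    using m by (auto simp: sum_distrib_left ua.cst_mult mult.assoc intro!: sum.cong sum.neutral)
qed

definition mconv :: "nat \<Rightarrow> (nat \<Rightarrow> nat \<Rightarrow> nat list \<Rightarrow> U) \<Rightarrow> (nat \<Rightarrow> nat \<Rightarrow> nat list \<Rightarrow> U) \<Rightarrow> nat \<Rightarrow> nat \<Rightarrow> nat list \<Rightarrow> U"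
  where "mconv N A B i j w = (\<Sum>k\<in>{1..N}. \<Sum>q\<in>{0..length w}. A i k (take q w) * B k j (drop q w))"

lemma tU_E_series_left:
  assumes "w \<noteq> []" "set w \<subseteq> {1..L}"
  shows "tU N c i j w = mconv N (E_series L c) (tU N c) i j w"
  using assms
proof (induction w)
  case Nil
  then show ?case by simp
next
  case (Cons \<alpha> w)
  have a: "\<alpha> \<in> {1..L}" using Cons.prems by auto
  define h where "h = (if starts \<alpha> w then - c else 0)"
  have g: "E_series L c i k (\<alpha> # take q w) = (if q = 0 then E (i, k, \<alpha>) else 0) + cst h * E_series L c i k (take q w)" if "q \<le> length w" for q k
  proof (cases "take q w = []")
    case True
    then have "q = 0" using that by auto
    then show ?thesis using a by (simp add: E_series_single E_series_Nil)
  next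
    case False
    then show ?thesis by (cases "q = 0") (auto simp: E_series_Cons h_def starts_def ua.cst_0)
  qed
  have "mconv N (E_series L c) (tU N c) i j (\<alpha> # w) =
      (\<Sum>k\<in>{1..N}. \<Sum>q\<in>{0..length w}. E_series L c i k (\<alpha> # take q w) * tU N c k j (drop q w))"
    unfolding mconv_def length_Cons sum.atLeast0_atMost_Suc_shift by (simp add: E_series_Nil)
  also have "\<dots> = (\<Sum>k\<in>{1..N}. \<Sum>q\<in>{0..length w}. (if q = 0 then E (i, k, \<alpha>) * tU N c k j w else 0) +
      cst h * (E_series L c i k (take q w) * tU N c k j (drop q w)))"
    by (intro sum.cong refl) (auto simp: g distrib_right mult.assoc)
  also have "\<dots> = (\<Sum>k\<in>{1..N}. E (i, k, \<alpha>) * tU N c k j w) + cst h * mconv N (E_series L c) (tU N c) i j w"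
    by (simp add: sum.distrib mconv_def sum_distrib_left)
  also have "\<dots> = tU N c i j (\<alpha> # w)"
  proof (cases "starts \<alpha> w")
    case True
    then have "mconv N (E_series L c) (tU N c) i j w = tU N c i j w"
      using Cons by (auto simp: starts_def)
    then show ?thesis using True by (simp add: h_def ua.cst_uminus)
  qed (simp add: h_def ua.cst_0)
  finally show ?case by simp
qed

lemma tU_E_series_right:
  assumes "w \<noteq> []" "set w \<subseteq> {1..L}" "i \<in> {1..N}" "j \<in> {1..N}"
  shows "tU N c i j w = mconv N (tU N c) (E_series L c) i j w"
  using assms(1,2)
proof (induction w rule: rev_induct)
  case Nil
  then show ?case by simp
next
  case (snoc \<beta> w)
  have b: "\<beta> \<in> {1..L}" using snoc.prems by auto
  define h where "h = (if w \<noteq> [] \<and> last w = \<beta> then - c else 0)"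
  have g: "E_series L c k j (drop q w @ [\<beta>]) = (if q = length w then E (k, j, \<beta>) else 0) + cst h * E_series L c k j (drop q w)" if "q \<le> length w" for q k
  proof (cases "drop q w = []")
    case True
    then have "q = length w" using that by auto
    then show ?thesis using b by (simp add: E_series_single E_series_Nil)
  next
    case False
    then show ?thesis by (auto simp: E_series_snoc h_def ua.cst_0)
  qed
  have "mconv N (tU N c) (E_series L c) i j (w @ [\<beta>]) =
      (\<Sum>k\<in>{1..N}. \<Sum>q\<in>{0..length w}. tU N c i k (take q w) * E_series L c k j (drop q w @ [\<beta>]))"
    unfolding mconv_def by (auto simp: E_series_Nil intro!: sum.cong)
  also have "\<dots> = (\<Sum>k\<in>{1..N}. \<Sum>q\<in>{0..length w}. (if q = length w then tU N c i k w * E (k, j, \<beta>) else 0) +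
      cst h * (tU N c i k (take q w) * E_series L c k j (drop q w)))"
    by (intro sum.cong refl) (auto simp: g distrib_left cst_left[of "tU N c i _ _"])
  also have "\<dots> = (\<Sum>k\<in>{1..N}. tU N c i k w * E (k, j, \<beta>)) + cst h * mconv N (tU N c) (E_series L c) i j w"
    by (simp add: sum.distrib mconv_def sum_distrib_left)
  also have "\<dots> = tU N c i j (w @ [\<beta>])"
  proof (cases "w \<noteq> [] \<and> last w = \<beta>")
    case True
    then have "mconv N (tU N c) (E_series L c) i j w = tU N c i j w" using snoc by auto
    then show ?thesis unfolding tU_snoc[OF assms(3,4)] using True by (simp add: h_def ua.cst_uminus)
  qed (auto simp: h_def ua.cst_0 tU_snoc[OF assms(3,4)])
  finally show ?case by simp
qed

definition one_minus_E :: "nat \<Rightarrow> complex \<Rightarrow> nat \<Rightarrow> nat \<Rightarrow> nat list \<Rightarrow> U"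
  where "one_minus_E L c i j w = (if w = [] \<and> i = j then 1 else 0) - E_series L c i j w"

lemma mconv_one_minus_E_left:
  assumes "i \<in> {1..N}"
  shows "mconv N (one_minus_E L c) Y i j w = Y i j w - mconv N (E_series L c) Y i j w"
proof -
  have "mconv N (one_minus_E L c) Y i j w = (\<Sum>k\<in>{1..N}. \<Sum>q\<in>{0..length w}.
      (if q = 0 then (if i = k then Y k j w else 0) else 0) - E_series L c i k (take q w) * Y k j (drop q w))"
    unfolding mconv_def one_minus_E_def by (intro sum.cong refl) (auto simp: left_diff_distrib)
  also have "\<dots> = Y i j w - mconv N (E_series L c) Y i j w"
    using assms by (simp add: sum_subtractf mconv_def)
  finally show ?thesis .
qed

lemma mconv_one_minus_E_right:
  assumes "j \<in> {1..N}"
  shows "mconv N Y (one_minus_E L c) i j w = Y i j w - mconv N Y (E_series L c) i j w"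
proof -
  have "mconv N Y (one_minus_E L c) i j w = (\<Sum>k\<in>{1..N}. \<Sum>q\<in>{0..length w}.
      (if q = length w then (if k = j then Y i k w else 0) else 0) - Y i k (take q w) * E_series L c k j (drop q w))"
    unfolding mconv_def one_minus_E_def by (intro sum.cong refl) (auto simp: right_diff_distrib)
  also have "\<dots> = Y i j w - mconv N Y (E_series L c) i j w"
    using assms by (simp add: sum_subtractf mconv_def)
  finally show ?thesis .
qed

lemma mconv_E_series_Nil: "mconv N (E_series L c) Y i j [] = 0" "mconv N Y (E_series L c) i j [] = 0"
  by (simp_all add: mconv_def E_series_Nil)

lemma one_minus_E_tU:
  assumes "i \<in> {1..N}" "j \<in> {1..N}" "set w \<subseteq> {1..L}"
  shows "mconv N (one_minus_E L c) (tU N c) i j w = (if w = [] \<and> i = j then 1 else 0)"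
    "mconv N (tU N c) (one_minus_E L c) i j w = (if w = [] \<and> i = j then 1 else 0)"
  using tU_E_series_left[of w L N c i j] tU_E_series_right[of w L i N j c] assms
  by (cases "w = []"; simp add: mconv_one_minus_E_left mconv_one_minus_E_right mconv_E_series_Nil)+

text \<open>The series of \<^const>\<open>E_series\<close> has no constant term, so the coefficient of a right inverse at \<open>w\<close> is
determined by the coefficients at shorter words.\<close>

lemma one_minus_E_inverse_unique:
  assumes "\<And>i j w. i \<in> {1..N} \<Longrightarrow> j \<in> {1..N} \<Longrightarrow> set w \<subseteq> {1..L} \<Longrightarrow>
      mconv N (one_minus_E L c) Y i j w = (if w = [] \<and> i = j then 1 else 0)"
    and "i \<in> {1..N}" "j \<in> {1..N}" "set w \<subseteq> {1..L}"
  shows "Y i j w = tU N c i j w"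
  using assms(2-)
proof (induction w arbitrary: i rule: length_induct)
  case (1 w)
  have "mconv N (E_series L c) Y i j w = mconv N (E_series L c) (tU N c) i j w"
    unfolding mconv_def
  proof (intro sum.cong refl)
    fix k q assume k: "k \<in> {1..N}" and q: "q \<in> {0..length w}"
    show "E_series L c i k (take q w) * Y k j (drop q w) = E_series L c i k (take q w) * tU N c k j (drop q w)"
    proof (cases "take q w = []")
      case True
      then show ?thesis unfolding True E_series_Nil by simp
    next
      case False
      then have "length (drop q w) < length w" by auto
      moreover have "set (drop q w) \<subseteq> {1..L}" using 1(4) set_drop_subset[of q w] by auto
      ultimately have "Y k j (drop q w) = tU N c k j (drop q w)" using 1(1) k 1(3) by blast
      then show ?thesis by simp
    qed
  qed
  moreover have "Y i j w - mconv N (E_series L c) Y i j w = (if w = [] \<and> i = j then 1 else 0)"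
    using assms(1)[OF 1(2-4)] mconv_one_minus_E_left[OF 1(2), of L c Y j w] by simp
  moreover have "tU N c i j w - mconv N (E_series L c) (tU N c) i j w = (if w = [] \<and> i = j then 1 else 0)"
    using one_minus_E_tU(1)[OF 1(2-4), of c] mconv_one_minus_E_left[OF 1(2), of L c "tU N c" j w] by simp
  ultimately show ?case by (metis diff_add_cancel)
qed

subsection \<open>Matrices of series over the enveloping algebra\<close>

lemma abelian_group_ncseries:
  assumes "abelian_group R"
  shows "abelian_group (ncseries L R)"
proof -
  interpret abelian_group R by fact
  show ?thesis
  proof (rule abelian_groupI)
    fix x assume x: "x \<in> carrier (ncseries L R)"
    show "\<exists>y\<in>carrier (ncseries L R). y \<oplus>\<^bsub>ncseries L R\<^esub> x = \<zero>\<^bsub>ncseries L R\<^esub>"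
      using x by (intro bexI[of _ "\<lambda>w\<in>words0 L. \<ominus>\<^bsub>R\<^esub> x w"]) (auto simp: ncseries_def l_neg PiE_iff fun_eq_iff)
  qed (auto simp: ncseries_def PiE_iff extensional_def fun_eq_iff a_assoc intro: a_comm)
qed

lemma abelian_group_matrix_ring:
  assumes "abelian_group R"
  shows "abelian_group (matrix_ring n R)"
proof -
  interpret abelian_group R by fact
  show ?thesis
  proof (rule abelian_groupI)
    fix x assume x: "x \<in> carrier (matrix_ring n R)"
    show "\<exists>y\<in>carrier (matrix_ring n R). y \<oplus>\<^bsub>matrix_ring n R\<^esub> x = \<zero>\<^bsub>matrix_ring n R\<^esub>"
      using x by (intro bexI[of _ "\<lambda>ij\<in>{1..n} \<times> {1..n}. \<ominus>\<^bsub>R\<^esub> x ij"]) (auto simp: matrix_ring_def l_neg PiE_iff fun_eq_iff)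
  qed (auto simp: matrix_ring_def PiE_iff extensional_def fun_eq_iff a_assoc intro: a_comm)
qed

lemma model_finsum:
  assumes "finite A" "f \<in> A \<rightarrow> carrier (UgL L N)"
  shows "model L N (finsum (UgL L N) f A) = (\<Sum>a\<in>A. model L N (f a))"
proof -
  interpret ring "UgL L N" by (rule ring_UgL)
  show ?thesis using assms
    by (induction A rule: finite_induct) (auto simp: model_zero model_add finsum_closed Pi_def)
qed

lemma ag_ncseries: "abelian_group (ncseries L (UgL L N))"
  by (intro abelian_group_ncseries ring.is_abelian_group ring_UgL)
lemma ag_series_matrices: "abelian_group (series_matrices L N)"
  by (intro abelian_group_matrix_ring ag_ncseries)

lemma words0_take: "w \<in> words0 L \<Longrightarrow> take q w \<in> words0 L"
  and words0_drop: "w \<in> words0 L \<Longrightarrow> drop q w \<in> words0 L"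
  unfolding words0_def lists_eq_set using set_take_subset[of q w] set_drop_subset[of q w] by auto

lemma words0_iff: "w \<in> words0 L \<longleftrightarrow> set w \<subseteq> {1..L}"
  by (auto simp: words0_def)

lemma ncs_mult_closed:
  assumes "F \<in> carrier (ncseries L (UgL L N))" "G \<in> carrier (ncseries L (UgL L N))"
  shows "F \<otimes>\<^bsub>ncseries L (UgL L N)\<^esub> G \<in> carrier (ncseries L (UgL L N))"
proof -
  interpret ring "UgL L N" by (rule ring_UgL)
  have "F v \<in> carrier (UgL L N)" "G v \<in> carrier (UgL L N)" if "v \<in> words0 L" for v
    using assms that by (auto simp: ncseries_def)
  then show ?thesis
    by (auto simp: ncseries_def intro!: finsum_closed m_closed words0_take words0_drop)
qed

lemma ncs_mult_model:
  assumes "F \<in> carrier (ncseries L (UgL L N))" "G \<in> carrier (ncseries L (UgL L N))" "w \<in> words0 L"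
  shows "model L N ((F \<otimes>\<^bsub>ncseries L (UgL L N)\<^esub> G) w) = (\<Sum>q\<in>{0..length w}. model L N (F (take q w)) * model L N (G (drop q w)))"
proof -
  interpret ring "UgL L N" by (rule ring_UgL)
  have c: "F v \<in> carrier (UgL L N)" "G v \<in> carrier (UgL L N)" if "v \<in> words0 L" for v
    using assms that by (auto simp: ncseries_def)
  have "model L N ((F \<otimes>\<^bsub>ncseries L (UgL L N)\<^esub> G) w) =
      model L N (\<Oplus>\<^bsub>UgL L N\<^esub>k\<in>{0..length w}. F (take k w) \<otimes>\<^bsub>UgL L N\<^esub> G (drop k w))"
    using assms(3) by (simp add: ncseries_def)
  also have "\<dots> = (\<Sum>q\<in>{0..length w}. model L N (F (take q w) \<otimes>\<^bsub>UgL L N\<^esub> G (drop q w)))"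
    using c assms(3) by (intro model_finsum) (auto intro!: m_closed words0_take words0_drop)
  also have "\<dots> = (\<Sum>q\<in>{0..length w}. model L N (F (take q w)) * model L N (G (drop q w)))"
    using c assms(3) by (intro sum.cong refl model_mult) (auto intro!: words0_take words0_drop)
  finally show ?thesis .
qed

lemma ncs_finsum_model:
  assumes "finite A" "f \<in> A \<rightarrow> carrier (ncseries L (UgL L N))" "w \<in> words0 L"
  shows "model L N (finsum (ncseries L (UgL L N)) f A w) = (\<Sum>a\<in>A. model L N (f a w))"
proof -
  interpret abelian_group "ncseries L (UgL L N)" by (rule ag_ncseries)
  have c: "F w \<in> carrier (UgL L N)" if "F \<in> carrier (ncseries L (UgL L N))" for F
    using assms(3) that by (auto simp: ncseries_def)
  have add: "(F \<oplus>\<^bsub>ncseries L (UgL L N)\<^esub> G) w = F w \<oplus>\<^bsub>UgL L N\<^esub> G w" for F G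
    using assms(3) by (simp add: ncseries_def)
  have zero: "\<zero>\<^bsub>ncseries L (UgL L N)\<^esub> w = \<zero>\<^bsub>UgL L N\<^esub>"
    using assms(3) by (simp add: ncseries_def)
  show ?thesis using assms(1,2)
    by (induction A rule: finite_induct) (auto simp: model_zero model_add add zero c Pi_def)
qed

definition entry :: "nat \<Rightarrow> nat \<Rightarrow> (nat \<times> nat \<Rightarrow> nat list \<Rightarrow> gl_elem falg set) \<Rightarrow> nat \<Rightarrow> nat \<Rightarrow> nat list \<Rightarrow> U"
  where "entry L N A i j w = model L N (A (i, j) w)"

lemma smat_carrier:
  "A \<in> carrier (series_matrices L N) \<Longrightarrow> i \<in> {1..N} \<Longrightarrow> j \<in> {1..N} \<Longrightarrow> A (i, j) \<in> carrier (ncseries L (UgL L N))"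
  "A \<in> carrier (series_matrices L N) \<Longrightarrow> i \<in> {1..N} \<Longrightarrow> j \<in> {1..N} \<Longrightarrow> w \<in> words0 L \<Longrightarrow> A (i, j) w \<in> carrier (UgL L N)"
  by (fastforce simp: matrix_ring_def ncseries_def PiE_iff)+

lemma smat_eqI:
  assumes A: "A \<in> carrier (series_matrices L N)" and B: "B \<in> carrier (series_matrices L N)"
    and eq: "\<And>i j w. i \<in> {1..N} \<Longrightarrow> j \<in> {1..N} \<Longrightarrow> w \<in> words0 L \<Longrightarrow> entry L N A i j w = entry L N B i j w"
  shows "A = B"
proof -
  have "A (i, j) = B (i, j)" if ij: "i \<in> {1..N}" "j \<in> {1..N}" for i j
  proof (rule PiE_ext)
    show "A (i, j) \<in> (\<Pi>\<^sub>E w\<in>words0 L. carrier (UgL L N))" "B (i, j) \<in> (\<Pi>\<^sub>E w\<in>words0 L. carrier (UgL L N))"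
      using smat_carrier(1)[OF A ij] smat_carrier(1)[OF B ij] by (auto simp: ncseries_def)
    show "A (i, j) w = B (i, j) w" if "w \<in> words0 L" for w
      using model_inj[OF smat_carrier(2)[OF A ij that] smat_carrier(2)[OF B ij that]] eq[OF ij that] by (simp add: entry_def)
  qed
  then show ?thesis
    using A B unfolding matrix_ring_def partial_object.simps monoid.simps by (intro PiE_ext[of A _ _ B]) auto
qed

lemma entry_one: "i \<in> {1..N} \<Longrightarrow> j \<in> {1..N} \<Longrightarrow> w \<in> words0 L \<Longrightarrow>
    entry L N \<one>\<^bsub>series_matrices L N\<^esub> i j w = (if w = [] \<and> i = j then 1 else 0)"
  by (auto simp: entry_def matrix_ring_def ncseries_def model_one model_zero)

lemma entry_mult:
  assumes A: "A \<in> carrier (series_matrices L N)" and B: "B \<in> carrier (series_matrices L N)"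
    and "i \<in> {1..N}" "j \<in> {1..N}" "w \<in> words0 L"
  shows "entry L N (A \<otimes>\<^bsub>series_matrices L N\<^esub> B) i j w = mconv N (entry L N A) (entry L N B) i j w"
proof -
  have "entry L N (A \<otimes>\<^bsub>series_matrices L N\<^esub> B) i j w =
      model L N ((\<Oplus>\<^bsub>ncseries L (UgL L N)\<^esub>k\<in>{1..N}. A (i, k) \<otimes>\<^bsub>ncseries L (UgL L N)\<^esub> B (k, j)) w)"
    using assms(3-) by (simp add: entry_def matrix_ring_def)
  also have "\<dots> = (\<Sum>k\<in>{1..N}. model L N ((A (i, k) \<otimes>\<^bsub>ncseries L (UgL L N)\<^esub> B (k, j)) w))"
    using assms by (intro ncs_finsum_model) (auto intro!: ncs_mult_closed smat_carrier)
  also have "\<dots> = mconv N (entry L N A) (entry L N B) i j w"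
    unfolding mconv_def entry_def using assms by (intro sum.cong refl ncs_mult_model) (auto intro!: smat_carrier)
  finally show ?thesis .
qed

lemma smat_mult_closed:
  assumes A: "A \<in> carrier (series_matrices L N)" and B: "B \<in> carrier (series_matrices L N)"
  shows "A \<otimes>\<^bsub>series_matrices L N\<^esub> B \<in> carrier (series_matrices L N)"
proof -
  interpret abelian_group "ncseries L (UgL L N)" by (rule ag_ncseries)
  have "(\<Oplus>\<^bsub>ncseries L (UgL L N)\<^esub>k\<in>{1..N}. A (i, k) \<otimes>\<^bsub>ncseries L (UgL L N)\<^esub> B (k, j)) \<in> carrier (ncseries L (UgL L N))"
    if "i \<in> {1..N}" "j \<in> {1..N}" for i j
    using that A B by (intro finsum_closed) (auto intro!: ncs_mult_closed smat_carrier)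
  then show ?thesis by (auto simp: matrix_ring_def)
qed

lemma smat_one_closed: "\<one>\<^bsub>series_matrices L N\<^esub> \<in> carrier (series_matrices L N)"
proof -
  interpret ring "UgL L N" by (rule ring_UgL)
  have "\<one>\<^bsub>ncseries L (UgL L N)\<^esub> \<in> carrier (ncseries L (UgL L N))" "\<zero>\<^bsub>ncseries L (UgL L N)\<^esub> \<in> carrier (ncseries L (UgL L N))"
    by (auto simp: ncseries_def)
  then show ?thesis by (auto simp: matrix_ring_def)
qed

lemma entry_add:
  assumes "A \<in> carrier (series_matrices L N)" "B \<in> carrier (series_matrices L N)"
    "i \<in> {1..N}" "j \<in> {1..N}" "w \<in> words0 L"
  shows "entry L N (A \<oplus>\<^bsub>series_matrices L N\<^esub> B) i j w = entry L N A i j w + entry L N B i j w"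
proof -
  have "(A \<oplus>\<^bsub>series_matrices L N\<^esub> B) (i, j) w = A (i, j) w \<oplus>\<^bsub>UgL L N\<^esub> B (i, j) w"
    using assms(3-) by (simp add: matrix_ring_def ncseries_def)
  then show ?thesis using assms by (simp add: entry_def model_add smat_carrier)
qed

lemma entry_zero:
  "i \<in> {1..N} \<Longrightarrow> j \<in> {1..N} \<Longrightarrow> w \<in> words0 L \<Longrightarrow> entry L N \<zero>\<^bsub>series_matrices L N\<^esub> i j w = 0"
  by (simp add: entry_def matrix_ring_def ncseries_def model_zero)

lemma entry_minus:
  assumes A: "A \<in> carrier (series_matrices L N)" and B: "B \<in> carrier (series_matrices L N)"
    and "i \<in> {1..N}" "j \<in> {1..N}" "w \<in> words0 L"
  shows "entry L N (A \<ominus>\<^bsub>series_matrices L N\<^esub> B) i j w = entry L N A i j w - entry L N B i j w"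
proof -
  interpret abelian_group "series_matrices L N" by (rule ag_series_matrices)
  have "entry L N (\<ominus>\<^bsub>series_matrices L N\<^esub> B \<oplus>\<^bsub>series_matrices L N\<^esub> B) i j w = 0"
    using B assms(3-) by (simp add: l_neg entry_zero)
  then have "entry L N (\<ominus>\<^bsub>series_matrices L N\<^esub> B) i j w = - entry L N B i j w"
    using entry_add[OF a_inv_closed[OF B] B assms(3-)] by (simp add: eq_neg_iff_add_eq_0)
  then show ?thesis
    unfolding a_minus_def using entry_add[OF A a_inv_closed[OF B] assms(3-)] by simp
qed

lemma entry_finsum:
  assumes "finite I" "f \<in> I \<rightarrow> carrier (series_matrices L N)" "i \<in> {1..N}" "j \<in> {1..N}" "w \<in> words0 L"
  shows "entry L N (finsum (series_matrices L N) f I) i j w = (\<Sum>a\<in>I. entry L N (f a) i j w)"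
proof -
  interpret abelian_group "series_matrices L N" by (rule ag_series_matrices)
  show ?thesis using assms(1,2)
    by (induction I rule: finite_induct) (auto simp: entry_zero[OF assms(3-)] entry_add[OF _ _ assms(3-)] finsum_closed Pi_def)
qed

lemma Eseries_carrier: "\<alpha> \<in> {1..L} \<Longrightarrow> Eseries L N c \<alpha> \<in> carrier (series_matrices L N)"
proof -
  interpret ring "UgL L N" by (rule ring_UgL)
  assume "\<alpha> \<in> {1..L}"
  then have "UE L N i j \<alpha> \<in> carrier (UgL L N)" if "i \<in> {1..N}" "j \<in> {1..N}" for i j
    using that by (intro UE_carrier)
  then show ?thesis
    by (auto simp: Eseries_def matrix_ring_def ncseries_def UgL_smult_closed)
qed

lemma entry_Eseries:
  assumes "\<alpha> \<in> {1..L}" "i \<in> {1..N}" "j \<in> {1..N}" "w \<in> words0 L"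
  shows "entry L N (Eseries L N c \<alpha>) i j w =
    (if w \<noteq> [] \<and> set w \<subseteq> {\<alpha>} then cst ((- c) ^ (length w - 1)) * E (i, j, \<alpha>) else 0)"
proof -
  have "UE L N i j \<alpha> \<in> carrier (UgL L N)" "model L N (UE L N i j \<alpha>) = E (i, j, \<alpha>)"
    using assms by (simp_all only: UE_carrier model_UE)
  then show ?thesis using assms
    by (simp add: entry_def Eseries_def model_smult model_zero)
qed

lemma tN_model:
  assumes "i \<in> {1..N}" "j \<in> {1..N}" "w \<in> words0 L"
  shows "tN L N s (i, j, w) \<in> carrier (UgL L N)" "model L N (tN L N s (i, j, w)) = tU N (of_nat N + s) i j w"
proof -
  let ?c = "of_nat N + s"
  let ?M = "series_matrices L N"
  define Es where "Es = (\<Oplus>\<^bsub>?M\<^esub>\<alpha>\<in>{1..L}. Eseries L N ?c \<alpha>)"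
  define A where "A = \<one>\<^bsub>?M\<^esub> \<ominus>\<^bsub>?M\<^esub> Es"
  interpret abelian_group ?M by (rule ag_series_matrices)
  have Es: "Es \<in> carrier ?M" unfolding Es_def using Eseries_carrier by (intro finsum_closed) auto
  have A: "A \<in> carrier ?M" unfolding A_def using smat_one_closed Es by simp
  have cfA: "entry L N A i j w = one_minus_E L ?c i j w" if "i \<in> {1..N}" "j \<in> {1..N}" "w \<in> words0 L" for i j w
  proof -
    have "entry L N Es i j w = (\<Sum>\<alpha>\<in>{1..L}. entry L N (Eseries L N ?c \<alpha>) i j w)"
      unfolding Es_def using that Eseries_carrier by (intro entry_finsum) auto
    also have "\<dots> = E_series L ?c i j w"
      unfolding E_series_def using that by (intro sum.cong refl entry_Eseries) auto
    finally show ?thesis unfolding A_def one_minus_E_def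
      using entry_minus[OF smat_one_closed Es that] entry_one[OF that] by simp
  qed
  have tUg: "tU N ?c i j w \<in> Umod L N" if "i \<in> {1..N}" "j \<in> {1..N}" "w \<in> words0 L" for i j w
    using that Fmod_tU by (intro Umod_Fmod[of _ _ "length w"]) (auto simp: words0_iff)
  define T where "T = (\<lambda>(i, j)\<in>{1..N} \<times> {1..N}. \<lambda>w\<in>words0 L. unmodel L N (tU N ?c i j w))"
  have T: "T \<in> carrier ?M"
    unfolding T_def using tUg unmodel(1) by (auto simp: matrix_ring_def ncseries_def)
  have cfT: "entry L N T i j w = tU N ?c i j w" if "i \<in> {1..N}" "j \<in> {1..N}" "w \<in> words0 L" for i j w
    using unmodel(2)[OF tUg[OF that]] that by (simp add: entry_def T_def)
  have mconv_cong: "mconv N P Q i j w = mconv N P' Q' i j w"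
    if "i \<in> {1..N}" "j \<in> {1..N}" "w \<in> words0 L"
      "\<And>i j w. i \<in> {1..N} \<Longrightarrow> j \<in> {1..N} \<Longrightarrow> w \<in> words0 L \<Longrightarrow> P i j w = P' i j w"
      "\<And>i j w. i \<in> {1..N} \<Longrightarrow> j \<in> {1..N} \<Longrightarrow> w \<in> words0 L \<Longrightarrow> Q i j w = Q' i j w" for P Q P' Q' i j w
    unfolding mconv_def using that words0_take words0_drop by (intro sum.cong refl) auto
  have inv: "A \<otimes>\<^bsub>?M\<^esub> T = \<one>\<^bsub>?M\<^esub>" "T \<otimes>\<^bsub>?M\<^esub> A = \<one>\<^bsub>?M\<^esub>"
  proof -
    show "A \<otimes>\<^bsub>?M\<^esub> T = \<one>\<^bsub>?M\<^esub>"
    proof (rule smat_eqI[OF smat_mult_closed[OF A T] smat_one_closed])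
      fix i j w assume r: "i \<in> {1..N}" "j \<in> {1..N}" "w \<in> words0 L"
      then show "entry L N (A \<otimes>\<^bsub>?M\<^esub> T) i j w = entry L N \<one>\<^bsub>?M\<^esub> i j w"
        using mconv_cong[OF r cfA cfT] one_minus_E_tU(1)[OF r(1,2)] entry_one[OF r]
        by (simp add: entry_mult[OF A T r] words0_iff)
    qed
    show "T \<otimes>\<^bsub>?M\<^esub> A = \<one>\<^bsub>?M\<^esub>"
    proof (rule smat_eqI[OF smat_mult_closed[OF T A] smat_one_closed])
      fix i j w assume r: "i \<in> {1..N}" "j \<in> {1..N}" "w \<in> words0 L"
      then show "entry L N (T \<otimes>\<^bsub>?M\<^esub> A) i j w = entry L N \<one>\<^bsub>?M\<^esub> i j w"
        using mconv_cong[OF r cfT cfA] one_minus_E_tU(2)[OF r(1,2)] entry_one[OF r]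
        by (simp add: entry_mult[OF T A r] words0_iff)
    qed
  qed
  have "inv\<^bsub>?M\<^esub> A = T"
    unfolding m_inv_def
  proof (rule the_equality)
    show "T \<in> carrier ?M \<and> A \<otimes>\<^bsub>?M\<^esub> T = \<one>\<^bsub>?M\<^esub> \<and> T \<otimes>\<^bsub>?M\<^esub> A = \<one>\<^bsub>?M\<^esub>"
      using T inv by blast
    fix Y assume Y: "Y \<in> carrier ?M \<and> A \<otimes>\<^bsub>?M\<^esub> Y = \<one>\<^bsub>?M\<^esub> \<and> Y \<otimes>\<^bsub>?M\<^esub> A = \<one>\<^bsub>?M\<^esub>"
    then have Yc: "Y \<in> carrier ?M" by blast
    show "Y = T"
    proof (rule smat_eqI[OF Yc T])
      fix i j w assume r: "i \<in> {1..N}" "j \<in> {1..N}" "w \<in> words0 L"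
      have "entry L N Y i j w = tU N ?c i j w"
      proof (rule one_minus_E_inverse_unique)
        fix i j w assume "i \<in> {1..N}" "j \<in> {1..N}" "set w \<subseteq> {1..L}"
        then have r: "i \<in> {1..N}" "j \<in> {1..N}" "w \<in> words0 L" by (auto simp: words0_iff)
        have "mconv N (one_minus_E L ?c) (entry L N Y) i j w = mconv N (entry L N A) (entry L N Y) i j w"
          by (rule mconv_cong[OF r]) (auto simp: cfA)
        then show "mconv N (one_minus_E L ?c) (entry L N Y) i j w = (if w = [] \<and> i = j then 1 else 0)"
          using entry_mult[OF A Yc r] Y entry_one[OF r] by simp
      qed (use r in \<open>auto simp: words0_iff\<close>)
      then show "entry L N Y i j w = entry L N T i j w" using cfT[OF r] by simp
    qed
  qed
  then have "tN L N s (i, j, w) = T (i, j) w" by (simp add: tN_def A_def Es_def)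
  then show "tN L N s (i, j, w) \<in> carrier (UgL L N)" "model L N (tN L N s (i, j, w)) = tU N ?c i j w"
    using smat_carrier(2)[OF T assms] cfT[OF assms] by (simp_all add: entry_def)
qed

section \<open>Polynomials in the generators\<close>

definition tdeg :: "triple \<Rightarrow> nat"
  where "tdeg = (\<lambda>(i, j, w). length w)"

lemma mon_degree_tdeg: "mon_degree m = sum_list (map tdeg m)"
  by (simp add: mon_degree_def tdeg_def)

abbreviation ev_t where "ev_t N c \<equiv> ua.ev (tgen N c)"

lemma gens_cases:
  assumes "x \<in> gens d L"
  obtains i j w where "x = (i, j, w)" "i \<in> {1..d}" "j \<in> {1..d}" "w \<noteq> []" "set w \<subseteq> {1..L}" "w \<in> words0 L"
  using assms that by (cases x) (auto simp: gens_def words_def words0_def in_lists_conv_set subset_iff simp del: lists_eq_set)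

lemma Fmod_tgen: "x \<in> gens d L \<Longrightarrow> d \<le> N \<Longrightarrow> Fmod L N (tdeg x) (tgen N c x)"
  by (erule gens_cases) (auto simp: tdeg_def tgen_def intro!: Fmod_tU)

lemma Fmod_ev_t:
  assumes "p \<in> fpol (gens d L) tdeg n" "d \<le> N"
  shows "Fmod L N n (ev_t N c p)"
  unfolding ua.ev_def
proof (intro Fmod_sum Fmod_scale)
  fix m assume "m \<in> ks p"
  then have m: "set (letters m) \<subseteq> gens d L" "sum_list (map tdeg (letters m)) \<le> n"
    using assms(1) by (auto simp: fpol_def)
  have "Fmod L N (sum_list (map tdeg (letters m))) (prod_list (map (tgen N c) (letters m)))"
    using m assms(2) by (intro Fmod_prod_list Fmod_tgen[of _ d]) auto
  then show "Fmod L N n (prod_list (map (tgen N c) (letters m)))"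
    using m(2) by (rule Fmod_mono)
qed

lemma ev_t_Umod: "p \<in> fcar (gens d L) \<Longrightarrow> d \<le> N \<Longrightarrow> ev_t N c p \<in> Umod L N"
  using fcar_fpol[of p "gens d L" tdeg] Fmod_ev_t Umod_Fmod by blast

lemma centralizes_sum: "(\<And>x. x \<in> A \<Longrightarrow> centralizes d L N (f x)) \<Longrightarrow> centralizes d L N (sum f A)"
  using centralizes_cst[of d L N 0]
  by (induction A rule: infinite_finite_induct) (auto simp: ua.cst_0 centralizes_add)

lemma centralizes_prod_list: "(\<And>x. x \<in> set xs \<Longrightarrow> centralizes d L N (f x)) \<Longrightarrow> centralizes d L N (prod_list (map f xs))"
  using centralizes_cst[of d L N 1]
  by (induction xs) (auto simp: ua.cst_1 centralizes_mult)

lemma centralizes_ev_t: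
  assumes "p \<in> fcar (gens d L)" "d \<le> N"
  shows "centralizes d L N (ev_t N c p)"
  unfolding ua.ev_def
proof (intro centralizes_sum centralizes_mult centralizes_cst centralizes_prod_list)
  fix m x assume "m \<in> ks p" "x \<in> set (letters m)"
  then have "x \<in> gens d L" using assms(1) by (auto simp: fcar_def)
  then show "centralizes d L N (tgen N c x)"
  proof (rule gens_cases)
    fix k l w assume x: "x = (k, l, w)" "k \<in> {1..d}" "l \<in> {1..d}" "set w \<subseteq> {1..L}"
    show ?thesis
      unfolding centralizes_def
    proof (intro ballI impI)
      fix i j assume "i \<in> {1..N}" "j \<in> {1..N}" "d < i" "d < j"
      then show "(\<Sum>\<alpha> = 1..L. E (i, j, \<alpha>)) * tgen N c x = tgen N c x * (\<Sum>\<alpha> = 1..L. E (i, j, \<alpha>))"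
        unfolding x tgen_def prod.case using x assms(2) by (intro diag_tU_comm) auto
    qed
  qed
qed

text \<open>The projection is multiplicative: for products,
\<open>t P - t' P' = t (P - P') + (t - t') P'\<close>, where the first term lies in the left ideal and the second one does
since the left ideal is stable under right multiplication by the smaller algebra.\<close>

lemma ev_t_proj:
  assumes "p \<in> fcar (gens d L)" "d \<le> K"
  shows "ev_t (Suc K) c p - ev_t K (c - 1) p \<in> Imod L (Suc K)"
proof -
  have w: "prod_list (map (tgen (Suc K) c) xs) - prod_list (map (tgen K (c - 1)) xs) \<in> Imod L (Suc K)"
    if "set xs \<subseteq> gens d L" for xs
    using that
  proof (induction xs)
    case Nil
    then show ?case by (simp add: Imod_0)
  next
    case (Cons x xs)
    have x: "x \<in> gens d L" and xs: "set xs \<subseteq> gens d L" using Cons.prems by auto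
    let ?P = "prod_list (map (tgen (Suc K) c) xs)" and ?P' = "prod_list (map (tgen K (c - 1)) xs)"
    have "tgen (Suc K) c x - tgen K (c - 1) x \<in> Imod L (Suc K)"
      using x by (rule gens_cases) (use assms(2) in \<open>auto simp: tgen_def intro!: tU_project\<close>)
    moreover have "?P' \<in> Umod L K"
      using ev_t_Umod[of "fmono xs" d L K "c - 1"] xs assms(2) by (simp add: fcar_fmono ua.ev_fmono)
    ultimately have 1: "(tgen (Suc K) c x - tgen K (c - 1) x) * ?P' \<in> Imod L (Suc K)" by (rule Imod_right)
    have "tgen (Suc K) c x \<in> Umod L (Suc K)"
      using Fmod_tgen[OF x, of "Suc K" c] assms(2) Umod_Fmod by simp
    then have 2: "tgen (Suc K) c x * (?P - ?P') \<in> Imod L (Suc K)"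
      using Cons.IH[OF xs] by (rule Imod_left)
    show ?case using Imod_add[OF 1 2] by (simp add: algebra_simps)
  qed
  have "ev_t (Suc K) c p - ev_t K (c - 1) p = (\<Sum>m\<in>ks p. cst (lk p m) *
      (prod_list (map (tgen (Suc K) c) (letters m)) - prod_list (map (tgen K (c - 1)) (letters m))))"
    by (simp add: ua.ev_def right_diff_distrib sum_subtractf)
  then show ?thesis using w assms(1) by (auto simp: fcar_def intro!: Imod_sum Imod_scale)
qed

text \<open>Projecting from size \<open>N + 1\<close> to size \<open>N\<close> lowers the parameter by \<open>1\<close>, so the relation holds for the
parameters \<open>0, -1, -2, \<dots>\<close>; for fixed \<open>N\<close> it is polynomial in the parameter.\<close>

lemma relation_all_parameters:
  assumes p: "p \<in> fcar (gens d L)" and zero: "\<And>N. d \<le> N \<Longrightarrow> ev_t N 0 p = 0" and "d \<le> N"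
  shows "ev_t N c p = 0"
proof -
  have neg: "ev_t N (- of_nat M) p = 0" if "d \<le> N" for N M
    using that
  proof (induction M arbitrary: N)
    case 0
    then show ?case using zero by simp
  next
    case (Suc M)
    have "ev_t (Suc N) (- of_nat M) p = 0" using Suc by simp
    moreover have "- of_nat M - 1 = (- of_nat (Suc M) :: complex)" by simp
    ultimately have "- ev_t N (- of_nat (Suc M)) p \<in> Imod L (Suc N)"
      using ev_t_proj[OF p Suc.prems, of "- of_nat M"] by (simp only: diff_0)
    from Imod_uminus[OF this] have "ev_t N (- of_nat (Suc M)) p \<in> Imod L (Suc N)" by simp
    from Imod_Umod_app[OF this ev_t_Umod[OF p Suc.prems]] show ?case
      by (rule Umod_app_0[OF ev_t_Umod[OF p Suc.prems]])
  qed
  have "app (ev_t N c p) 1 = 0"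
    using poly_fun_zero[of "\<lambda>c. ev_t N c p" c] poly_fun_ev[of N p] neg[OF assms(3)]
    by (simp add: tgen_def app_simps)
  then show ?thesis by (rule Umod_app_0[OF ev_t_Umod[OF p assms(3)]])
qed

lemma Fmod_has_symbol: "Fmod L N n u \<Longrightarrow> \<exists>z. has_symbol n \<xi> u z"
proof (induction rule: Fmod.induct)
  case (Fmod_cst n c)
  then show ?case using has_symbol_cst has_symbol_less by (metis bot_nat_0.not_eq_extremum)
next
  case (Fmod_E i j \<alpha> n)
  then show ?case using has_symbol_E[of \<xi> "(i, j, \<alpha>)"] has_symbol_less[OF has_symbol_E[of \<xi> "(i, j, \<alpha>)"], of "Suc n"]
    by (cases n) auto
next
  case (Fmod_add n u v)
  then show ?case using has_symbol_add by blast
next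
  case (Fmod_mult n u m v k)
  then obtain a b where "has_symbol (n + m) \<xi> (u * v) (a * b)" using has_symbol_mult by blast
  then show ?case using has_symbol_less[of "n + m" \<xi> "u * v" "a * b" k] Fmod_mult.hyps(3)
    by (cases "n + m = k") auto
qed

lemma Fmod_top_coeff: "Fmod L N n u \<Longrightarrow> n < m \<Longrightarrow> top_coeff m \<xi> (app u 1) = 0"
  using Fmod_has_symbol has_symbol_less has_symbol_top by metis

lemma ev_fa_ev: "ua.ev g (fa.ev h p) = ua.ev (\<lambda>x. ua.ev g (h x)) p"
proof -
  have "ua.ev g (prod_list (map h xs)) = prod_list (map (\<lambda>x. ua.ev g (h x)) xs)" for xs
    by (induction xs) (auto simp: ua.ev_1 ua.ev_mult)
  then show ?thesis
    unfolding fa.ev_def ua.ev_sum fscale_def[symmetric] ua.ev_fscale by (simp add: ua.ev_def)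
qed

definition shift_poly :: "complex \<Rightarrow> triple falg \<Rightarrow> triple falg"
  where "shift_poly c = fa.ev (\<lambda>(i, j, w). \<Sum>(v, z)\<leftarrow>shift_word c w. fscale z (gen (i, j, v)))"

lemma ev_t_shift_poly: "ev_t N (b + c) p = ev_t N b (shift_poly c p)"
proof -
  have "ua.ev g (\<Sum>(v, z)\<leftarrow>xs. fscale z (gen (i, j, v))) = (\<Sum>(v, z)\<leftarrow>xs. cst z * g (i, j, v))"
    for g :: "triple \<Rightarrow> U" and xs and i j :: nat
    by (induction xs) (auto simp: ua.ev_0 ua.ev_add ua.ev_fscale ua.ev_gen)
  then have "tgen N (b + c) = (\<lambda>x. ev_t N b (case x of (i, j, w) \<Rightarrow> \<Sum>(v, z)\<leftarrow>shift_word c w. fscale z (gen (i, j, v))))"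
    by (auto simp: fun_eq_iff tgen_def tU_shift)
  then show ?thesis by (simp add: shift_poly_def ev_fa_ev)
qed

lemma shift_poly_fcar: "p \<in> fcar (gens d L) \<Longrightarrow> shift_poly c p \<in> fcar (gens d L)"
proof -
  assume p: "p \<in> fcar (gens d L)"
  let ?h = "\<lambda>(i, j, w). \<Sum>(v, z)\<leftarrow>shift_word c w. fscale z (gen (i, j, v))"
  have h: "?h x \<in> fcar (gens d L)" if x: "x \<in> gens d L" for x
  proof -
    obtain i j w where r: "x = (i, j, w)" "i \<in> {1..d}" "j \<in> {1..d}" "w \<noteq> []" "set w \<subseteq> {1..L}"
      using x by (rule gens_cases)
    have "(\<Sum>(v, z)\<leftarrow>xs. fscale z (gen (i, j, v))) \<in> fcar (gens d L)"
      if "\<And>v z. (v, z) \<in> set xs \<Longrightarrow> (i, j, v) \<in> gens d L" for xs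
      using that by (induction xs) (auto simp: fcar_0 intro!: fcar_add fcar_fscale fcar_gen[THEN iffD2])
    moreover have "(i, j, v) \<in> gens d L" if "(v, z) \<in> set (shift_word c w)" for v z
      using shift_word_props[OF that] r by (auto simp: gens_def words_def words0_def)
    ultimately show ?thesis unfolding r by simp
  qed
  have "set xs \<subseteq> gens d L \<Longrightarrow> prod_list (map ?h xs) \<in> fcar (gens d L)" for xs
  proof (induction xs)
    case (Cons x xs)
    then show ?case using h[of x] fcar_mult[of "?h x" "gens d L" "prod_list (map ?h xs)"] by simp
  qed (simp add: fcar_1)
  then show "shift_poly c p \<in> fcar (gens d L)"
    unfolding shift_poly_def fa.ev_def fscale_def[symmetric] using p
    by (intro fcar_sum fcar_fscale) (auto simp: fcar_def)
qed

section \<open>The projective limit\<close>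

lemma lim_index_eq: "d \<ge> 1 \<Longrightarrow> lim_index d = {d..}"
  by (simp add: lim_index_def max_absorb1)

lemma Alim_carrierD:
  assumes "x \<in> carrier (Alim d L)" "N \<in> lim_index d"
  shows "x N \<in> carrier (UgL L N)"
  using assms by (auto simp: Alim_def Alim_filt_def centr_def)

lemma Alim_eqI:
  assumes "x \<in> carrier (Alim d L)" "y \<in> carrier (Alim d L)"
    "\<And>N. N \<in> lim_index d \<Longrightarrow> model L N (x N) = model L N (y N)"
  shows "x = y"
proof (rule PiE_ext)
  show "x \<in> (\<Pi>\<^sub>E N\<in>lim_index d. centr d L N)" "y \<in> (\<Pi>\<^sub>E N\<in>lim_index d. centr d L N)"
    using assms(1,2) by (auto simp: Alim_def Alim_filt_def)
  show "x N = y N" if "N \<in> lim_index d" for N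
    using that assms Alim_carrierD model_inj by blast
qed

text \<open>The canonical homomorphism from the free algebra on the generators to the limit, for the parameter \<open>s\<close>.\<close>

definition Psi :: "nat \<Rightarrow> nat \<Rightarrow> complex \<Rightarrow> triple falg \<Rightarrow> lim_elem"
  where "Psi d L s p = (\<lambda>N\<in>lim_index d. unmodel L N (ev_t N (of_nat N + s) p))"

locale projective_limit =
  fixes d L :: nat and ord :: "triple rel"
  assumes d1: "d \<ge> 1" and lin: "linear_order_on (all_triples L) ord"
begin

abbreviation "G \<equiv> gens d L"
abbreviation "A \<equiv> Alim d L"
abbreviation "\<Psi> \<equiv> Psi d L"

lemma lim_index_iff: "N \<in> lim_index d \<longleftrightarrow> d \<le> N"
  using lim_index_eq[OF d1] by simp

lemma Psi_at:
  assumes "p \<in> fcar G" "d \<le> N"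
  shows "\<Psi> s p N \<in> carrier (UgL L N)" "model L N (\<Psi> s p N) = ev_t N (of_nat N + s) p"
  using unmodel[OF ev_t_Umod[OF assms]] assms(2) by (simp_all add: Psi_def lim_index_iff)

lemma Psi_filt:
  assumes p: "p \<in> fpol G tdeg n"
  shows "\<Psi> s p \<in> Alim_filt d L n"
proof -
  have c: "p \<in> fcar G" using p by (rule fpol_fcar)
  have "\<Psi> s p N \<in> centr d L N" if "N \<in> lim_index d" for N
    using that Psi_at[OF c] centralizes_ev_t[OF c] by (intro centralizes_centr) (auto simp: lim_index_iff)
  moreover have "centr_proj L N (\<Psi> s p N) = \<Psi> s p (N - 1)" if N: "N \<in> lim_index d" "N - 1 \<in> lim_index d" for N
  proof -
    obtain K where K: "N = Suc K" using N d1 by (cases N) (auto simp: lim_index_iff)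
    have dK: "d \<le> K" "d \<le> Suc K" using N K by (auto simp: lim_index_iff)
    have "of_nat (Suc K) + s - 1 = of_nat K + s" by simp
    then have "ev_t (Suc K) (of_nat (Suc K) + s) p - ev_t K (of_nat K + s) p \<in> Imod L (Suc K)"
      using ev_t_proj[OF c dK(1), of "of_nat (Suc K) + s"] by simp
    then have "centr_proj L (Suc K) (\<Psi> s p (Suc K)) = \<Psi> s p K"
      using Psi_at[OF c] dK centralizes_mono[OF centralizes_ev_t[OF c dK(2)] dK(1)] by (intro centr_proj_eq) auto
    then show ?thesis by (simp add: K)
  qed
  moreover have "\<Psi> s p N \<in> env_filt (gl L N) n" if "N \<in> lim_index d" for N
    using that Psi_at[OF c] Fmod_ev_t[OF p] by (subst env_filt_iff) (auto simp: lim_index_iff)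
  ultimately show ?thesis by (auto simp: Alim_filt_def Psi_def)
qed

lemma Psi_carrier: "p \<in> fcar G \<Longrightarrow> \<Psi> s p \<in> carrier A"
  using fcar_fpol[of p G tdeg] Psi_filt by (auto simp: Alim_def)

lemma Psi_eq_iff:
  assumes "p \<in> fcar G" "q \<in> fcar G"
  shows "\<Psi> s p = \<Psi> s' q \<longleftrightarrow> (\<forall>N\<ge>d. ev_t N (of_nat N + s) p = ev_t N (of_nat N + s') q)"
proof
  assume "\<Psi> s p = \<Psi> s' q"
  then show "\<forall>N\<ge>d. ev_t N (of_nat N + s) p = ev_t N (of_nat N + s') q"
    using Psi_at(2)[OF assms(1), of _ s] Psi_at(2)[OF assms(2), of _ s'] by metis
next
  assume "\<forall>N\<ge>d. ev_t N (of_nat N + s) p = ev_t N (of_nat N + s') q"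
  then show "\<Psi> s p = \<Psi> s' q" by (auto simp: Psi_def lim_index_iff intro!: restrict_ext)
qed

lemma Psi_mult:
  assumes "p \<in> fcar G" "q \<in> fcar G"
  shows "\<Psi> s p \<otimes>\<^bsub>A\<^esub> \<Psi> s q = \<Psi> s (p * q)"
proof -
  have "\<Psi> s p N \<otimes>\<^bsub>UgL L N\<^esub> \<Psi> s q N = \<Psi> s (p * q) N" if "d \<le> N" for N
    using Psi_at[OF assms(1) that, of s] Psi_at[OF assms(2) that, of s] Psi_at[OF fcar_mult[OF assms] that, of s]
    by (intro model_inj) (auto simp: model_mult ua.ev_mult ring.ring_simprules(5)[OF ring_UgL])
  then show ?thesis by (auto simp: Alim_def Psi_def[of d L s "p * q"] lim_index_iff intro!: restrict_ext)
qed

lemma Psi_add: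
  assumes "p \<in> fcar G" "q \<in> fcar G"
  shows "\<Psi> s p \<oplus>\<^bsub>A\<^esub> \<Psi> s q = \<Psi> s (p + q)"
proof -
  have "\<Psi> s p N \<oplus>\<^bsub>UgL L N\<^esub> \<Psi> s q N = \<Psi> s (p + q) N" if "d \<le> N" for N
    using Psi_at[OF assms(1) that, of s] Psi_at[OF assms(2) that, of s] Psi_at[OF fcar_add[OF assms] that, of s]
    by (intro model_inj) (auto simp: model_add ua.ev_add ring.ring_simprules(1)[OF ring_UgL])
  then show ?thesis by (auto simp: Alim_def Psi_def[of d L s "p + q"] lim_index_iff intro!: restrict_ext)
qed

lemma Psi_smult:
  assumes "p \<in> fcar G"
  shows "c \<odot>\<^bsub>A\<^esub> \<Psi> s p = \<Psi> s (fscale c p)"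
proof -
  have "c \<odot>\<^bsub>UgL L N\<^esub> \<Psi> s p N = \<Psi> s (fscale c p) N" if "d \<le> N" for N
    using Psi_at[OF assms(1) that, of s] Psi_at[OF fcar_fscale[OF assms] that, of s]
    by (intro model_inj) (auto simp: model_smult ua.ev_fscale UgL_smult_closed)
  then show ?thesis by (auto simp: Alim_def Psi_def[of d L s "fscale c p"] lim_index_iff intro!: restrict_ext)
qed

lemma Psi_one: "\<Psi> s 1 = \<one>\<^bsub>A\<^esub>"
proof -
  have "\<one>\<^bsub>UgL L N\<^esub> = \<Psi> s 1 N" if "d \<le> N" for N
    using Psi_at[OF fcar_1 that, of s] by (intro model_inj) (auto simp: model_one ua.ev_1 ring.ring_simprules(6)[OF ring_UgL])
  then show ?thesis by (auto simp: Alim_def Psi_def[of d L s 1] lim_index_iff intro!: restrict_ext)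
qed

lemma Psi_zero: "\<Psi> s 0 = \<zero>\<^bsub>A\<^esub>"
proof -
  have "\<zero>\<^bsub>UgL L N\<^esub> = \<Psi> s 0 N" if "d \<le> N" for N
    using Psi_at[OF fcar_0 that, of s] by (intro model_inj) (auto simp: model_zero ua.ev_0 ring.ring_simprules(2)[OF ring_UgL])
  then show ?thesis by (auto simp: Alim_def Psi_def[of d L s 0] lim_index_iff intro!: restrict_ext)
qed

lemma Psi_gen:
  assumes "x \<in> G"
  shows "\<Psi> s (gen x) = tlim d L s x"
proof -
  obtain i j w where x: "x = (i, j, w)" "i \<in> {1..d}" "j \<in> {1..d}" "w \<in> words0 L"
    using assms by (rule gens_cases)
  have "\<Psi> s (gen x) N = tN L N s x" if "d \<le> N" for N
  proof -
    have "i \<in> {1..N}" "j \<in> {1..N}" using x that by auto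
    then show ?thesis
      using tN_model[of i N j w L s] x(4) Psi_at[of "gen x" N s] assms that
      by (intro model_inj) (auto simp: x fcar_gen ua.ev_gen tgen_def)
  qed
  then show ?thesis by (auto simp: tlim_def Psi_def[of d L s "gen x"] lim_index_iff intro!: restrict_ext)
qed

lemma Psi_zero_iff: "p \<in> fcar G \<Longrightarrow> \<Psi> s p = \<zero>\<^bsub>A\<^esub> \<longleftrightarrow> (\<forall>N\<ge>d. ev_t N (of_nat N + s) p = 0)"
  unfolding Psi_zero[of s, symmetric] by (simp add: Psi_eq_iff fcar_0 ua.ev_0)

lemma Psi_inv:
  assumes p: "p \<in> fcar G"
  shows "inv\<^bsub>add_monoid A\<^esub> \<Psi> s p = \<Psi> s (- p)"
  unfolding m_inv_def
proof (rule the_equality)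
  show "\<Psi> s (- p) \<in> carrier (add_monoid A) \<and> \<Psi> s p \<otimes>\<^bsub>add_monoid A\<^esub> \<Psi> s (- p) = \<one>\<^bsub>add_monoid A\<^esub> \<and>
      \<Psi> s (- p) \<otimes>\<^bsub>add_monoid A\<^esub> \<Psi> s p = \<one>\<^bsub>add_monoid A\<^esub>"
    using p Psi_carrier[OF fcar_uminus[OF p]] by (simp add: Psi_add fcar_uminus Psi_zero)
  fix y assume y: "y \<in> carrier (add_monoid A) \<and> \<Psi> s p \<otimes>\<^bsub>add_monoid A\<^esub> y = \<one>\<^bsub>add_monoid A\<^esub> \<and>
      y \<otimes>\<^bsub>add_monoid A\<^esub> \<Psi> s p = \<one>\<^bsub>add_monoid A\<^esub>"
  then have yA: "y \<in> carrier A" by simp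
  show "y = \<Psi> s (- p)"
  proof (rule Alim_eqI[OF yA Psi_carrier[OF fcar_uminus[OF p]]])
    fix N assume N: "N \<in> lim_index d"
    then have dN: "d \<le> N" by (simp add: lim_index_iff)
    have "(\<Psi> s p \<oplus>\<^bsub>A\<^esub> y) N = \<zero>\<^bsub>A\<^esub> N" using y by simp
    then have "\<Psi> s p N \<oplus>\<^bsub>UgL L N\<^esub> y N = \<zero>\<^bsub>UgL L N\<^esub>" using N by (simp add: Alim_def)
    then have "model L N (\<Psi> s p N) + model L N (y N) = 0"
      using model_add[OF Psi_at(1)[OF p dN, of s] Alim_carrierD[OF yA N]] by (simp add: model_zero)
    from minus_unique[OF this] show "model L N (y N) = model L N (\<Psi> s (- p) N)"
      using Psi_at(2)[OF p dN, of s] Psi_at(2)[OF fcar_uminus[OF p] dN, of s]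
      by (simp add: ua.ev_uminus)
  qed
qed

lemma Psi_minus: "p \<in> fcar G \<Longrightarrow> q \<in> fcar G \<Longrightarrow> \<Psi> s p \<ominus>\<^bsub>A\<^esub> \<Psi> s q = \<Psi> s (p - q)"
  using Psi_add[OF _ fcar_uminus, of p q s] by (simp add: a_minus_def a_inv_def Psi_inv)

text \<open>All partial sums lie in the image of \<^const>\<open>Psi\<close>, where the addition is known, so the fold that defines
the sum can be evaluated there.\<close>

lemma Psi_finsum:
  assumes fin: "finite I" and f: "\<And>m. m \<in> I \<Longrightarrow> f m \<in> fcar G"
    and h: "\<And>m. m \<in> I \<Longrightarrow> h m = \<Psi> s (f m)"
  shows "finsum A h I = \<Psi> s (sum f I)"
proof -
  let ?g = "\<lambda>m y. h m \<oplus>\<^bsub>A\<^esub> y"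
  have det: "(J, y) \<in> foldSetD (carrier A) ?g \<zero>\<^bsub>A\<^esub> \<Longrightarrow> J \<subseteq> I \<Longrightarrow> y = \<Psi> s (sum f J)" for J y
  proof (induction J y rule: foldSetD.induct)
    case emptyI
    then show ?case by (simp add: Psi_zero)
  next
    case (insertI x J y)
    then have "finite J" "J \<subseteq> I" using foldSetD_imp_finite by auto
    then show ?case using insertI f by (simp add: h Psi_add fcar_sum subset_iff)
  qed
  have ex: "(J, \<Psi> s (sum f J)) \<in> foldSetD (carrier A) ?g \<zero>\<^bsub>A\<^esub>" if "finite J" "J \<subseteq> I" for J
    using that
  proof (induction J rule: finite_induct)
    case empty
    show ?case using Psi_carrier[OF fcar_0, of s] by (auto simp: Psi_zero intro: foldSetD.emptyI)
  next
    case (insert x J)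
    have e: "\<Psi> s (sum f (insert x J)) = ?g x (\<Psi> s (sum f J))"
      using insert f by (simp add: h Psi_add fcar_sum subset_iff)
    moreover have "\<Psi> s (sum f (insert x J)) \<in> carrier A"
      using insert f by (intro Psi_carrier fcar_sum) auto
    ultimately show ?case unfolding e using insert by (intro foldSetD.insertI) auto
  qed
  have "foldD (carrier A) ?g \<zero>\<^bsub>A\<^esub> I = \<Psi> s (sum f I)"
    unfolding foldD_def by (rule the_equality) (rule ex[OF fin subset_refl], rule det[OF _ subset_refl])
  then show ?thesis using fin by (simp add: finsum_def finprod_def comp_def)
qed

lemma Psi_shift: "p \<in> fcar G \<Longrightarrow> \<Psi> (s + c) p = \<Psi> s (shift_poly c p)"
  by (simp add: Psi_eq_iff shift_poly_fcar ev_t_shift_poly flip: add.assoc)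

lemma Psi_image: "\<Psi> s ` fcar G = \<Psi> s' ` fcar G"
proof -
  have "\<Psi> s ` fcar G \<subseteq> \<Psi> s' ` fcar G" for s s'
    using Psi_shift[of _ s' "s - s'"] shift_poly_fcar by fastforce
  then show ?thesis by blast
qed

lemma mon_eval_Psi: "set m \<subseteq> G \<Longrightarrow> mon_eval A (tlim d L s) m = \<Psi> s (fmono m)"
proof (induction m)
  case Nil
  then show ?case by (simp add: mon_eval_def fmono_Nil Psi_one)
next
  case (Cons x m)
  have "mon_eval A (tlim d L s) (x # m) = \<Psi> s (gen x) \<otimes>\<^bsub>A\<^esub> \<Psi> s (fmono m)"
    using Cons by (simp add: mon_eval_def Psi_gen)
  also have "\<dots> = \<Psi> s (fmono (x # m))"
    using Cons.prems by (simp add: Psi_mult fcar_fmono fmono_mult)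
  finally show ?case .
qed

lemma Y_carrier: "carrier (Yalg d L s) = \<Psi> s' ` fcar G"
proof -
  have "subalg_gen A (tlim d L s ` G) = \<Psi> s ` fcar G"
  proof
    have "subring (\<Psi> s ` fcar G) A"
    proof
      show "\<Psi> s ` fcar G \<subseteq> carrier (add_monoid A)" using Psi_carrier by auto
      show "\<Psi> s ` fcar G \<subseteq> carrier A" using Psi_carrier by auto
      show "\<one>\<^bsub>add_monoid A\<^esub> \<in> \<Psi> s ` fcar G" using imageI[OF fcar_0, of "\<Psi> s"] by (simp add: Psi_zero)
      show "\<one>\<^bsub>A\<^esub> \<in> \<Psi> s ` fcar G" using fcar_1 Psi_one[of s] by (metis imageI)
    qed (auto simp: Psi_add Psi_mult Psi_inv intro!: imageI fcar_add fcar_mult fcar_uminus)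
    moreover have "\<forall>c. \<forall>x\<in>\<Psi> s ` fcar G. c \<odot>\<^bsub>A\<^esub> x \<in> \<Psi> s ` fcar G"
      by (auto simp: Psi_smult intro!: imageI fcar_fscale)
    moreover have "tlim d L s ` G \<subseteq> \<Psi> s ` fcar G"
      using Psi_gen[of _ s] fcar_gen by (metis image_subsetI imageI)
    ultimately show "subalg_gen A (tlim d L s ` G) \<subseteq> \<Psi> s ` fcar G"
      unfolding subalg_gen_def by blast
    show "\<Psi> s ` fcar G \<subseteq> subalg_gen A (tlim d L s ` G)"
      unfolding subalg_gen_def
    proof (rule Inter_greatest, clarify)
      fix B p assume B: "subring B A" "\<forall>c. \<forall>x\<in>B. c \<odot>\<^bsub>A\<^esub> x \<in> B" "tlim d L s ` G \<subseteq> B" and p: "p \<in> fcar G"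
      interpret subring B A by fact
      have w: "set m \<subseteq> G \<Longrightarrow> \<Psi> s (fmono m) \<in> B" for m
      proof (induction m)
        case Nil
        then show ?case using one_closed submonoid.one_closed[OF submonoid_axioms] by (simp add: fmono_Nil Psi_one)
      next
        case (Cons x m)
        have "\<Psi> s (gen x) \<otimes>\<^bsub>A\<^esub> \<Psi> s (fmono m) \<in> B"
          using Cons B(3) by (intro submonoid.m_closed[OF submonoid_axioms]) (auto simp: Psi_gen)
        then show ?case using Cons.prems by (simp add: Psi_mult fcar_fmono fmono_mult)
      qed
      have "finite J \<Longrightarrow> J \<subseteq> ks p \<Longrightarrow> \<Psi> s (\<Sum>m\<in>J. fscale (lk p m) (fmono (letters m))) \<in> B" for J
      proof (induction J rule: finite_induct)
        case empty
        show ?case using subgroup.one_closed[OF subgroup_axioms] by (simp add: Psi_zero)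
      next
        case (insert m J)
        have fm: "fmono (letters m) \<in> fcar G" if "m \<in> ks p" for m
          using that p unfolding fcar_fmono by (auto simp: fcar_def)
        have "c \<odot>\<^bsub>A\<^esub> \<Psi> s (fmono (letters m)) \<in> B" for c
          using B(2) w[of "letters m"] insert.prems p by (auto simp: fcar_def)
        then have "\<Psi> s (fscale (lk p m) (fmono (letters m))) \<oplus>\<^bsub>A\<^esub> \<Psi> s (\<Sum>m\<in>J. fscale (lk p m) (fmono (letters m))) \<in> B"
          using subgroup.m_closed[OF subgroup_axioms] insert fm by (simp add: Psi_smult)
        then show ?case using insert fm by (simp add: Psi_add fcar_sum fcar_fscale subset_iff)
      qed
      from this[of "ks p"] show "\<Psi> s p \<in> B" by (simp flip: falg_expand)
    qed
  qed
  then show ?thesis using Psi_image[of s s'] by (simp add: Yalg_def)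
qed

subsection \<open>Independence of normal monomials\<close>

lemma ord_tot: "x \<in> G \<Longrightarrow> y \<in> G \<Longrightarrow> (x, y) \<in> ord \<or> (y, x) \<in> ord"
proof -
  assume "x \<in> G" "y \<in> G"
  then have "x \<in> all_triples L" "y \<in> all_triples L" by (auto simp: gens_def all_triples_def)
  then show ?thesis
    using lin unfolding linear_order_on_def partial_order_on_def preorder_on_def total_on_def refl_on_def by metis
qed
lemma ord_trans: "(x, y) \<in> ord \<Longrightarrow> (y, z) \<in> ord \<Longrightarrow> (x, z) \<in> ord"
  using lin unfolding linear_order_on_def partial_order_on_def preorder_on_def trans_def by blast
lemma ord_antisym: "(x, y) \<in> ord \<Longrightarrow> (y, x) \<in> ord \<Longrightarrow> x = y"
  using lin unfolding linear_order_on_def partial_order_on_def antisym_def by blast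

abbreviation "sorted_poly q \<equiv> (\<forall>m\<in>ks q. sorted_wrt (\<lambda>x y. (x, y) \<in> ord) (letters m))"

text \<open>For \<open>N\<close> large enough the graph has room for all excursions along words of length at most the degree of
\<open>q\<close>, so the symbols of the generators in \<open>q\<close> take arbitrary values.\<close>

lemma normal_independent:
  assumes q: "q \<in> fcar G" "sorted_poly q"
    and m0: "m0 \<in> ks q" and le: "\<And>m. m \<in> ks q \<Longrightarrow> sum_list (map tdeg (letters m)) \<le> sum_list (map tdeg (letters m0))"
  shows "\<exists>N\<ge>d. \<exists>\<xi>. top_coeff (sum_list (map tdeg (letters m0))) \<xi> (app (ev_t N (c N) q) 1) \<noteq> 0"
proof (rule ccontr)
  let ?n = "sum_list (map tdeg (letters m0))"
  assume H: "\<not> ?thesis"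
  have lets: "set (letters m) \<subseteq> G" if "m \<in> ks q" for m using that q(1) by (auto simp: fcar_def)
  obtain N where N: "d \<le> N" "\<And>j v. (j, v) \<in> verts d L ?n \<Longrightarrow> vertex d j v \<in> {1..N}"
  proof -
    let ?S = "(\<lambda>(j, v). vertex d j v) ` verts d L ?n"
    have fin: "finite ?S" using finite_verts by blast
    have "vertex d j v \<in> {1..Max (insert d ?S)}" if "(j, v) \<in> verts d L ?n" for j v
    proof -
      have "vertex d j v \<in> ?S" using that by (rule image_eqI[rotated]) simp
      then have "vertex d j v \<le> Max (insert d ?S)" using fin by (intro Max_ge) auto
      moreover have "1 \<le> vertex d j v" using that by (auto simp: vertex_def verts_def)
      ultimately show ?thesis by simp
    qed
    moreover have "d \<le> Max (insert d ?S)" using fin by (intro Max_ge) auto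
    ultimately show ?thesis using that by blast
  qed
  show False
  proof (rule symbols_independent[of q tdeg ?n m0])
    show "inj_on (\<lambda>m. mset (letters m)) (ks q)"
    proof (rule inj_onI)
      fix a b assume ab: "a \<in> ks q" "b \<in> ks q" "mset (letters a) = mset (letters b)"
      have "letters a = letters b"
      proof (rule sorted_wrt_unique[of G "\<lambda>x y. (x, y) \<in> ord"])
        show "x = y" if "(x, y) \<in> ord" "(y, x) \<in> ord" for x y using that by (rule ord_antisym)
      qed (use lets[OF ab(1)] q(2) ab in auto)
      then show "a = b" by (metis fmon.exhaust_sel)
    qed
    fix y :: "triple \<Rightarrow> complex"
    have sym: "has_symbol (tdeg x) (path_point d L ?n y) (tgen N (c N) x) (y x)" if m: "m \<in> ks q" and x: "x \<in> set (letters m)" for m x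
    proof -
      have "x \<in> G" using lets m x by blast
      then obtain i j w where r: "x = (i, j, w)" "i \<in> {1..d}" "j \<in> {1..d}" "w \<noteq> []" "set w \<subseteq> {1..L}"
        by (rule gens_cases)
      have "tdeg x \<le> sum_list (map tdeg (letters m))" using x by (simp add: member_le_sum_list)
      then have "length w \<le> ?n" using le[OF m] by (simp add: r tdeg_def)
      then have "path_sym N (path_point d L ?n y) i j w = y (i, j, w)" using N(2) r by (intro path_sym_path_point) auto
      then show ?thesis using has_symbol_tU[of w "path_point d L ?n y" N "c N" i j] by (simp add: r tdeg_def tgen_def)
    qed
    have "top_coeff ?n (path_point d L ?n y) (app (ev_t N (c N) q) 1) = 0" using H N(1) by blast
    then show "\<exists>h \<xi>. (\<forall>m\<in>ks q. \<forall>x\<in>set (letters m). has_symbol (tdeg x) \<xi> (h x) (y x)) \<and> top_coeff ?n \<xi> (app (ua.ev h q) 1) = 0"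
      using sym by blast
  qed (use m0 le in auto)
qed

lemma max_degree:
  assumes "q \<noteq> (0 :: triple falg)"
  obtains m0 where "m0 \<in> ks q" "\<And>m. m \<in> ks q \<Longrightarrow> sum_list (map tdeg (letters m)) \<le> sum_list (map tdeg (letters m0))"
proof -
  let ?l = "\<lambda>m. sum_list (map tdeg (letters m))"
  have ne: "ks q \<noteq> {}" using assms by (metis ex_in_conv in_keys_iff lookup_zero poly_mapping_eqI)
  then have "Max (?l ` ks q) \<in> ?l ` ks q" by (intro Max_in) auto
  then obtain m0 where "m0 \<in> ks q" "?l m0 = Max (?l ` ks q)" by auto
  moreover have "?l m \<le> Max (?l ` ks q)" if "m \<in> ks q" for m using that by (intro Max_ge) auto
  ultimately show ?thesis using that by metis
qed

lemma normal_zero: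
  assumes "q \<in> fcar G" "sorted_poly q" "\<And>N. d \<le> N \<Longrightarrow> ev_t N (c N) q = 0"
  shows "q = 0"
proof (rule ccontr)
  assume "q \<noteq> 0"
  then obtain m0 where m0: "m0 \<in> ks q" "\<And>m. m \<in> ks q \<Longrightarrow> sum_list (map tdeg (letters m)) \<le> sum_list (map tdeg (letters m0))"
    by (rule max_degree) blast
  from normal_independent[OF assms(1,2) m0, of c] show False using assms(3) by (auto simp: app_simps top_0)
qed

text \<open>Otherwise the leading part of \<open>q\<close>, of degree greater than \<open>n\<close>, would have to vanish for all \<open>N\<close>.\<close>

lemma normal_filtration:
  assumes "q \<in> fcar G" "sorted_poly q" "\<Psi> s q \<in> Alim_filt d L n"
  shows "q \<in> fpol G tdeg n"
proof (cases "q = 0")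
  case True
  then show ?thesis by (simp add: fpol_0)
next
  case False
  then obtain m0 where m0: "m0 \<in> ks q" "\<And>m. m \<in> ks q \<Longrightarrow> sum_list (map tdeg (letters m)) \<le> sum_list (map tdeg (letters m0))"
    by (rule max_degree) blast
  let ?n = "sum_list (map tdeg (letters m0))"
  obtain N \<xi> where N: "d \<le> N" "top_coeff ?n \<xi> (app (ev_t N (of_nat N + s) q) 1) \<noteq> 0"
    using normal_independent[OF assms(1,2) m0, of "\<lambda>N. of_nat N + s"] by blast
  have "\<Psi> s q N \<in> env_filt (gl L N) n" using assms(3) N(1) by (simp add: Alim_filt_def lim_index_iff)
  then have "Fmod L N n (ev_t N (of_nat N + s) q)"
    using Psi_at[OF assms(1) N(1), of s] by (simp add: env_filt_iff)
  then have "?n \<le> n" using Fmod_top_coeff N(2) by (meson not_le)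
  then show ?thesis using assms(1) m0(2) by (fastforce simp: fpol_def fcar_def)
qed

subsection \<open>The relations\<close>

definition rhs :: "(triple list \<Rightarrow>\<^sub>0 int) \<Rightarrow> triple falg"
  where "rhs r = (\<Sum>m\<in>ks r. fscale (of_int (lk r m)) (fmono m))"

lemma lookup_rhs: "lk (rhs r) (Mon m) = of_int (lk r m)"
  unfolding rhs_def
  by (auto simp: fscale_fmono lookup_sum lookup_single when_def in_keys_iff)

lemma keys_rhs: "ks (rhs r) \<subseteq> Mon ` ks r"
proof
  fix m assume "m \<in> ks (rhs r)"
  then have "lk (rhs r) (Mon (letters m)) \<noteq> 0" by (simp add: in_keys_iff)
  then have "letters m \<in> ks r" unfolding lookup_rhs by (auto simp: in_keys_iff)
  then show "m \<in> Mon ` ks r" by (metis fmon.collapse imageI)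
qed

lemma allowed_props:
  assumes "x \<in> G" "y \<in> G" "m \<in> allowed_monomials L ord x y"
  shows "set m \<subseteq> G" "sorted_wrt (\<lambda>x y. (x, y) \<in> ord) m" "sum_list (map tdeg m) \<le> tdeg x + tdeg y - 1"
proof -
  obtain i j w where x: "x = (i, j, w)" "i \<in> {1..d}" "j \<in> {1..d}" using assms(1) by (rule gens_cases)
  obtain k l w' where y: "y = (k, l, w')" "k \<in> {1..d}" "l \<in> {1..d}" using assms(2) by (rule gens_cases)
  have np: "set (normal_pair ord a b) = {a, b}" for a b by (auto simp: normal_pair_def)
  have ns: "sorted_wrt (\<lambda>x y. (x, y) \<in> ord) (normal_pair ord a b)" if "a \<in> G" "b \<in> G" for a b
    using ord_tot[OF that] by (auto simp: normal_pair_def)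
  have mem: "(a, b, z) \<in> G" if "a \<in> {1..d}" "b \<in> {1..d}" "z \<in> words L" for a b z
    using that by (auto simp: gens_def)
  have m: "m \<in> allowed_upto L ord i j k l (length w + length w' - 1)"
    using assms(3) unfolding x y allowed_upto_allowed .
  then show "sum_list (map tdeg m) \<le> tdeg x + tdeg y - 1"
    by (simp add: allowed_upto_def mon_degree_tdeg) (simp add: x y tdeg_def)
  from m consider z where "z \<in> words L" "m = [(i, j, z)] \<or> m = [(k, l, z)] \<or> m = [(i, l, z)] \<or> m = [(k, j, z)]"
    | z z' where "z \<in> words L" "z' \<in> words L" "m = normal_pair ord (i, j, z) (k, l, z') \<or> m = normal_pair ord (i, l, z) (k, j, z')"
    unfolding allowed_upto_def by blast
  then have "set m \<subseteq> G \<and> sorted_wrt (\<lambda>x y. (x, y) \<in> ord) m"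
    using x(2,3) y(2,3) mem by cases (auto simp: np simp del: atLeastAtMost_iff intro!: ns)
  then show "set m \<subseteq> G" "sorted_wrt (\<lambda>x y. (x, y) \<in> ord) m" by auto
qed

definition rel :: "triple \<Rightarrow> triple \<Rightarrow> (triple list \<Rightarrow>\<^sub>0 int) \<Rightarrow> triple falg"
  where "rel x y r = gen x * gen y - gen y * gen x - rhs r"

lemma rhs_fpol:
  assumes "x \<in> G" "y \<in> G" "ks r \<subseteq> allowed_monomials L ord x y"
  shows "rhs r \<in> fpol G tdeg (tdeg x + tdeg y - 1)" "sorted_poly (rhs r)"
proof -
  have "set (letters m) \<subseteq> G \<and> sorted_wrt (\<lambda>x y. (x, y) \<in> ord) (letters m) \<and> sum_list (map tdeg (letters m)) \<le> tdeg x + tdeg y - 1"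
    if "m \<in> ks (rhs r)" for m
  proof -
    have "m \<in> Mon ` ks r" using keys_rhs that by (rule subsetD)
    then obtain l where "m = Mon l" "l \<in> ks r" by (rule imageE)
    then show ?thesis using allowed_props[OF assms(1,2), of l] assms(3) by auto
  qed
  then show "rhs r \<in> fpol G tdeg (tdeg x + tdeg y - 1)" "sorted_poly (rhs r)"
    unfolding fpol_def by blast+
qed

lemma rel_fcar:
  assumes "x \<in> G" "y \<in> G" "ks r \<subseteq> allowed_monomials L ord x y"
  shows "rel x y r \<in> fcar G"
  unfolding rel_def using fpol_fcar[OF rhs_fpol(1)[OF assms]] assms(1,2)
  by (intro fcar_diff fcar_mult) (auto simp: fcar_gen)

lemma is_comm_relation_iff:
  assumes x: "x \<in> G" and y: "y \<in> G"
  shows "is_comm_relation d L ord x y r \<longleftrightarrow>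
    ks r \<subseteq> allowed_monomials L ord x y \<and> (\<forall>s. \<Psi> s (rel x y r) = \<zero>\<^bsub>A\<^esub>)"
proof -
  have "(tlim d L s x \<otimes>\<^bsub>A\<^esub> tlim d L s y \<ominus>\<^bsub>A\<^esub> tlim d L s y \<otimes>\<^bsub>A\<^esub> tlim d L s x =
      (\<Oplus>\<^bsub>A\<^esub>m\<in>ks r. of_int (lk r m) \<odot>\<^bsub>A\<^esub> mon_eval A (tlim d L s) m)) \<longleftrightarrow> \<Psi> s (rel x y r) = \<zero>\<^bsub>A\<^esub>"
    if r: "ks r \<subseteq> allowed_monomials L ord x y" for s
  proof -
    have g: "gen x \<in> fcar G" "gen y \<in> fcar G" using x y by (simp_all add: fcar_gen)
    have rc: "rhs r \<in> fcar G" using fpol_fcar[OF rhs_fpol(1)[OF x y r]] .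
    have fm: "fmono m \<in> fcar G" if "m \<in> ks r" for m
      using that r allowed_props(1)[OF x y] by (auto simp: fcar_fmono)
    have "tlim d L s x \<otimes>\<^bsub>A\<^esub> tlim d L s y \<ominus>\<^bsub>A\<^esub> tlim d L s y \<otimes>\<^bsub>A\<^esub> tlim d L s x = \<Psi> s (gen x * gen y - gen y * gen x)"
      using g fcar_mult[OF g] fcar_mult[OF g(2,1)] by (simp add: Psi_mult Psi_minus flip: Psi_gen[OF x] Psi_gen[OF y])
    moreover have "(\<Oplus>\<^bsub>A\<^esub>m\<in>ks r. of_int (lk r m) \<odot>\<^bsub>A\<^esub> mon_eval A (tlim d L s) m) = \<Psi> s (rhs r)"
    proof -
      have e: "of_int (lk r m) \<odot>\<^bsub>A\<^esub> mon_eval A (tlim d L s) m = \<Psi> s (fscale (of_int (lk r m)) (fmono m))" if "m \<in> ks r" for m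
        using mon_eval_Psi[of m s] fm[OF that] by (simp add: fcar_fmono Psi_smult)
      show ?thesis
        unfolding rhs_def using fm e by (intro Psi_finsum fcar_fscale) auto
    qed
    moreover have "gen x * gen y - gen y * gen x \<in> fcar G" using g by (intro fcar_diff fcar_mult)
    ultimately show ?thesis
      using rc by (simp add: Psi_eq_iff Psi_zero_iff rel_def fcar_diff ua.ev_diff)
  qed
  then show ?thesis unfolding is_comm_relation_def by blast
qed

text \<open>The relation found for the parameter \<open>N + s = 0\<close> extends to all parameters.\<close>

lemma gens_commute:
  assumes x: "x \<in> G" and y: "y \<in> G"
  shows "\<exists>r. is_comm_relation d L ord x y r"
proof -
  obtain r where r: "ks r \<subseteq> allowed_monomials L ord x y"
    "\<And>N. N \<ge> d \<Longrightarrow> tgen N 0 x * tgen N 0 y - tgen N 0 y * tgen N 0 x = eval_rhs N r"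
    using commutator_normal_form[OF x y] by metis
  have of_int: "cst (of_int z) = of_int z" for z
    by (cases z) (simp_all add: ua.cst_of_nat ua.cst_uminus ua.cst_diff ua.cst_1)
  have "ev_t N 0 (rhs r) = eval_rhs N r" for N
    by (simp add: rhs_def eval_rhs_def ua.ev_sum ua.ev_fscale ua.ev_fmono of_int)
  then have "ev_t N 0 (rel x y r) = 0" if "d \<le> N" for N
    using r(2)[OF that] by (simp add: rel_def ua.ev_diff ua.ev_mult ua.ev_gen)
  then have "\<Psi> s (rel x y r) = \<zero>\<^bsub>A\<^esub>" for s
    using relation_all_parameters[OF rel_fcar[OF x y r(1)]] rel_fcar[OF x y r(1)] by (simp add: Psi_zero_iff)
  then show ?thesis using r(1) is_comm_relation_iff[OF x y] by blast
qed

lemma is_comm_relation_unique: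
  assumes x: "x \<in> G" and y: "y \<in> G"
    and r: "is_comm_relation d L ord x y r" and r': "is_comm_relation d L ord x y r'"
  shows "r = r'"
proof -
  have k: "ks r \<subseteq> allowed_monomials L ord x y" "ks r' \<subseteq> allowed_monomials L ord x y"
    and z: "\<Psi> 0 (rel x y r) = \<zero>\<^bsub>A\<^esub>" "\<Psi> 0 (rel x y r') = \<zero>\<^bsub>A\<^esub>"
    using r r' is_comm_relation_iff[OF x y] by auto
  let ?q = "rhs r - rhs r'"
  have sub: "ks ?q \<subseteq> ks (rhs r) \<union> ks (rhs r')" by (rule Poly_Mapping.keys_diff)
  have "?q = 0"
  proof (rule normal_zero)
    show "?q \<in> fcar G" by (intro fcar_diff fpol_fcar[OF rhs_fpol(1)[OF x y]] k)
    show "sorted_poly ?q" using rhs_fpol(2)[OF x y k(1)] rhs_fpol(2)[OF x y k(2)] sub by (meson UnE subsetD)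
    show "ev_t N (of_nat N + 0) ?q = 0" if "d \<le> N" for N
    proof -
      have "ev_t N (of_nat N + 0) (rel x y r) = 0" "ev_t N (of_nat N + 0) (rel x y r') = 0"
        using z that rel_fcar[OF x y] k Psi_zero_iff by blast+
      then show ?thesis by (simp add: rel_def ua.ev_diff)
    qed
  qed
  then have "lk (rhs r) (Mon m) = lk (rhs r') (Mon m)" for m by simp
  then have "lk r m = lk r' m" for m by (simp add: lookup_rhs)
  then show ?thesis by (simp add: poly_mapping_eqI)
qed

abbreviation "rels \<equiv> comm_relations d L ord"
abbreviation "K \<equiv> Idl\<^bsub>free_alg G\<^esub> rels"

lemma rels_eq: "rels = {rel x y r | x y r. x \<in> G \<and> y \<in> G \<and> is_comm_relation d L ord x y r}"
  by (simp add: comm_relations_def rel_def rhs_def)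

lemma rels_fcar: "rels \<subseteq> fcar G"
  unfolding rels_eq using rel_fcar is_comm_relation_iff by blast

lemmas K_ideal = genideal_free_alg[OF rels_fcar]
lemmas KD = ideal_free_algD[OF K_ideal(1)]

lemma reorder_Y: "reorder G tdeg ord K"
proof
  fix x y assume x: "x \<in> G" and y: "y \<in> G"
  show "(x, y) \<in> ord \<or> (y, x) \<in> ord" by (rule ord_tot[OF x y])
  obtain r where r: "is_comm_relation d L ord x y r" using gens_commute[OF x y] by blast
  then have "rel x y r \<in> K" using K_ideal(2) x y unfolding rels_eq by blast
  moreover have "rhs r \<in> fpol G tdeg (tdeg x + tdeg y - 1)"
    using rhs_fpol(1)[OF x y] r is_comm_relation_iff[OF x y] by blast
  ultimately show "\<exists>q\<in>fpol G tdeg (tdeg x + tdeg y - 1). gen x * gen y - gen y * gen x - q \<in> K"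
    unfolding rel_def by blast
next
  fix x assume "x \<in> G"
  then show "1 \<le> tdeg x" by (rule gens_cases) (simp add: tdeg_def Suc_le_eq)
next
  fix x y z assume "(x, y) \<in> ord" "(y, z) \<in> ord" then show "(x, z) \<in> ord" by (rule ord_trans)
next
  fix x y assume "(x, y) \<in> ord" "(y, x) \<in> ord" then show "x = y" by (rule ord_antisym)
qed (fact KD)+

definition ker :: "complex \<Rightarrow> triple falg set"
  where "ker s = {p \<in> fcar G. \<Psi> s p = \<zero>\<^bsub>A\<^esub>}"

lemma ker_ideal: "ideal (ker s) (free_alg G)"
  by (rule ideal_free_algI)
    (auto simp: ker_def Psi_zero_iff fcar_0 fcar_add fcar_uminus fcar_mult ua.ev_0 ua.ev_add ua.ev_uminus ua.ev_mult)

lemma K_sub_ker: "K \<subseteq> ker s"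
  using rel_fcar is_comm_relation_iff by (intro K_ideal(3) ker_ideal) (fastforce simp: rels_eq ker_def)

lemma normal_form:
  assumes "p \<in> fcar G"
  obtains q where "q \<in> fcar G" "sorted_poly q" "p - q \<in> K"
proof -
  obtain n where "p \<in> fpol G tdeg n" using fcar_fpol[OF assms] by blast
  from reorder.reorder[OF reorder_Y this] show ?thesis using that fpol_fcar by blast
qed

text \<open>Modulo \<open>K\<close> an element of the kernel is a combination of normal monomials that vanishes in the limit.\<close>

lemma ker_eq: "ker s = K"
proof
  show "ker s \<subseteq> K"
  proof
    fix p assume p: "p \<in> ker s"
    then have "p \<in> fcar G" by (simp add: ker_def)
    then obtain q where q: "q \<in> fcar G" "sorted_poly q" "p - q \<in> K" by (rule normal_form)
    have "p - q \<in> ker s" using q(3) K_sub_ker by blast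
    then have "ev_t N (of_nat N + s) q = 0" if "d \<le> N" for N
      using that p q(1) by (auto simp: ker_def Psi_zero_iff fcar_diff ua.ev_diff)
    then have "q = 0" by (rule normal_zero[OF q(1,2)])
    then show "p \<in> K" using q(3) by simp
  qed
qed (rule K_sub_ker)

lemma Psi_eq_iff_K:
  assumes "p \<in> fcar G" "q \<in> fcar G"
  shows "\<Psi> s p = \<Psi> s q \<longleftrightarrow> p - q \<in> K"
  unfolding ker_eq[of s, symmetric]
  using assms by (auto simp: ker_def Psi_zero_iff Psi_eq_iff fcar_diff ua.ev_diff)

lemma Y_simps:
  "monoid.mult (Yalg d L s) = monoid.mult A" "one (Yalg d L s) = one A"
  "ring.zero (Yalg d L s) = ring.zero A" "ring.add (Yalg d L s) = ring.add A" "smult (Yalg d L s) = smult A"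
  by (simp_all add: Yalg_def)

lemma Y_defining: "defining_relations (Yalg d L s0) G (tlim d L s) rels"
  unfolding defining_relations_def
proof (intro conjI bexI)
  show "rels \<subseteq> carrier (free_alg G)" using rels_fcar by (simp add: free_alg_simps)
  show "\<forall>x\<in>G. \<Psi> s (gen x) = tlim d L s x" using Psi_gen by blast
  show "\<Psi> s ` carrier (free_alg G) = carrier (Yalg d L s0)"
    using Y_carrier[of s0 s] by (simp add: free_alg_simps)
  show "a_kernel (free_alg G) (Yalg d L s0) (\<Psi> s) = K"
    unfolding ker_eq[of s, symmetric] by (simp add: a_kernel_def kernel_def ker_def free_alg_simps Y_simps)
  show "\<Psi> s \<in> alg_hom (free_alg G) (Yalg d L s0)"
    using Y_carrier[of s0 s] Psi_mult Psi_add Psi_smult Psi_one[of s]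
    by (auto simp: alg_hom_def ring_hom_def free_alg_simps Y_simps)
qed

subsection \<open>The shift automorphisms\<close>

text \<open>The choice of the preimage does not matter because the kernel of \<open>\<Psi> s\<close> is the same for all \<open>s\<close>.\<close>

definition Shift :: "complex \<Rightarrow> lim_elem \<Rightarrow> lim_elem"
  where "Shift c = (\<lambda>y\<in>\<Psi> 0 ` fcar G. \<Psi> c (SOME p. p \<in> fcar G \<and> \<Psi> 0 p = y))"

lemma Shift_Psi:
  assumes p: "p \<in> fcar G"
  shows "Shift c (\<Psi> s p) = \<Psi> (s + c) p"
proof -
  have p': "shift_poly s p \<in> fcar G" using p by (rule shift_poly_fcar)
  have e: "\<Psi> s p = \<Psi> 0 (shift_poly s p)" using Psi_shift[OF p, of 0 s] by simp
  let ?q = "SOME q. q \<in> fcar G \<and> \<Psi> 0 q = \<Psi> s p"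
  have q: "?q \<in> fcar G \<and> \<Psi> 0 ?q = \<Psi> s p"
    by (rule someI[of _ "shift_poly s p"]) (use p' e in simp)
  then have "?q - shift_poly s p \<in> K" using Psi_eq_iff_K[of ?q "shift_poly s p" 0] p' e by simp
  then have "\<Psi> c ?q = \<Psi> c (shift_poly s p)" using Psi_eq_iff_K[of ?q "shift_poly s p" c] q p' by simp
  also have "\<dots> = \<Psi> (c + s) p" using Psi_shift[OF p, of c s] by simp
  finally show ?thesis using e p' by (simp add: Shift_def add.commute)
qed

lemma Y_obtain:
  assumes "y \<in> carrier (Yalg d L s0)"
  obtains p where "p \<in> fcar G" "y = \<Psi> 0 p"
  using assms Y_carrier[of s0 0] by auto

lemma Shift_add: "y \<in> carrier (Yalg d L s0) \<Longrightarrow> Shift c (Shift c' y) = Shift (c + c') y"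
  by (erule Y_obtain) (simp add: Shift_Psi add.commute)

lemma Shift_0: "y \<in> carrier (Yalg d L s0) \<Longrightarrow> Shift 0 y = y"
  by (erule Y_obtain) (simp add: Shift_Psi)

lemma Shift_closed: "y \<in> carrier (Yalg d L s0) \<Longrightarrow> Shift c y \<in> carrier (Yalg d L s0)"
  by (erule Y_obtain) (use Y_carrier[of s0 c] in \<open>simp add: Shift_Psi\<close>)

lemma Shift_bij: "bij_betw (Shift c) (carrier (Yalg d L s0)) (carrier (Yalg d L s0))"
  by (rule bij_betw_byWitness[of _ "Shift (- c)"])
    (auto simp: Shift_add Shift_0 Shift_closed)

lemma Shift_aut: "Shift c \<in> alg_aut (Yalg d L s0)"
proof -
  have "Shift c (x \<otimes>\<^bsub>A\<^esub> y) = Shift c x \<otimes>\<^bsub>A\<^esub> Shift c y" "Shift c (x \<oplus>\<^bsub>A\<^esub> y) = Shift c x \<oplus>\<^bsub>A\<^esub> Shift c y"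
    if xy: "x \<in> carrier (Yalg d L s0)" "y \<in> carrier (Yalg d L s0)" for x y
  proof -
    obtain p where p: "p \<in> fcar G" "x = \<Psi> 0 p" using xy(1) by (rule Y_obtain)
    obtain q where q: "q \<in> fcar G" "y = \<Psi> 0 q" using xy(2) by (rule Y_obtain)
    show "Shift c (x \<otimes>\<^bsub>A\<^esub> y) = Shift c x \<otimes>\<^bsub>A\<^esub> Shift c y" "Shift c (x \<oplus>\<^bsub>A\<^esub> y) = Shift c x \<oplus>\<^bsub>A\<^esub> Shift c y"
      using p q by (simp_all add: Psi_mult Psi_add Shift_Psi fcar_mult fcar_add)
  qed
  moreover have "Shift c (a \<odot>\<^bsub>A\<^esub> x) = a \<odot>\<^bsub>A\<^esub> Shift c x" if "x \<in> carrier (Yalg d L s0)" for a x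
    using that by (rule Y_obtain) (simp add: Psi_smult Shift_Psi fcar_fscale)
  moreover have "Shift c \<one>\<^bsub>A\<^esub> = \<one>\<^bsub>A\<^esub>"
    using Shift_Psi[OF fcar_1, of c 0] by (simp add: Psi_one)
  ultimately show ?thesis
    using Shift_bij Shift_closed by (auto simp: alg_aut_def alg_hom_def ring_hom_def Y_simps)
qed

lemma Shift_action: "group_action additive_C (carrier (Yalg d L s0)) Shift"
proof -
  let ?Y = "carrier (Yalg d L s0)"
  have "group additive_C"
    by (rule groupI) (auto simp: additive_C_def add.assoc intro: exI[of _ "- _"])
  moreover have bij: "Shift c \<in> Bij ?Y" for c
    using Shift_bij[of c s0] Y_carrier[of s0 0] by (auto simp: Bij_def Shift_def)
  moreover have "Shift (c + c') = compose ?Y (Shift c) (Shift c')" for c c'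
  proof
    fix y
    show "Shift (c + c') y = compose ?Y (Shift c) (Shift c') y"
    proof (cases "y \<in> ?Y")
      case True
      then show ?thesis by (simp add: compose_def Shift_add)
    next
      case False
      then show ?thesis using Y_carrier[of s0 0] by (simp add: compose_def Shift_def)
    qed
  qed
  ultimately show ?thesis
    unfolding group_action_def group_hom_def group_hom_axioms_def hom_def
    using group_BijGroup[of ?Y] by (auto simp: BijGroup_def additive_C_def)
qed

text \<open>An element of degree at most \<open>n\<close> is the value of a polynomial of degree at most \<open>n\<close> in the generators,
namely of its normal form, and remains so after a change of the parameter.\<close>

lemma Shift_filt: "Shift c ` Yfilt d L s0 n = Yfilt d L s0 n"
proof -
  have sub: "Shift c y \<in> Yfilt d L s0 n" if y: "y \<in> Yfilt d L s0 n" for c y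
  proof -
    have yY: "y \<in> carrier (Yalg d L s0)" and yf: "y \<in> Alim_filt d L n" using y by (auto simp: Yfilt_def)
    obtain p where p: "p \<in> fcar G" "y = \<Psi> 0 p" using yY by (rule Y_obtain)
    obtain q where q: "q \<in> fcar G" "sorted_poly q" "p - q \<in> K" using p(1) by (rule normal_form)
    have yq: "y = \<Psi> 0 q" using Psi_eq_iff_K[OF p(1) q(1)] q(3) p(2) by simp
    then have "q \<in> fpol G tdeg n" using normal_filtration[OF q(1,2)] yf by simp
    then have "Shift c y \<in> Alim_filt d L n" using Psi_filt q(1) by (simp add: yq Shift_Psi)
    then show ?thesis using Shift_closed[OF yY] by (simp add: Yfilt_def)
  qed
  have "y \<in> Shift c ` Yfilt d L s0 n" if y: "y \<in> Yfilt d L s0 n" for y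
  proof (rule image_eqI)
    have "y \<in> carrier (Yalg d L s0)" using y by (simp add: Yfilt_def)
    then show "y = Shift c (Shift (- c) y)" by (simp add: Shift_add Shift_0)
  qed (rule sub[OF y])
  then show ?thesis using sub by blast
qed

end

theorem theorem7p10:
  fixes d L :: nat and s\<^sub>0 :: complex and ord :: "triple rel"
  assumes "d \<ge> 1" and "L \<ge> 2" and "linear_order_on (all_triples L) ord"
  shows
    "(\<forall>x\<in>gens d L. \<forall>y\<in>gens d L. \<exists>!r. is_comm_relation d L ord x y r) \<and>
     (\<forall>s. defining_relations (Yalg d L s\<^sub>0) (gens d L) (tlim d L s) (comm_relations d L ord)) \<and>
     (\<exists>Shift.
        group_action additive_C (carrier (Yalg d L s\<^sub>0)) Shift \<and>
        (\<forall>c. Shift c \<in> alg_aut (Yalg d L s\<^sub>0)) \<and>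
        (\<forall>c s. \<forall>x\<in>gens d L. Shift c (tlim d L s x) = tlim d L (s + c) x) \<and>
        (\<forall>c n. Shift c ` Yfilt d L s\<^sub>0 n = Yfilt d L s\<^sub>0 n))"
proof -
  interpret projective_limit d L ord using assms by unfold_locales
  have "Shift c (tlim d L s x) = tlim d L (s + c) x" if "x \<in> gens d L" for c s x
    using Shift_Psi[of "gen x" c s] that by (simp add: fcar_gen Psi_gen)
  then have "\<exists>Shift.
        group_action additive_C (carrier (Yalg d L s\<^sub>0)) Shift \<and>
        (\<forall>c. Shift c \<in> alg_aut (Yalg d L s\<^sub>0)) \<and>
        (\<forall>c s. \<forall>x\<in>gens d L. Shift c (tlim d L s x) = tlim d L (s + c) x) \<and>
        (\<forall>c n. Shift c ` Yfilt d L s\<^sub>0 n = Yfilt d L s\<^sub>0 n)"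
    by (intro exI[of _ Shift]) (simp add: Shift_action Shift_aut Shift_filt)
  moreover have "\<exists>!r. is_comm_relation d L ord x y r" if "x \<in> gens d L" "y \<in> gens d L" for x y
    using gens_commute[OF that] is_comm_relation_unique[OF that] by blast
  ultimately show ?thesis using Y_defining by simp
qed

end
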